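(* Let $(Y,d)$ be a compact geodesic metric space (with more than one point), let $\mu$ be a Borel probability measure on $Y$ such that $(Y,d,\mu)$ is Ahlfors regular, let $\Gamma$ be a finitely generated group acting on $Y$ by Lipschitz homeomorphisms, and let $X$ be any Banach space. Then the action of $\Gamma$ on $Y$ has a spectral gap in $L^2(Y,\mu;X)$ if and only if the family of metric spaces $(tY,d_\Gamma)_{t>0}=\mathcal{O}_\Gamma Y$ (the warped cone of the action) is quasi-isometric to an expander with respect to $X$.
   Context: **Ahlfors regularity.** $(Y,d,\mu)$ is Ahlfors regular if there are constants $c,m>0$ and $C\ge 1$ such that $c r^m\le \mu(B(y,r))\le C c r^m$ for all $y\in Y$ and $0<r\le 2\operatorname{diam} Y$, where $B(y,r)$ is the open ball. **Spectral gap.** Fix a finite generating set $S$ of $\Gamma$ closed under inverses. $L^2(Y,\mu;X)$ is the space of Bochner-measurable square-integrable $X$-valued functions on $Y$. The action has a spectral gap in $L^2(Y,\mu;X)$ if there is a constant $\kappa>0$ such that for every $f\in L^2(Y,\mu;X)$ $$\sum_{s\in S}\int_Y\|f(u)-f(s^{-1}u)\|_X^2\,d\mu(u)\ \ge\ \kappa\iint_{Y^2}\|f(u)-f(v)\|_X^2\,d\mu(u)\,d\mu(v).$$ **Warped cone.** $\mathcal{O}_\Gamma Y$ is the family of metric spaces $(tY)_{t>0}$, where $tY$ denotes the set $\{t\}\times Y$ (with points written $ty$, $y\in Y$), equipped with the largest metric $d_\Gamma$ such that $d_\Gamma(tx,ty)\le t\,d(x,y)$ for all $x,y\in Y$ and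 $d_\Gamma(ty,tsy)\le 1$ for all $y\in Y$, $s\in S$. (Another finite symmetric generating set yields uniformly Lipschitz equivalent metrics.) **Quasi-isometry.** A map $f\colon(Y_1,d_1)\to(Y_2,d_2)$ is a quasi-isometry if there are constants $A\ge0$, $C\ge1$, $B>0$ such that $C^{-1}d_1(x,y)-A\le d_2(f(x),f(y))\le C d_1(x,y)+A$ for all $x,y\in Y_1$ and the $B$-neighbourhood of the image of $f$ is all of $Y_2$. Two families of metric spaces with the same index set are quasi-isometric if there are quasi-isometries between the members with the same index, with constants $A,B,C$ independent of the index. Graphs are regarded as metric spaces (on their vertex sets) with the shortest-path metric. **Expander with respect to $X$.** A family $(G_i)_{i\in I}$ of finite graphs with uniformly bounded vertex degrees and unbounded cardinalities is an expander with respect to $X$ if there is a constant $\eta>0$ such that for every $i\in I$ and every function $f\colon G_i\to X$ (defined on vertices) $$\sum_{x\sim y}\|f(x)-f(y)\|_X^2\ \ge\ \frac{\eta}{\# G_i}\sum_{x,y\in G_i}\|f(x)-f(y)\|_X^2,$$ where the sums run over pairs of vertices of $G_i$, $x\sim y$ means that $x$ and $y$ are joined by an edge, and $\# G_i$ is the number of vertices. *)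

theory Defs
  imports
    "HOL-Probability.Probability"
    "HOL-Algebra.Generated_Groups"
    "HOL-Algebra.Group_Action"
    "Graph_Theory.Digraph_Component"
    "Graph_Theory.Pair_Digraph"
    "Graph_Theory.Shortest_Path"
begin

section \<open>Metric measure spaces\<close>

definition geodesic_space :: "'a::metric_space set \<Rightarrow> bool" where
  "geodesic_space Y \<longleftrightarrow>
     (\<forall>x\<in>Y. \<forall>y\<in>Y. \<exists>\<gamma>::real \<Rightarrow> 'a.
        \<gamma> \<in> {0..dist x y} \<rightarrow> Y \<and> \<gamma> 0 = x \<and> \<gamma> (dist x y) = y \<and>
        (\<forall>a\<in>{0..dist x y}. \<forall>b\<in>{0..dist x y}. dist (\<gamma> a) (\<gamma> b) = \<bar>a - b\<bar>))"

definition ahlfors_regular :: "'y::metric_space measure \<Rightarrow> bool" where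
  "ahlfors_regular \<mu> \<longleftrightarrow>
     (\<exists>c m C::real. c > 0 \<and> m > 0 \<and> C \<ge> 1 \<and>
        (\<forall>y r. 0 < r \<and> r \<le> 2 * diameter (UNIV::'y set) \<longrightarrow>
           c * r powr m \<le> measure \<mu> (ball y r) \<and>
           measure \<mu> (ball y r) \<le> C * c * r powr m))"

definition lipschitz_homeomorphism :: "('y::metric_space \<Rightarrow> 'y) \<Rightarrow> bool" where
  "lipschitz_homeomorphism h \<longleftrightarrow>
     (\<exists>g. homeomorphism UNIV UNIV h g) \<and> (\<exists>L. L-lipschitz_on UNIV h)"

section \<open>Spectral gap\<close>

text \<open>The target need not be separable, so measurability with respect to the Borel
  sigma-algebra would be too weak.\<close>

definition bochner_measurable :: "'y measure \<Rightarrow> ('y \<Rightarrow> 'x::real_normed_vector) \<Rightarrow> bool" where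
  "bochner_measurable \<mu> f \<longleftrightarrow>
     (\<exists>s. (\<forall>i::nat. simple_function \<mu> (s i)) \<and>
          (AE u in \<mu>. (\<lambda>i. s i u) \<longlonglongrightarrow> f u))"

definition bochner_L2 :: "'y measure \<Rightarrow> ('y \<Rightarrow> 'x::real_normed_vector) set" where
  "bochner_L2 \<mu> =
     {f. bochner_measurable \<mu> f \<and> (\<integral>\<^sup>+u. ennreal ((norm (f u))\<^sup>2) \<partial>\<mu>) < \<infinity>}"

text \<open>The elements of \<open>bochner_L2\<close> are only almost everywhere equal to Borel functions. Hence
  the nonnegative integral, which is insensitive to null sets, is used: the Lebesgue integral
  of HOL-Analysis is 0 by convention on functions that are not Borel measurable.\<close>

definition spectral_gap ::
  "'x::banach itself \<Rightarrow> ('g, 'b) monoid_scheme \<Rightarrow> ('g \<Rightarrow> 'y \<Rightarrow> 'y) \<Rightarrow> 'g set \<Rightarrow> 'y measure \<Rightarrow> bool"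
where
  "spectral_gap _ \<Gamma> \<phi> S \<mu> \<longleftrightarrow>
     (\<exists>\<kappa>::real. \<kappa> > 0 \<and>
        (\<forall>f \<in> (bochner_L2 \<mu> :: ('y \<Rightarrow> 'x) set).
           (\<Sum>s\<in>S. \<integral>\<^sup>+u. ennreal ((norm (f u - f (\<phi> (inv\<^bsub>\<Gamma>\<^esub> s) u)))\<^sup>2) \<partial>\<mu>) \<ge>
           ennreal \<kappa> * (\<integral>\<^sup>+(u, v). ennreal ((norm (f u - f v))\<^sup>2) \<partial>(\<mu> \<Otimes>\<^sub>M \<mu>))))"

section \<open>Warped cones\<close>

text \<open>The set \<open>{t} \<times> Y\<close> is identified with \<open>Y\<close> via \<open>ty \<mapsto> y\<close>; the level \<open>t\<close> only enters
  through the metric.\<close>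

definition warped_admissible ::
  "('g \<Rightarrow> 'y::metric_space \<Rightarrow> 'y) \<Rightarrow> 'g set \<Rightarrow> real \<Rightarrow> ('y \<Rightarrow> 'y \<Rightarrow> real) \<Rightarrow> bool" where
  "warped_admissible \<phi> S t \<delta> \<longleftrightarrow>
     Metric_space UNIV \<delta> \<and>
     (\<forall>x y. \<delta> x y \<le> t * dist x y) \<and>
     (\<forall>y. \<forall>s\<in>S. \<delta> y (\<phi> s y) \<le> 1)"

definition warped_metric ::
  "('g \<Rightarrow> 'y::metric_space \<Rightarrow> 'y) \<Rightarrow> 'g set \<Rightarrow> real \<Rightarrow> 'y \<Rightarrow> 'y \<Rightarrow> real" where
  "warped_metric \<phi> S t = (GREATEST \<delta>. warped_admissible \<phi> S t \<delta>)"

text \<open>For \<open>t > 0\<close> the greatest admissible metric (in the pointwise order) exists.\<close>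

lemma warped_metric_greatest:
  fixes \<phi> :: "'g \<Rightarrow> 'y::metric_space \<Rightarrow> 'y"
  assumes "t > 0"
  shows "warped_admissible \<phi> S t (warped_metric \<phi> S t)"
    and "warped_admissible \<phi> S t \<delta> \<Longrightarrow> \<delta> \<le> warped_metric \<phi> S t"
proof -
  let ?A = "Collect (warped_admissible \<phi> S t)"
  define D where "D = (\<lambda>x y. SUP \<delta>\<in>?A. \<delta> x y)"
  define \<rho> where "\<rho> = (\<lambda>x y::'y. min (t * dist x y) 1)"
  have tri: "\<rho> x z \<le> \<rho> x y + \<rho> y z" for x y z
  proof -
    have "t * dist x z \<le> t * (dist x y + dist y z)"
      using assms by (intro mult_left_mono dist_triangle) auto
    moreover have "0 \<le> t * dist x y" "0 \<le> t * dist y z" using assms by auto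
    ultimately show ?thesis by (auto simp: \<rho>_def min_def distrib_left)
  qed
  have \<rho>: "\<rho> \<in> ?A"
    unfolding mem_Collect_eq warped_admissible_def
  proof (intro conjI allI ballI)
    show "Metric_space UNIV \<rho>"
    proof
      show "\<rho> x z \<le> \<rho> x y + \<rho> y z" for x y z by (rule tri)
    qed (use assms in \<open>auto simp: \<rho>_def dist_commute min_def\<close>)
  qed (auto simp: \<rho>_def)
  have bdd: "bdd_above ((\<lambda>\<delta>. \<delta> x y) ` ?A)" for x y
    by (rule bdd_aboveI2[where M = "t * dist x y"]) (auto simp: warped_admissible_def)
  have le: "\<delta> x y \<le> D x y" if "\<delta> \<in> ?A" for \<delta> x y
    unfolding D_def by (rule cSUP_upper[OF that bdd])
  have least: "D x y \<le> b" if "\<And>\<delta>. \<delta> \<in> ?A \<Longrightarrow> \<delta> x y \<le> b" for x y b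
    unfolding D_def using \<rho> that by (intro cSUP_least) auto
  have met: "Metric_space UNIV \<delta>" if "\<delta> \<in> ?A" for \<delta>
    using that by (simp add: warped_admissible_def)
  have nonneg: "0 \<le> D x y" for x y
    using order_trans[OF _ le[OF \<rho>, of x y]] assms by (auto simp: \<rho>_def)
  have comm: "D x y = D y x" for x y
    unfolding D_def by (intro SUP_cong refl) (use Metric_space.commute[OF met] in blast)
  have triD: "D x z \<le> D x y + D y z" for x y z
  proof (rule least)
    fix \<delta> assume d: "\<delta> \<in> ?A"
    have "\<delta> x z \<le> \<delta> x y + \<delta> y z"
      using Metric_space.triangle[OF met[OF d]] by blast
    also have "\<dots> \<le> D x y + D y z" by (intro add_mono le d)
    finally show "\<delta> x z \<le> D x y + D y z" .
  qed
  have leD: "D x y \<le> t * dist x y" for x y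
    by (rule least) (auto simp: warped_admissible_def)
  have zero: "D x y = 0 \<longleftrightarrow> x = y" for x y
  proof
    assume "D x y = 0"
    then have "\<rho> x y \<le> 0" using le[OF \<rho>, of x y] by simp
    then show "x = y" using assms by (auto simp: \<rho>_def min_def mult_le_0_iff split: if_splits)
  next
    assume "x = y"
    then show "D x y = 0" using leD[of x y] nonneg[of x y] by simp
  qed
  have D: "warped_admissible \<phi> S t D"
    unfolding warped_admissible_def
  proof (intro conjI allI ballI)
    show "Metric_space UNIV D"
      by (rule Metric_space.intro) (rule nonneg comm zero triD)+
    show "D x y \<le> t * dist x y" for x y by (rule leD)
    show "D y (\<phi> s y) \<le> 1" if "s \<in> S" for y s
      by (rule least) (use that in \<open>auto simp: warped_admissible_def\<close>)
  qed
  have "warped_metric \<phi> S t = D"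
    unfolding warped_metric_def
    by (rule Greatest_equality, rule D) (auto simp: le_fun_def intro: le)
  then show "warped_admissible \<phi> S t (warped_metric \<phi> S t)"
    and "warped_admissible \<phi> S t \<delta> \<Longrightarrow> \<delta> \<le> warped_metric \<phi> S t"
    using D le by (auto simp: le_fun_def)
qed

section \<open>Quasi-isometries\<close>

definition quasi_isometry ::
  "real \<Rightarrow> real \<Rightarrow> real \<Rightarrow> 'a set \<Rightarrow> ('a \<Rightarrow> 'a \<Rightarrow> real) \<Rightarrow> 'b set \<Rightarrow> ('b \<Rightarrow> 'b \<Rightarrow> real) \<Rightarrow>
   ('a \<Rightarrow> 'b) \<Rightarrow> bool" where
  "quasi_isometry A B C Y1 d1 Y2 d2 f \<longleftrightarrow>
     f \<in> Y1 \<rightarrow> Y2 \<and>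
     (\<forall>x\<in>Y1. \<forall>y\<in>Y1. inverse C * d1 x y - A \<le> d2 (f x) (f y) \<and>
                       d2 (f x) (f y) \<le> C * d1 x y + A) \<and>
     (\<forall>z\<in>Y2. \<exists>x\<in>Y1. d2 (f x) z < B)"

definition quasi_isometric_families ::
  "'i set \<Rightarrow> ('i \<Rightarrow> 'a set) \<Rightarrow> ('i \<Rightarrow> 'a \<Rightarrow> 'a \<Rightarrow> real) \<Rightarrow>
   ('i \<Rightarrow> 'b set) \<Rightarrow> ('i \<Rightarrow> 'b \<Rightarrow> 'b \<Rightarrow> real) \<Rightarrow> bool" where
  "quasi_isometric_families I Y1 d1 Y2 d2 \<longleftrightarrow>
     (\<exists>A B C::real. A \<ge> 0 \<and> B > 0 \<and> C \<ge> 1 \<and>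
        (\<forall>i\<in>I. \<exists>f. quasi_isometry A B C (Y1 i) (d1 i) (Y2 i) (d2 i) f))"

section \<open>Graphs and expanders\<close>

text \<open>Finite simple graphs are the \<open>pair_graph\<close>s of Graph_Theory: every edge is represented
  by its two orientations in \<open>parcs\<close>. In particular, out-degrees are the usual vertex
  degrees.\<close>

text \<open>The shortest-path metric, a genuine metric on the vertices if the graph is connected;
  \<open>wf_digraph.\<mu>\<close> is the extended-real-valued infimum of the costs of all walks.\<close>

definition graph_metric :: "'v pair_pre_digraph \<Rightarrow> 'v \<Rightarrow> 'v \<Rightarrow> real" where
  "graph_metric G x y = real_of_ereal (wf_digraph.\<mu> (with_proj G) (\<lambda>_. 1) x y)"

definition expander_wrt ::
  "'x::banach itself \<Rightarrow> 'i set \<Rightarrow> ('i \<Rightarrow> 'v pair_pre_digraph) \<Rightarrow> bool" where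
  "expander_wrt _ I G \<longleftrightarrow>
     (\<forall>i\<in>I. pair_graph (G i)) \<and>
     (\<exists>k. \<forall>i\<in>I. \<forall>v\<in>pverts (G i). out_degree (with_proj (G i)) v \<le> k) \<and>
     (\<forall>n. \<exists>i\<in>I. card (pverts (G i)) > n) \<and>
     (\<exists>\<eta>::real. \<eta> > 0 \<and>
        (\<forall>i\<in>I. \<forall>f::'v \<Rightarrow> 'x.
           (\<Sum>(x, y)\<in>parcs (G i). (norm (f x - f y))\<^sup>2) \<ge>
           \<eta> / card (pverts (G i)) *
             (\<Sum>(x, y)\<in>pverts (G i) \<times> pverts (G i). (norm (f x - f y))\<^sup>2)))"

end

theory Submission
  imports Defs
begin

text \<open>
  Seen at unit scale, the level \<open>tY\<close> of the warped cone is \<open>Y\<close> seen at scale \<open>1/t\<close>, with additional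
  edges along the generators: points at bounded warped distance differ by a word of bounded length
  and an error of order \<open>1/t\<close> in \<open>Y\<close> (\<open>warped_metric_chain\<close>, \<open>warped_close_imp_word\<close>). By Ahlfors
  regularity, for large \<open>t\<close> all balls of radius \<open>1/t\<close> have measure of the same order \<open>1 / (t powr m)\<close>. Hence averages
  over the vertices of a graph that models \<open>tY\<close> are comparable to integrals over \<open>Y\<close>, sums over its
  edges are comparable to the energies of the generators, and the Poincare inequality of the graph is
  a discrete form of the spectral gap.

  From the gap to an expander, a maximal separated set at scale \<open>1/t\<close> is made into a graph whose edges
  are the steps of \<open>Y\<close> at this scale and the jumps along the generators. Because \<open>Y\<close> is geodesic, this
  graph is uniformly quasi-isometric to \<open>tY\<close>, and packing bounds its degrees. A function on the
  vertices is extended to a function that is constant on the Voronoi cells; for such functions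
  the spectral gap is a Poincare inequality (\<open>gap_imp_poincare\<close>).

  In the other direction the expander is an arbitrary family of graphs quasi-isometric to the
  cone. Its vertices are marked by points of \<open>Y\<close>, and a continuous function \<open>h\<close> is sampled at these points.
  The Poincare inequality for the samples bounds the double integral of \<open>h\<close> by the energies of words of
  bounded length, up to the modulus of continuity of \<open>h\<close> at scale \<open>1/t\<close>
  (\<open>poincare_imp_variation_bound\<close>). The error vanishes as \<open>t\<close> tends to infinity. Quasi-invariance of
  the measure under Lipschitz maps, again a consequence of Ahlfors regularity (\<open>measure_vimage_le\<close>),
  reduces words to generators (\<open>energy_word\<close>). It also makes the energies continuous in \<open>L\<^sup>2\<close>, so that
  the inequality passes from the dense subspace of continuous functions to all square-integrable
  ones (\<open>approximable_L2\<close>, \<open>continuous_gap_imp_L2_gap\<close>).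
\<close>

section \<open>Walks in finite graphs\<close>

text \<open>Only the lengths of walks matter below. They are therefore recorded as powers of the arc
  relation, for which concatenation, reversal and counting are elementary.\<close>

lemma awalk_imp_relpow:
  assumes "pair_graph G" "pre_digraph.awalk (with_proj G) x p y"
  shows "(x, y) \<in> parcs G ^^ length p"
proof -
  interpret pair_graph G by fact
  show ?thesis
    using assms(2)
  proof (induction p arbitrary: x)
    case (Cons e p)
    from Cons.prems have "e \<in> parcs G" "fst e = x" "awalk (snd e) p y"
      by (auto simp: awalk_Cons_iff)
    then have "(x, snd e) \<in> parcs G" and "(snd e, y) \<in> parcs G ^^ length p"
      using Cons.IH by auto
    then show ?case by (metis length_Cons relpow_Suc_I2)
  qed (auto simp: awalk_Nil_iff)
qed

lemma relpow_imp_awalk: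
  assumes "pair_graph G" "(x, y) \<in> parcs G ^^ n" "x \<in> pverts G"
  obtains p where "pre_digraph.awalk (with_proj G) x p y" "length p = n"
proof -
  interpret pair_graph G by fact
  have "\<exists>p. awalk x p y \<and> length p = n"
    using assms(2,3)
  proof (induction n arbitrary: x)
    case 0
    then show ?case by (auto simp: awalk_Nil_iff)
  next
    case (Suc n)
    from Suc.prems(1) obtain z where z: "(x, z) \<in> parcs G" "(z, y) \<in> parcs G ^^ n"
      by (metis relpow_Suc_D2)
    then obtain p where "awalk z p y" "length p = n"
      using Suc.IH in_arcsD2 by blast
    with z show ?case
      by (intro exI[of _ "(x, z) # p"]) (auto simp: awalk_Cons_iff in_arcsD1)
  qed
  then show ?thesis using that by blast
qed

lemma (in wf_digraph) awalk_cost_one: "awalk_cost (\<lambda>_. 1) p = real (length p)"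
  by (induction p) auto

lemma connected_iff_relpow:
  assumes G: "pair_graph G"
  shows "Digraph_Component.connected (with_proj G) \<longleftrightarrow>
    pverts G \<noteq> {} \<and> (\<forall>x\<in>pverts G. \<forall>y\<in>pverts G. \<exists>n. (x, y) \<in> parcs G ^^ n)"
proof -
  interpret pair_graph G by fact
  have eq: "x \<rightarrow>\<^sup>*\<^bsub>mk_symmetric (with_proj G)\<^esub> y \<longleftrightarrow> (\<exists>n. (x, y) \<in> parcs G ^^ n)"
    if "x \<in> pverts G" for x y
  proof -
    have "x \<rightarrow>\<^sup>*\<^bsub>mk_symmetric (with_proj G)\<^esub> y \<longleftrightarrow> (\<exists>p. awalk x p y)"
      by (simp add: reachable_mk_symmetric_eq[OF pair_sym_arcs] reachable_awalk)
    then show ?thesis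
      using awalk_imp_relpow[OF G] relpow_imp_awalk[OF G _ that] by blast
  qed
  show ?thesis
    unfolding Digraph_Component.connected_def strongly_connected_def by (simp add: eq)
qed

lemma graph_metric_eqI:
  assumes G: "pair_graph G" and x: "x \<in> pverts G"
    and n: "(x, y) \<in> parcs G ^^ n" and min: "\<And>k. (x, y) \<in> parcs G ^^ k \<Longrightarrow> n \<le> k"
  shows "graph_metric G x y = real n"
proof -
  interpret pair_graph G by fact
  obtain p where p: "awalk x p y" "length p = n"
    using relpow_imp_awalk[OF G n x] .
  have "\<mu> (\<lambda>_. 1) x y = ereal (real n)"
    unfolding \<mu>_def
  proof (rule INF_eqI)
    fix q assume "q \<in> {q. awalk x q y}"
    then have "n \<le> length q" using min awalk_imp_relpow[OF G] by auto
    then show "ereal (real n) \<le> ereal (awalk_cost (\<lambda>_. 1) q)"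
      by (simp add: awalk_cost_one)
  next
    fix b :: ereal assume "\<And>q. q \<in> {q. awalk x q y} \<Longrightarrow> b \<le> ereal (awalk_cost (\<lambda>_. 1) q)"
    from this[of p] p show "b \<le> ereal (real n)"
      by (simp add: awalk_cost_one)
  qed
  then show ?thesis by (simp add: graph_metric_def)
qed

lemma graph_metric_attained:
  assumes G: "pair_graph G" and con: "Digraph_Component.connected (with_proj G)"
    and x: "x \<in> pverts G" and y: "y \<in> pverts G"
  obtains n where "(x, y) \<in> parcs G ^^ n" "graph_metric G x y = real n"
    "\<And>k. (x, y) \<in> parcs G ^^ k \<Longrightarrow> n \<le> k"
proof -
  define n where "n = (LEAST n. (x, y) \<in> parcs G ^^ n)"
  have n: "(x, y) \<in> parcs G ^^ n"
    unfolding n_def by (rule LeastI_ex) (use con x y in \<open>auto simp: connected_iff_relpow[OF G]\<close>)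
  have min: "n \<le> k" if "(x, y) \<in> parcs G ^^ k" for k
    unfolding n_def using that by (rule Least_le)
  show ?thesis
    using that[OF n graph_metric_eqI[OF G x n min] min] .
qed

lemma graph_metric_le:
  assumes "pair_graph G" "x \<in> pverts G" "(x, y) \<in> parcs G ^^ n"
  shows "graph_metric G x y \<le> real n"
proof -
  define m where "m = (LEAST m. (x, y) \<in> parcs G ^^ m)"
  have m: "(x, y) \<in> parcs G ^^ m" "\<And>k. (x, y) \<in> parcs G ^^ k \<Longrightarrow> m \<le> k"
    unfolding m_def using assms(3) by (auto intro: LeastI Least_le)
  then show ?thesis using graph_metric_eqI[OF assms(1,2) m] m(2)[OF assms(3)] by simp
qed

lemma relpow_sym:
  assumes "sym R" "(x, y) \<in> R ^^ n"
  shows "(y, x) \<in> R ^^ n"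
  using assms(2)
  proof (induction n arbitrary: y)
  case (Suc n)
  then obtain z where "(x, z) \<in> R ^^ n" "(z, y) \<in> R" by auto
  then show ?case using Suc.IH symD[OF assms(1)] by (blast intro: relpow_Suc_I2)
qed simp

lemma pair_graph_sym: "pair_graph G \<Longrightarrow> sym (parcs G)"
  by (metis pair_sym_digraph.arcs_symmetric pair_graph.axioms(2) pair_pseudo_graph.axioms(2) symI)

lemma card_sphere_le:
  fixes R :: "('a \<times> 'a) set"
  assumes fin: "\<And>v. finite (R `` {v})" and deg: "\<And>v. card (R `` {v}) \<le> k"
  shows "finite {y. (x, y) \<in> R ^^ n} \<and> card {y. (x, y) \<in> R ^^ n} \<le> k ^ n"
proof (induction n)
  case (Suc n)
  let ?A = "{y. (x, y) \<in> R ^^ n}"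
  have eq: "{y. (x, y) \<in> R ^^ Suc n} = (\<Union>v\<in>?A. R `` {v})"
    by auto
  have "card (\<Union>v\<in>?A. R `` {v}) \<le> (\<Sum>v\<in>?A. card (R `` {v}))"
    using Suc by (intro card_UN_le) auto
  also have "\<dots> \<le> card ?A * k"
    using sum_bounded_above[of ?A "\<lambda>v. card (R `` {v})" k] deg by simp
  also have "\<dots> \<le> k ^ n * k" using Suc by (intro mult_right_mono) auto
  finally show ?case unfolding eq using Suc fin by (auto simp: mult.commute)
qed simp

lemma card_ball_le:
  fixes R :: "('a \<times> 'a) set"
  assumes fin: "\<And>v. finite (R `` {v})" and deg: "\<And>v. card (R `` {v}) \<le> k"
  shows "finite {y. \<exists>n\<le>N. (x, y) \<in> R ^^ n} \<and>
    card {y. \<exists>n\<le>N. (x, y) \<in> R ^^ n} \<le> (\<Sum>n\<le>N. k ^ n)"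
proof -
  have eq: "{y. \<exists>n\<le>N. (x, y) \<in> R ^^ n} = (\<Union>n\<in>{..N}. {y. (x, y) \<in> R ^^ n})" by auto
  have "card (\<Union>n\<in>{..N}. {y. (x, y) \<in> R ^^ n}) \<le> (\<Sum>n\<le>N. card {y. (x, y) \<in> R ^^ n})"
    by (rule card_UN_le) simp
  also have "\<dots> \<le> (\<Sum>n\<le>N. k ^ n)"
    by (intro sum_mono) (use card_sphere_le[OF assms] in blast)
  finally show ?thesis unfolding eq using card_sphere_le[OF assms] by auto
qed

lemma card_image_le_out_degree:
  assumes G: "pair_graph G" and deg: "\<And>v. v \<in> pverts G \<Longrightarrow> out_degree (with_proj G) v \<le> k"
  shows "finite (parcs G `` {v}) \<and> card (parcs G `` {v}) \<le> k"
proof -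
  interpret pair_graph G by fact
  have eq: "parcs G `` {v} = snd ` {e \<in> parcs G. fst e = v}" by force
  have "card (parcs G `` {v}) \<le> card {e \<in> parcs G. fst e = v}"
    unfolding eq by (intro card_image_le) (simp add: pair_finite_arcs)
  moreover have "card {e \<in> parcs G. fst e = v} \<le> k"
  proof (cases "v \<in> pverts G")
    case True
    then show ?thesis using deg[of v] by (simp add: out_degree_def out_arcs_def)
  next
    case False
    then have "{e \<in> parcs G. fst e = v} = {}" using arc_fst_in_verts by fastforce
    then show ?thesis by (metis card.empty le0)
  qed
  moreover have "finite (parcs G `` {v})" unfolding eq by (simp add: pair_finite_arcs)
  ultimately show ?thesis by linarith
qed

section \<open>Chains and the warped metric\<close>

text \<open>The group enters only through its generators: \<open>J\<close> is inversion on \<open>S\<close>, and \<open>L\<close> is a common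
  Lipschitz constant of the generators, hence also of their inverses.\<close>

locale symmetric_maps =
  fixes \<phi> :: "'g \<Rightarrow> 'y::metric_space \<Rightarrow> 'y" and S :: "'g set" and J :: "'g \<Rightarrow> 'g" and L :: real
  assumes finite_S: "finite S"
    and J_closed: "s \<in> S \<Longrightarrow> J s \<in> S"
    and J_J: "s \<in> S \<Longrightarrow> J (J s) = s"
    and J_left: "s \<in> S \<Longrightarrow> \<phi> (J s) (\<phi> s y) = y"
    and L_ge_1: "1 \<le> L"
    and lip: "s \<in> S \<Longrightarrow> dist (\<phi> s x) (\<phi> s y) \<le> L * dist x y"

text \<open>A chain with \<open>n\<close> jumps and length \<open>l\<close> alternates moves in \<open>Y\<close>, of total length \<open>l\<close>, with \<open>n\<close>
  applications of generators. It begins and ends with a move, possibly of length 0, so that two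
  consecutive moves are always merged into one. At level \<open>t\<close> its cost is \<open>n + t * l\<close>.\<close>

inductive chain :: "('g \<Rightarrow> 'y::metric_space \<Rightarrow> 'y) \<Rightarrow> 'g set \<Rightarrow> nat \<Rightarrow> real \<Rightarrow> 'y \<Rightarrow> 'y \<Rightarrow> bool"
  for \<phi> S where
  move: "chain \<phi> S 0 (dist x y) x y"
| jump: "chain \<phi> S n l x y \<Longrightarrow> s \<in> S \<Longrightarrow> chain \<phi> S (Suc n) (l + dist (\<phi> s y) z) x z"

lemma chain_nonneg: "chain \<phi> S n l x y \<Longrightarrow> 0 \<le> l"
  by (induction rule: chain.induct) auto

lemma chain_zero: "chain \<phi> S 0 l x y \<Longrightarrow> l = dist x y"
  by (auto elim: chain.cases)

lemma chain_move:
  assumes "chain \<phi> S n l x y"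
  shows "\<exists>l'\<le>l + dist y z. chain \<phi> S n l' x z"
  using assms
proof cases
  case move
  then show ?thesis using chain.move[of \<phi> S x z] dist_triangle[of x z y] by auto
next
  case (jump n' l' y' s)
  have "chain \<phi> S (Suc n') (l' + dist (\<phi> s y') z) x z"
    using jump by (intro chain.jump)
  moreover have "l' + dist (\<phi> s y') z \<le> l + dist y z"
    using jump dist_triangle[of "\<phi> s y'" z y] by auto
  ultimately show ?thesis using jump by blast
qed

lemma chain_trans:
  assumes "chain \<phi> S n' l' y z" "chain \<phi> S n l x y"
  shows "\<exists>k\<le>l + l'. chain \<phi> S (n + n') k x z"
  using assms
proof (induction rule: chain.induct)
  case (move y z)
  then show ?case using chain_move[of \<phi> S n l x y z] by simp
next
  case (jump n' l' y y' s z)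
  then obtain k where k: "k \<le> l + l'" "chain \<phi> S (n + n') k x y'" by blast
  then have "chain \<phi> S (Suc (n + n')) (k + dist (\<phi> s y') z) x z"
    using jump by (intro chain.jump)
  then show ?case using k by (intro exI[of _ "k + dist (\<phi> s y') z"]) auto
qed

text \<open>Reversing a chain undoes each jump with the inverse generator.\<close>

lemma (in symmetric_maps) chain_sym:
  assumes "chain \<phi> S n l x y"
  shows "\<exists>k\<le>l. chain \<phi> S n k y x"
  using assms
proof (induction rule: chain.induct)
  case (move x y)
  then show ?case using chain.move[of \<phi> S y x] by (auto simp: dist_commute)
next
  case (jump n l x y s z)
  then obtain k where k: "k \<le> l" "chain \<phi> S n k y x" by blast
  have "chain \<phi> S (Suc 0) (dist z (\<phi> s y) + dist (\<phi> (J s) (\<phi> s y)) y) z y"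
    using jump J_closed by (intro chain.jump chain.move)
  then have "chain \<phi> S (Suc 0) (dist z (\<phi> s y)) z y"
    using jump J_left by simp
  then obtain k' where "k' \<le> dist z (\<phi> s y) + k" "chain \<phi> S (Suc 0 + n) k' z x"
    using chain_trans[OF k(2)] by blast
  with k show ?case by (intro exI[of _ k']) (auto simp: dist_commute)
qed

text \<open>The infimum of the costs of all chains is an admissible metric (in fact the largest one),
  so the warped metric is at least this infimum.\<close>

lemma (in symmetric_maps) warped_metric_chain:
  assumes t: "t > 0" and e: "e > 0"
  shows "\<exists>n l. chain \<phi> S n l x y \<and> real n + t * l < warped_metric \<phi> S t x y + e"
proof -
  define cost where "cost x y = {real n + t * l |n l. chain \<phi> S n l x y}" for x y
  define D where "D x y = Inf (cost x y)" for x y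
  have ne: "cost x y \<noteq> {}" for x y
    unfolding cost_def using chain.move by blast
  have pos: "0 \<le> c" if "c \<in> cost x y" for c x y
    using that t chain_nonneg unfolding cost_def by fastforce
  have bdd: "bdd_below (cost x y)" for x y
    using pos by (rule bdd_belowI)
  have le: "D x y \<le> real n + t * l" if "chain \<phi> S n l x y" for n l x y
    unfolding D_def using that by (intro cInf_lower bdd) (auto simp: cost_def)
  have near: "\<exists>n l. chain \<phi> S n l x y \<and> real n + t * l < D x y + e" if "e > 0" for x y e
  proof -
    have "Inf (cost x y) < D x y + e" using that by (simp add: D_def)
    then show ?thesis using cInf_lessD[OF ne] unfolding cost_def by blast
  qed
  have nonneg: "0 \<le> D x y" for x y
    unfolding D_def using ne pos by (intro cInf_greatest) auto
  have "warped_admissible \<phi> S t D"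
    unfolding warped_admissible_def
  proof (intro conjI allI ballI)
    have le_sym: "D y x \<le> D x y" for x y
    proof (rule field_le_epsilon)
      fix e :: real assume "e > 0"
      then obtain n l where nl: "chain \<phi> S n l x y" "real n + t * l < D x y + e"
        using near by blast
      obtain k where "k \<le> l" "chain \<phi> S n k y x" using chain_sym[OF nl(1)] by blast
      then have "D y x \<le> real n + t * k" "t * k \<le> t * l" using le t by auto
      then show "D y x \<le> D x y + e" using nl by linarith
    qed
    show "Metric_space UNIV D"
    proof
      show "0 \<le> D x y" for x y by (rule nonneg)
      show "D x y = D y x" for x y using le_sym by (intro antisym)
      show "D x y = 0 \<longleftrightarrow> x = y" for x y
      proof
        assume D0: "D x y = 0"
        have "t * dist x y \<le> 0"
        proof (rule field_le_epsilon)
          fix e :: real assume "e > 0"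
          then obtain n l where nl: "chain \<phi> S n l x y" "real n + t * l < D x y + min e 1"
            using near[of "min e 1" x y] by auto
          have "0 \<le> t * l" using chain_nonneg[OF nl(1)] t by simp
          then have "n = 0" using nl D0 by linarith
          then show "t * dist x y \<le> 0 + e" using nl D0 chain_zero by fastforce
        qed
        then show "x = y" using t by (simp add: mult_le_0_iff)
      next
        assume "x = y"
        then show "D x y = 0" using le[OF chain.move[of \<phi> S x y]] nonneg[of x y] by simp
      qed
      show "D x z \<le> D x y + D y z" for x y z
      proof (rule field_le_epsilon)
        fix e :: real assume "e > 0"
        then obtain n l n' l' where nl: "chain \<phi> S n l x y" "real n + t * l < D x y + e/2"
          and nl': "chain \<phi> S n' l' y z" "real n' + t * l' < D y z + e/2"
          using near[of "e/2"] by (meson half_gt_zero)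
        obtain k where k: "k \<le> l + l'" "chain \<phi> S (n + n') k x z"
          using chain_trans[OF nl'(1) nl(1)] by blast
        have "t * k \<le> t * l + t * l'" using k(1) t by (simp flip: distrib_left)
        then show "D x z \<le> D x y + D y z + e" using le[OF k(2)] nl nl' by simp
      qed
    qed
    show "D x y \<le> t * dist x y" for x y
      using le[OF chain.move[of \<phi> S x y]] by simp
    show "D y (\<phi> s y) \<le> 1" if "s \<in> S" for y s
      using le[OF chain.jump[OF chain.move[of \<phi> S y y] that, of "\<phi> s y"]] by simp
  qed
  then have "D \<le> warped_metric \<phi> S t"
    by (rule warped_metric_greatest(2)[OF t])
  then have "D x y \<le> warped_metric \<phi> S t x y"
    by (simp add: le_fun_def)
  then show ?thesis using near[OF e, of x y] by force
qed

text \<open>All jumps of a chain can be performed before all moves, at the price of the Lipschitz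
  constant for every jump that is pulled in front.\<close>

lemma (in symmetric_maps) chain_imp_word:
  assumes "chain \<phi> S n l x y"
  shows "\<exists>w. set w \<subseteq> S \<and> length w = n \<and> dist (foldr \<phi> w x) y \<le> L ^ n * l"
  using assms
proof (induction rule: chain.induct)
  case (move x y)
  then show ?case by (intro exI[of _ "[]"]) auto
next
  case (jump n l x y s z)
  then obtain w where w: "set w \<subseteq> S" "length w = n" "dist (foldr \<phi> w x) y \<le> L ^ n * l" by blast
  have "dist (\<phi> s (foldr \<phi> w x)) z \<le> dist (\<phi> s (foldr \<phi> w x)) (\<phi> s y) + dist (\<phi> s y) z"
    by (rule dist_triangle)
  also have "\<dots> \<le> L * (L ^ n * l) + L ^ Suc n * dist (\<phi> s y) z"
  proof (rule add_mono)
    show "dist (\<phi> s (foldr \<phi> w x)) (\<phi> s y) \<le> L * (L ^ n * l)"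
      using lip[OF jump.hyps(2), of "foldr \<phi> w x" y] mult_left_mono[OF w(3), of L] L_ge_1 by linarith
    show "dist (\<phi> s y) z \<le> L ^ Suc n * dist (\<phi> s y) z"
      using mult_right_mono[OF one_le_power[OF L_ge_1], of "dist (\<phi> s y) z" "Suc n"] by simp
  qed
  also have "\<dots> = L ^ Suc n * (l + dist (\<phi> s y) z)" by (simp add: algebra_simps)
  finally show ?case using w jump.hyps by (intro exI[of _ "s # w"]) auto
qed

text \<open>Points at bounded warped distance are, up to an error of order \<open>1/t\<close> in \<open>Y\<close>, joined by a word of
  bounded length. This is how the geometry of the warped cone is turned back into the action.\<close>

lemma (in symmetric_maps) warped_close_imp_word:
  assumes t: "t > 0" and R: "warped_metric \<phi> S t x y \<le> R"
  shows "\<exists>w. set w \<subseteq> S \<and> real (length w) \<le> R + 1 \<and>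
    dist (foldr \<phi> w x) y \<le> L ^ nat \<lfloor>R + 1\<rfloor> * (R + 1) / t"
proof -
  obtain n l where nl: "chain \<phi> S n l x y" "real n + t * l < R + 1"
    using warped_metric_chain[OF t zero_less_one, of x y] R by force
  note l = chain_nonneg[OF nl(1)]
  have n: "real n \<le> R + 1" using nl(2) t l by (smt (verit) mult_nonneg_nonneg)
  have "t * l \<le> R + 1" using nl(2) by linarith
  then have l': "l \<le> (R + 1) / t" using t by (simp add: field_simps)
  obtain w where w: "set w \<subseteq> S" "length w = n" "dist (foldr \<phi> w x) y \<le> L ^ n * l"
    using chain_imp_word[OF nl(1)] by blast
  have "n \<le> nat \<lfloor>R + 1\<rfloor>" by (rule le_nat_floor[OF n])
  then have "L ^ n * l \<le> L ^ nat \<lfloor>R + 1\<rfloor> * ((R + 1) / t)"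
    using L_ge_1 l l' by (intro mult_mono power_increasing) auto
  then show ?thesis using w n by (intro exI[of _ w]) auto
qed

lemma (in symmetric_maps) word_lipschitz:
  assumes "set w \<subseteq> S"
  shows "dist (foldr \<phi> w x) (foldr \<phi> w y) \<le> L ^ length w * dist x y"
  using assms
proof (induction w)
  case (Cons s w)
  have "dist (\<phi> s (foldr \<phi> w x)) (\<phi> s (foldr \<phi> w y)) \<le> L * dist (foldr \<phi> w x) (foldr \<phi> w y)"
    using Cons by (intro lip) auto
  also have "\<dots> \<le> L * (L ^ length w * dist x y)"
    using Cons L_ge_1 by (intro mult_left_mono) auto
  finally show ?case by (simp add: algebra_simps)
qed simp

section \<open>Ahlfors regular probability measures\<close>

lemma ball_subset_ballI:
  fixes x y :: "'a::metric_space"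
  assumes "dist x y + r \<le> s"
  shows "ball x r \<subseteq> ball y s"
proof
  fix z assume "z \<in> ball x r"
  then show "z \<in> ball y s" using assms dist_triangle[of y z x] by (simp add: dist_commute)
qed

text \<open>In the application \<open>D\<close> is the diameter of \<open>Y\<close>.\<close>

locale ahlfors_space = prob_space \<mu> for \<mu> :: "'y::metric_space measure" +
  fixes c m C D :: real
  assumes compact_UNIV: "compact (UNIV :: 'y set)"
    and sets_\<mu> [measurable_cong]: "sets \<mu> = sets borel"
    and D_pos: "0 < D" and dist_le_D: "\<And>x y :: 'y. dist x y \<le> D"
    and c_pos: "0 < c" and m_pos: "0 < m" and C_pos: "0 < C"
    and ball_lower: "0 < r \<Longrightarrow> r \<le> 2 * D \<Longrightarrow> c * r powr m \<le> measure \<mu> (ball y r)"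
    and ball_upper_small:
      "0 < r \<Longrightarrow> r \<le> 2 * D \<Longrightarrow> measure \<mu> (ball y r) \<le> C * c * r powr m"
begin

lemma space_\<mu> [simp]: "space \<mu> = UNIV"
  using sets_\<mu> by (metis sets_eq_imp_space_eq space_borel)

lemma open_sets: "open A \<Longrightarrow> A \<in> sets \<mu>" and closed_sets: "closed A \<Longrightarrow> A \<in> sets \<mu>"
  by (auto simp: sets_\<mu>)

lemma ball_sets [simp, measurable]: "ball y r \<in> sets \<mu>"
  by (rule open_sets) simp

lemma continuous_measurable:
  "continuous_on UNIV f \<Longrightarrow> f \<in> borel_measurable \<mu>"
  using borel_measurable_continuous_onI measurable_cong_sets[OF sets_\<mu> refl] by blast

text \<open>A ball of radius at least \<open>2 * D\<close> is the whole space, as is the ball of radius \<open>2 * D\<close>, so the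
  upper bound persists at all scales.\<close>

lemma ball_upper:
  assumes "0 < r"
  shows "measure \<mu> (ball y r) \<le> C * c * r powr m"
proof (cases "r \<le> 2 * D")
  case False
  have "ball y (2 * D) = UNIV"
    using dist_le_D[of y] D_pos by (force simp: set_eq_iff intro: le_less_trans)
  then have "measure \<mu> (ball y r) \<le> measure \<mu> (ball y (2 * D))"
    by (metis finite_measure_mono sets.top space_\<mu> subset_UNIV)
  also have "\<dots> \<le> C * c * (2 * D) powr m"
    using D_pos by (intro ball_upper_small) auto
  also have "\<dots> \<le> C * c * r powr m"
    using False D_pos m_pos c_pos C_pos by (intro mult_left_mono powr_mono2) auto
  finally show ?thesis .
qed (use ball_upper_small assms in auto)

text \<open>Every point is counted at most \<open>M\<close> times. With \<open>g\<close> the indicator of a set this bounds the number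
  of balls inside the set; in general it replaces a sum of local averages by a single integral.\<close>

lemma bounded_overlap:
  fixes p :: "'i \<Rightarrow> 'y" and g :: "'y \<Rightarrow> ennreal"
  assumes fin: "finite I" and g [measurable]: "g \<in> borel_measurable \<mu>"
    and M: "\<And>u. card {x \<in> I. u \<in> ball (p x) \<rho>} \<le> M"
  shows "(\<Sum>x\<in>I. \<integral>\<^sup>+u. g u * indicator (ball (p x) \<rho>) u \<partial>\<mu>) \<le> of_nat M * (\<integral>\<^sup>+u. g u \<partial>\<mu>)"
proof -
  have "(\<Sum>x\<in>I. \<integral>\<^sup>+u. g u * indicator (ball (p x) \<rho>) u \<partial>\<mu>)
      = (\<integral>\<^sup>+u. (\<Sum>x\<in>I. g u * indicator (ball (p x) \<rho>) u) \<partial>\<mu>)"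
    by (subst nn_integral_sum) auto
  also have "\<dots> \<le> (\<integral>\<^sup>+u. of_nat M * g u \<partial>\<mu>)"
  proof (rule nn_integral_mono)
    fix u
    have "(\<Sum>x\<in>I. g u * indicator (ball (p x) \<rho>) u)
        = g u * of_nat (card {x \<in> I. u \<in> ball (p x) \<rho>})"
      using fin by (simp add: sum_distrib_left[symmetric] indicator_def sum.If_cases Int_def)
    also have "\<dots> \<le> g u * of_nat M" using M by (intro mult_left_mono) auto
    finally show "(\<Sum>x\<in>I. g u * indicator (ball (p x) \<rho>) u) \<le> of_nat M * g u"
      by (simp add: mult.commute)
  qed
  also have "\<dots> = of_nat M * (\<integral>\<^sup>+u. g u \<partial>\<mu>)" by (rule nn_integral_cmult) simp
  finally show ?thesis .
qed

lemma card_balls_le: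
  fixes p :: "'i \<Rightarrow> 'y"
  assumes fin: "finite I" and M: "\<And>u. card {x \<in> I. u \<in> ball (p x) \<rho>} \<le> M"
    and \<rho>: "0 < \<rho>" "\<rho> \<le> 2 * D" and A: "A \<in> sets \<mu>" "\<And>x. x \<in> I \<Longrightarrow> ball (p x) \<rho> \<subseteq> A"
  shows "real (card I) * (c * \<rho> powr m) \<le> real M * measure \<mu> A"
proof -
  have "ennreal (real (card I) * (c * \<rho> powr m)) = (\<Sum>x\<in>I. ennreal (c * \<rho> powr m))"
    by (simp add: ennreal_mult c_pos less_imp_le ennreal_of_nat_eq_real_of_nat)
  also have "\<dots> \<le> (\<Sum>x\<in>I. \<integral>\<^sup>+u. indicator A u * indicator (ball (p x) \<rho>) u \<partial>\<mu>)"
  proof (rule sum_mono)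
    fix x assume x: "x \<in> I"
    have "ennreal (c * \<rho> powr m) \<le> emeasure \<mu> (ball (p x) \<rho>)"
      unfolding emeasure_eq_measure using \<rho> by (intro ennreal_leI ball_lower)
    also have "\<dots> = (\<integral>\<^sup>+u. indicator (ball (p x) \<rho>) u \<partial>\<mu>)" by simp
    also have "\<dots> = (\<integral>\<^sup>+u. indicator A u * indicator (ball (p x) \<rho>) u \<partial>\<mu>)"
      using A(2)[OF x] by (intro nn_integral_cong) (auto simp: indicator_def)
    finally show "ennreal (c * \<rho> powr m) \<le> \<dots>" .
  qed
  also have "\<dots> \<le> of_nat M * (\<integral>\<^sup>+u. indicator A u \<partial>\<mu>)"
    using A by (intro bounded_overlap fin M) auto
  also have "\<dots> = ennreal (real M * measure \<mu> A)"
    using A by (simp add: emeasure_eq_measure ennreal_mult ennreal_of_nat_eq_real_of_nat)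
  finally show ?thesis by (simp add: ennreal_le_iff)
qed

lemma separated_overlap:
  fixes p :: "'i \<Rightarrow> 'y"
  assumes "finite I" and sep: "\<And>x y. x \<in> I \<Longrightarrow> y \<in> I \<Longrightarrow> x \<noteq> y \<Longrightarrow> r \<le> dist (p x) (p y)"
  shows "card {x \<in> I. u \<in> ball (p x) (r/2)} \<le> 1"
proof -
  have "x = y" if "x \<in> I" "u \<in> ball (p x) (r/2)" "y \<in> I" "u \<in> ball (p y) (r/2)" for x y
    using sep[of x y] that dist_triangle_half_l[of "p x" u r "p y"] by (auto simp: dist_commute)
  then show ?thesis
    using \<open>finite I\<close> by (subst One_nat_def, subst card_le_Suc0_iff_eq) (auto simp del: mem_ball)
qed

text \<open>The balls of radius \<open>r/2\<close> around \<open>r\<close>-separated points are disjoint and have measure at least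
  of order \<open>r powr m\<close>, while they all lie in one ball of comparable radius.\<close>

lemma packing_ball:
  fixes p :: "'i \<Rightarrow> 'y"
  assumes fin: "finite I" and sep: "\<And>x y. x \<in> I \<Longrightarrow> y \<in> I \<Longrightarrow> x \<noteq> y \<Longrightarrow> r \<le> dist (p x) (p y)"
    and r: "0 < r" "r \<le> D" and K: "0 \<le> K" and near: "\<And>x. x \<in> I \<Longrightarrow> dist y (p x) \<le> K * r"
  shows "real (card I) \<le> C * (2 * K + 2) powr m"
proof -
  have "real (card I) * (c * (r/2) powr m) \<le> real 1 * measure \<mu> (ball y ((K + 1) * r))"
  proof (rule card_balls_le[OF fin])
    show "card {x \<in> I. u \<in> ball (p x) (r/2)} \<le> 1" for u
      by (rule separated_overlap[OF fin sep])
    fix x assume "x \<in> I"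
    from near[OF this] show "ball (p x) (r/2) \<subseteq> ball y ((K + 1) * r)"
      using r by (intro ball_subset_ballI) (auto simp: dist_commute algebra_simps)
  qed (use r D_pos in auto)
  also have "\<dots> \<le> C * c * ((K + 1) * r) powr m"
    using r K by (simp add: ball_upper)
  also have "((K + 1) * r) powr m = (2 * K + 2) powr m * (r/2) powr m"
    using r K by (subst powr_mult[symmetric]) (auto simp: algebra_simps add_divide_distrib)
  finally have "real (card I) * (c * (r/2) powr m) \<le> (C * (2 * K + 2) powr m) * (c * (r/2) powr m)"
    by (simp add: mult_ac)
  then show ?thesis using r c_pos by (auto simp: mult_le_cancel_right)
qed

text \<open>The packing bound makes the cardinality of \<open>r\<close>-separated sets bounded, and an \<open>r\<close>-separated set
  of maximal cardinality cannot miss any point by \<open>r\<close>.\<close>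

lemma net_exists:
  assumes r: "0 < r" "r \<le> D"
  shows "\<exists>(n::nat) p :: nat \<Rightarrow> 'y.
    (\<forall>i<n. \<forall>j<n. i \<noteq> j \<longrightarrow> r \<le> dist (p i) (p j)) \<and> (\<forall>u. \<exists>i<n. dist u (p i) < r)"
proof -
  define sep where "sep P \<longleftrightarrow> finite P \<and> (\<forall>x\<in>P. \<forall>y\<in>P. x \<noteq> y \<longrightarrow> r \<le> dist x y)" for P :: "'y set"
  have bound: "card P < Suc (nat \<lfloor>C * (2 * (D/r) + 2) powr m\<rfloor>)" if "sep P" for P
  proof -
    have "real (card P) \<le> C * (2 * (D/r) + 2) powr m"
      using that r D_pos dist_le_D by (intro packing_ball[where p = "\<lambda>x. x" and r = r]) (auto simp: sep_def)
    then show ?thesis by (simp add: le_nat_floor less_Suc_eq_le)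
  qed
  have "sep {}" by (simp add: sep_def)
  then obtain P where P: "sep P" "\<And>Q. sep Q \<Longrightarrow> card Q \<le> card P"
    using ex_has_greatest_nat[of sep "{}" card] bound by blast
  have cover: "\<exists>x\<in>P. dist u x < r" for u
  proof (rule ccontr)
    assume neg: "\<not> (\<exists>x\<in>P. dist u x < r)"
    then have "sep (insert u P)" "u \<notin> P"
      using P(1) r by (auto simp: sep_def dist_commute not_less)
    then show False using P(2)[of "insert u P"] P(1) by (simp add: sep_def)
  qed
  obtain p where p: "bij_betw p {0..<card P} P"
    using ex_bij_betw_nat_finite[of P] P(1) unfolding sep_def by blast
  show ?thesis
  proof (rule exI[of _ "card P"], rule exI[of _ p], intro conjI allI impI)
    fix i j assume "i < card P" "j < card P" "i \<noteq> j"
    then have "p i \<in> P" "p j \<in> P" "p i \<noteq> p j"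
      using p by (auto simp: bij_betw_def dest: inj_onD)
    then show "r \<le> dist (p i) (p j)"
      using P(1) by (auto simp: sep_def)
  next
    fix u
    obtain x where "x \<in> P" "dist u x < r" using cover by blast
    then show "\<exists>i<card P. dist u (p i) < r"
      using p unfolding bij_betw_def by (metis atLeast0LessThan imageE lessThan_iff)
  qed
qed

text \<open>The sets that are squeezed between a closed and an open set with difference of small measure
  form a sigma-algebra. It contains the open sets, because they are increasing unions of closed
  sets defined by the distance to the complement.\<close>

lemma regular_closed_open:
  assumes A: "A \<in> sets \<mu>" and e: "e > 0"
  shows "\<exists>F U. closed F \<and> open U \<and> F \<subseteq> A \<and> A \<subseteq> U \<and> measure \<mu> (U - F) < e"
proof -
  have "A \<in> sigma_sets UNIV {S::'y set. open S}"
    using A by (simp add: sets_\<mu> borel_def)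
  then show ?thesis using e
  proof (induction arbitrary: e rule: sigma_sets.induct)
    case (Basic A)
    then have A: "open A" by simp
    show ?case
    proof (cases "A = UNIV")
      case True
      then show ?thesis using Basic by (intro exI[of _ UNIV]) auto
    next
      case False
      define F where "F k = {u. 1 / real (Suc k) \<le> infdist u (-A)}" for k
      have cl: "closed (F k)" for k
        unfolding F_def by (intro closed_Collect_le continuous_intros)
      have inA: "u \<in> A \<longleftrightarrow> 0 < infdist u (-A)" for u
        using in_closed_iff_infdist_zero[of "-A" u] infdist_nonneg[of u "-A"] A False
        by (auto simp: closed_Compl less_le)
      have UN: "(\<Union>k. F k) = A"
      proof safe
        fix u k assume "u \<in> F k"
        then show "u \<in> A" unfolding inA F_def
          by (auto intro: less_le_trans[rotated])
      next
        fix u assume "u \<in> A"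
        then obtain k where "1 / real (Suc k) < infdist u (-A)"
          unfolding inA using nat_approx_posE by blast
        then show "u \<in> (\<Union>k. F k)" by (auto simp: F_def intro: less_imp_le)
      qed
      have "incseq F"
        unfolding F_def incseq_def by (auto elim: order_trans[rotated] simp: frac_le)
      then have "(\<lambda>k. measure \<mu> (F k)) \<longlonglongrightarrow> measure \<mu> (\<Union>k. F k)"
        using cl by (intro finite_Lim_measure_incseq) (auto intro: closed_sets)
      then have "eventually (\<lambda>k. measure \<mu> A - e < measure \<mu> (F k)) sequentially"
        unfolding UN using \<open>e > 0\<close> by (intro order_tendstoD) auto
      then obtain k where k: "measure \<mu> A - e < measure \<mu> (F k)"
        using eventually_happens'[OF sequentially_bot] by blast
      have "F k \<subseteq> A" using UN by blast
      then have "measure \<mu> (A - F k) = measure \<mu> A - measure \<mu> (F k)"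
        using A cl by (intro finite_measure_Diff open_sets closed_sets) auto
      then show ?thesis using k A cl \<open>F k \<subseteq> A\<close> by (intro exI[of _ "F k"] exI[of _ A]) auto
    qed
  next
    case Empty
    then show ?case by (intro exI[of _ "{}"]) auto
  next
    case (Compl A)
    obtain F U where "closed F" "open U" "F \<subseteq> A" "A \<subseteq> U" "measure \<mu> (U - F) < e"
      using Compl.IH[OF Compl.prems] by blast
    moreover have "- F - - U = U - F" by auto
    ultimately show ?case
      by (intro exI[of _ "-U"] exI[of _ "-F"]) (auto simp: Compl_eq_Diff_UNIV[symmetric])
  next
    case (Union A)
    define d where "d k = e / 2 * (1/2) ^ Suc k" for k
    have d: "d k > 0" for k using Union.prems by (simp add: d_def)
    have "\<exists>F U. closed F \<and> open U \<and> F \<subseteq> A k \<and> A k \<subseteq> U \<and> measure \<mu> (U - F) < d k" for k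
      by (rule Union.IH[OF d])
    then obtain F U where FU: "\<And>k. closed (F k)" "\<And>k. open (U k)" "\<And>k. F k \<subseteq> A k"
      "\<And>k. A k \<subseteq> U k" "\<And>k. measure \<mu> (U k - F k) < d k"
      by metis
    have ms: "F k \<in> sets \<mu>" "U k \<in> sets \<mu>" for k using FU by (auto intro: open_sets closed_sets)
    have sums_d: "d sums (e/2)"
      unfolding d_def by (metis mult.right_neutral power_half_series sums_mult)
    have summ: "summable (\<lambda>k. measure \<mu> (U k - F k))"
      by (rule summable_comparison_test'[OF sums_summable[OF sums_d], of 0])
        (use FU(5) in \<open>auto intro: less_imp_le\<close>)
    have "measure \<mu> ((\<Union>k. U k) - (\<Union>k. F k)) \<le> measure \<mu> (\<Union>k. U k - F k)"
      using ms by (intro finite_measure_mono) auto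
    also have "\<dots> \<le> (\<Sum>k. measure \<mu> (U k - F k))"
      using summ ms by (intro finite_measure_subadditive_countably) auto
    also have "\<dots> \<le> (\<Sum>k. d k)"
      using FU(5) less_imp_le by (intro suminf_le summ sums_summable[OF sums_d]) blast
    finally have half: "measure \<mu> ((\<Union>k. U k) - (\<Union>k. F k)) \<le> e/2"
      using sums_unique[OF sums_d] by simp
    define G where "G N = (\<Union>k\<le>N. F k)" for N
    have G: "closed (G N)" for N unfolding G_def using FU(1) by (intro closed_UN) auto
    have GU: "(\<Union>N. G N) = (\<Union>k. F k)" unfolding G_def by auto
    have "incseq G" unfolding G_def incseq_def by force
    then have "(\<lambda>N. measure \<mu> (G N)) \<longlonglongrightarrow> measure \<mu> (\<Union>k. F k)"
      unfolding GU[symmetric] using G by (intro finite_Lim_measure_incseq) (auto intro: closed_sets)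
    then have "eventually (\<lambda>N. measure \<mu> (\<Union>k. F k) - e/2 < measure \<mu> (G N)) sequentially"
      using Union.prems by (intro order_tendstoD) auto
    then obtain N where N: "measure \<mu> (\<Union>k. F k) - e/2 < measure \<mu> (G N)"
      using eventually_happens'[OF sequentially_bot] by blast
    have GF: "G N \<subseteq> (\<Union>k. F k)" unfolding G_def by auto
    have FU': "(\<Union>k. F k) \<subseteq> (\<Union>k. U k)" using FU(3,4) by (meson UN_mono order_trans subset_refl)
    have "measure \<mu> ((\<Union>k. U k) - G N) = measure \<mu> (\<Union>k. U k) - measure \<mu> (G N)"
      using GF FU' ms G by (intro finite_measure_Diff) (auto intro: closed_sets)
    moreover have "measure \<mu> ((\<Union>k. U k) - (\<Union>k. F k)) = measure \<mu> (\<Union>k. U k) - measure \<mu> (\<Union>k. F k)"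
      using FU' ms by (intro finite_measure_Diff) auto
    ultimately have "measure \<mu> ((\<Union>k. U k) - G N) < e" using half N by linarith
    moreover have "G N \<subseteq> (\<Union>k. A k)" "(\<Union>k. A k) \<subseteq> (\<Union>k. U k)"
      using order_trans[OF GF UN_mono[OF subset_refl FU(3)]] UN_mono[OF subset_refl FU(4)] .
    moreover have "open (\<Union>k. U k)" using FU(2) by auto
    ultimately show ?case
      using G by (intro exI[of _ "G N"] exI[of _ "\<Union>k. U k"] conjI)
  qed
qed

text \<open>Quasi-invariance: a map with Lipschitz inverse \<open>g\<close> pulls measures back with a bounded factor.
  By regularity it is enough to compare a closed set \<open>F\<close> with an open neighbourhood \<open>U\<close> of its image.
  At a scale \<open>r\<close> below the distance from the image to the complement of \<open>U\<close>, the image is covered by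
  balls of radius \<open>r\<close> whose concentric halves are disjoint and inside \<open>U\<close>; their images under \<open>g\<close> have
  radius at most \<open>L * r\<close> and cover \<open>F\<close>.\<close>

lemma measure_vimage_le:
  assumes hg: "\<And>y. h (g y) = y" "\<And>y. g (h y) = y"
    and L: "1 \<le> L" and g: "\<And>x y. dist (g x) (g y) \<le> L * dist x y"
    and h: "continuous_on UNIV h" and A: "A \<in> sets \<mu>"
  shows "measure \<mu> (h -` A) \<le> C * (2 * L) powr m * measure \<mu> A"
proof -
  define K where "K = C * (2 * L) powr m"
  have K: "0 < K" using C_pos L by (simp add: K_def)
  have compact_open: "measure \<mu> F \<le> K * measure \<mu> U"
    if F: "closed F" and U: "open U" "h ` F \<subseteq> U" for F U
  proof -
    have "compact F" using compact_Int_closed[OF compact_UNIV F] by simp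
    then have "compact (h ` F)"
      using h by (intro compact_continuous_image) (auto intro: continuous_on_subset)
    then obtain d where d: "d > 0" "\<And>x. x \<in> h ` F \<Longrightarrow> ball x d \<subseteq> U"
      using Heine_Borel_lemma[of "h ` F" "{U}"] U by auto
    \<comment> \<open>the ball of radius \<open>2 * r\<close> around a point of the image must stay inside \<open>U\<close>\<close>
    define r where "r = min (d/2) D"
    have r: "0 < r" "r \<le> D" "2 * r \<le> d" using d D_pos by (auto simp: r_def)
    obtain n :: nat and p :: "nat \<Rightarrow> 'y" where
      sep: "\<forall>i<n. \<forall>j<n. i \<noteq> j \<longrightarrow> r \<le> dist (p i) (p j)" and cover: "\<forall>u. \<exists>i<n. dist u (p i) < r"
      using net_exists[OF r(1,2)] by blast
    define I where "I = {i. i < n \<and> ball (p i) r \<inter> h ` F \<noteq> {}}"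
    have fin: "finite I" by (simp add: I_def)
    have "F \<subseteq> (\<Union>i\<in>I. ball (g (p i)) (L * r))"
    proof
      fix u assume u: "u \<in> F"
      obtain i where i: "i < n" "dist (h u) (p i) < r" using cover by blast
      then have "i \<in> I" using u by (auto simp: I_def dist_commute)
      moreover have "dist (g (p i)) (g (h u)) < L * r"
        using g[of "p i" "h u"] i L by (smt (verit) dist_commute mult_strict_left_mono)
      ultimately show "u \<in> (\<Union>i\<in>I. ball (g (p i)) (L * r))" using hg by auto
    qed
    then have "measure \<mu> F \<le> measure \<mu> (\<Union>i\<in>I. ball (g (p i)) (L * r))"
      using fin by (intro finite_measure_mono) auto
    also have "\<dots> \<le> (\<Sum>i\<in>I. measure \<mu> (ball (g (p i)) (L * r)))"
      using fin by (intro measure_UNION_le) auto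
    also have "\<dots> \<le> (\<Sum>i\<in>I. C * c * (L * r) powr m)"
      using L r by (intro sum_mono ball_upper) auto
    also have "\<dots> = K * (real (card I) * (c * (r/2) powr m))"
    proof -
      have "(L * r) powr m = (2 * L) powr m * (r/2) powr m"
        using L r by (subst powr_mult[symmetric]) auto
      then show ?thesis by (simp add: K_def mult_ac)
    qed
    also have "\<dots> \<le> K * (real 1 * measure \<mu> U)"
    proof (intro mult_left_mono card_balls_le[OF fin])
      show "card {x \<in> I. u \<in> ball (p x) (r/2)} \<le> 1" for u
        using sep by (intro separated_overlap fin) (auto simp: I_def)
      show "ball (p i) (r/2) \<subseteq> U" if i: "i \<in> I" for i
      proof -
        obtain x where x: "x \<in> h ` F" "dist (p i) x < r" using i unfolding I_def by fastforce
        have "ball (p i) (r/2) \<subseteq> ball x d"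
          using x(2) r by (intro ball_subset_ballI) auto
        then show ?thesis using d(2)[OF x(1)] by blast
      qed
    qed (use r K U in \<open>auto intro: open_sets\<close>)
    finally show ?thesis by simp
  qed
  have hA: "h -` A \<in> sets \<mu>"
    using measurable_sets[OF borel_measurable_continuous_onI[OF h], of A] A by (simp add: sets_\<mu>)
  have "measure \<mu> (h -` A) \<le> K * measure \<mu> A"
  proof (rule field_le_epsilon)
    fix e :: real assume e: "e > 0"
    define d where "d = e / (K + 1)"
    have d: "d > 0" using e K by (simp add: d_def)
    obtain F where F: "closed F" "F \<subseteq> h -` A" "measure \<mu> (h -` A - F) < d"
    proof -
      obtain F U where FU: "closed F" "open U" "F \<subseteq> h -` A" "h -` A \<subseteq> U" "measure \<mu> (U - F) < d"
        using regular_closed_open[OF hA d] by blast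
      moreover have "measure \<mu> (h -` A - F) \<le> measure \<mu> (U - F)"
        using FU by (intro finite_measure_mono) (auto intro: open_sets closed_sets)
      ultimately show ?thesis using that[of F] by simp
    qed
    obtain U where U: "open U" "A \<subseteq> U" "measure \<mu> (U - A) < d"
    proof -
      obtain F U where FU: "closed F" "open U" "F \<subseteq> A" "A \<subseteq> U" "measure \<mu> (U - F) < d"
        using regular_closed_open[OF A d] by blast
      moreover have "measure \<mu> (U - A) \<le> measure \<mu> (U - F)"
        using FU by (intro finite_measure_mono) (auto intro: open_sets closed_sets)
      ultimately show ?thesis using that[of U] by simp
    qed
    have "measure \<mu> (h -` A) = measure \<mu> F + measure \<mu> (h -` A - F)"
      using F hA finite_measure_Diff[of "h -` A" F] by (simp add: closed_sets)
    also have "\<dots> \<le> K * measure \<mu> U + d"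
      using compact_open[OF F(1) U(1)] F U by fastforce
    also have "measure \<mu> U = measure \<mu> A + measure \<mu> (U - A)"
      using U A finite_measure_Diff[of U A] by (simp add: open_sets)
    also have "K * (measure \<mu> A + measure \<mu> (U - A)) + d \<le> K * (measure \<mu> A + d) + d"
      using K U by (intro add_right_mono mult_left_mono add_left_mono) auto
    also have "\<dots> = K * measure \<mu> A + e"
    proof -
      have "(K + 1) * d = e" using K by (simp add: d_def)
      then show ?thesis by (simp add: algebra_simps)
    qed
    finally show "measure \<mu> (h -` A) \<le> K * measure \<mu> A + e" .
  qed
  then show ?thesis by (simp add: K_def)
qed

lemma nn_integral_compose_le:
  fixes f :: "'y \<Rightarrow> ennreal"
  assumes hg: "\<And>y. h (g y) = y" "\<And>y. g (h y) = y"
    and L: "1 \<le> L" and g: "\<And>x y. dist (g x) (g y) \<le> L * dist x y"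
    and h: "continuous_on UNIV h" and f: "f \<in> borel_measurable \<mu>"
  shows "(\<integral>\<^sup>+u. f (h u) \<partial>\<mu>) \<le> ennreal (C * (2 * L) powr m) * (\<integral>\<^sup>+u. f u \<partial>\<mu>)"
proof -
  let ?K = "C * (2 * L) powr m"
  have h_meas: "h \<in> measurable \<mu> \<mu>"
    using continuous_measurable[OF h] measurable_cong_sets[OF refl sets_\<mu>] by blast
  have le: "distr \<mu> \<mu> h \<le> scale_measure ?K \<mu>"
  proof -
    have "emeasure (distr \<mu> \<mu> h) A \<le> emeasure (scale_measure ?K \<mu>) A" for A
    proof (cases "A \<in> sets \<mu>")
      case True
      have "emeasure (distr \<mu> \<mu> h) A = ennreal (measure \<mu> (h -` A))"
        using True by (simp add: emeasure_distr[OF h_meas] emeasure_eq_measure)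
      also have "\<dots> \<le> ennreal (?K * measure \<mu> A)"
        using measure_vimage_le[OF hg L g h True] by (intro ennreal_leI)
      also have "\<dots> = emeasure (scale_measure ?K \<mu>) A"
        using C_pos by (simp add: emeasure_eq_measure ennreal_mult)
      finally show ?thesis .
    qed (simp add: emeasure_notin_sets)
    then show ?thesis by (simp add: le_measure_iff le_fun_def space_scale_measure)
  qed
  have "(\<integral>\<^sup>+u. f (h u) \<partial>\<mu>) = (\<integral>\<^sup>+u. f u \<partial>distr \<mu> \<mu> h)"
    by (simp add: nn_integral_distr h_meas f)
  also have "\<dots> \<le> (\<integral>\<^sup>+u. f u \<partial>scale_measure ?K \<mu>)"
    by (intro nn_integral_mono_measure le) simp
  also have "\<dots> = ?K * (\<integral>\<^sup>+u. f u \<partial>\<mu>)" by (rule nn_integral_scale_measure) (rule f)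
  finally show ?thesis .
qed

end

section \<open>Strongly measurable functions and approximation by continuous ones\<close>

text \<open>The Voronoi partition of a net; ties are resolved by the index, which keeps the cells disjoint
  and measurable.\<close>

definition nearest :: "nat \<Rightarrow> (nat \<Rightarrow> 'y::metric_space) \<Rightarrow> 'y \<Rightarrow> nat" where
  "nearest n p u = (LEAST i. i < n \<and> (\<forall>j<n. dist u (p i) \<le> dist u (p j)))"

lemma nearest:
  assumes "0 < n"
  shows nearest_less: "nearest n p u < n"
    and nearest_le: "j < n \<Longrightarrow> dist u (p (nearest n p u)) \<le> dist u (p j)"
proof -
  have "\<exists>i. i < n \<and> (\<forall>j<n. dist u (p i) \<le> dist u (p j))"
  proof -
    have "finite {..<n}" "{..<n} \<noteq> {}" using assms by auto
    from arg_min_if_finite[OF this, of "\<lambda>i. dist u (p i)"] show ?thesis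
      by (intro exI[of _ "arg_min_on (\<lambda>i. dist u (p i)) {..<n}"]) (auto simp: not_less[symmetric])
  qed
  from LeastI_ex[OF this] show "nearest n p u < n"
    and "j < n \<Longrightarrow> dist u (p (nearest n p u)) \<le> dist u (p j)"
    unfolding nearest_def[symmetric] by blast+
qed

lemma nearest_eqI:
  assumes "i < n" "dist u (p i) < r/2"
    and sep: "\<And>i j. i < n \<Longrightarrow> j < n \<Longrightarrow> i \<noteq> j \<Longrightarrow> r \<le> dist (p i) (p j)"
  shows "nearest n p u = i"
proof (rule ccontr)
  assume neq: "nearest n p u \<noteq> i"
  have n: "0 < n" using assms(1) by simp
  have "dist u (p (nearest n p u)) < r/2"
    using nearest_le[OF n assms(1), of u p] assms(2) by simp
  then have "dist (p (nearest n p u)) (p i) < r"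
    using assms(2) dist_triangle_half_r[of u "p (nearest n p u)" r "p i"] by simp
  then show False using sep[OF nearest_less[OF n] assms(1) neq] by force
qed

lemma (in ahlfors_space) nearest_measurable [measurable]:
  "nearest n p \<in> measurable \<mu> (count_space UNIV)"
proof -
  have [measurable]: "(\<lambda>u. dist u y) \<in> borel_measurable \<mu>" for y :: 'y
    by (intro continuous_measurable continuous_intros)
  show ?thesis unfolding nearest_def[abs_def] by measurable
qed

lemma (in ahlfors_space) simple_function_nearest:
  assumes "0 < n"
  shows "simple_function \<mu> (\<lambda>u. F (nearest n p u))"
proof -
  have "simple_function \<mu> (nearest n p)"
    unfolding simple_function_def
  proof (intro conjI ballI)
    show "finite (nearest n p ` space \<mu>)"
      by (rule finite_subset[of _ "{..<n}"]) (auto simp: nearest_less[OF assms])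
    show "nearest n p -` {x} \<inter> space \<mu> \<in> sets \<mu>" for x
      by (rule measurable_sets[OF nearest_measurable]) simp
  qed
  then show ?thesis by (rule simple_function_compose1)
qed

text \<open>Bochner measurability with convergence at every point. The target need not be separable, so
  every closure property is derived from simple functions.\<close>

definition strongly_measurable :: "'a measure \<Rightarrow> ('a \<Rightarrow> 'x::real_normed_vector) \<Rightarrow> bool" where
  "strongly_measurable M f \<longleftrightarrow>
     (\<exists>s. (\<forall>i::nat. simple_function M (s i)) \<and> (\<forall>u\<in>space M. (\<lambda>i. s i u) \<longlonglongrightarrow> f u))"

lemma strongly_measurable_simple: "simple_function M f \<Longrightarrow> strongly_measurable M f"
  unfolding strongly_measurable_def by (intro exI[of _ "\<lambda>_. f"]) auto

lemma strongly_measurable_diff: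
  assumes "strongly_measurable M f" "strongly_measurable M g"
  shows "strongly_measurable M (\<lambda>u. f u - g u)"
proof -
  obtain s t where "\<And>i. simple_function M (s i)" "\<And>u. u \<in> space M \<Longrightarrow> (\<lambda>i. s i u) \<longlonglongrightarrow> f u"
    "\<And>i. simple_function M (t i)" "\<And>u. u \<in> space M \<Longrightarrow> (\<lambda>i. t i u) \<longlonglongrightarrow> g u"
    using assms unfolding strongly_measurable_def by metis
  then show ?thesis
    unfolding strongly_measurable_def
    by (intro exI[of _ "\<lambda>i u. s i u - t i u"])
      (auto intro: simple_function_compose2[where h = "(-)"] tendsto_diff)
qed

lemma strongly_measurable_compose:
  assumes "strongly_measurable M f" "T \<in> measurable N M"
  shows "strongly_measurable N (\<lambda>u. f (T u))"
proof -
  obtain s where s: "\<And>i. simple_function M (s i)" "\<And>u. u \<in> space M \<Longrightarrow> (\<lambda>i. s i u) \<longlonglongrightarrow> f u"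
    using assms(1) unfolding strongly_measurable_def by metis
  then show ?thesis
    unfolding strongly_measurable_def using measurable_space[OF assms(2)]
    by (intro exI[of _ "\<lambda>i u. s i (T u)"]) (auto intro: simple_function_comp[OF assms(2)])
qed

lemma strongly_measurable_norm:
  assumes "strongly_measurable M f"
  shows "(\<lambda>u. norm (f u)) \<in> borel_measurable M"
proof -
  obtain s where s: "\<And>i. simple_function M (s i)" "\<And>u. u \<in> space M \<Longrightarrow> (\<lambda>i. s i u) \<longlonglongrightarrow> f u"
    using assms unfolding strongly_measurable_def by metis
  show ?thesis
  proof (rule borel_measurable_LIMSEQ_real)
    show "(\<lambda>i. norm (s i u)) \<longlonglongrightarrow> norm (f u)" if "u \<in> space M" for u
      using s(2)[OF that] by (rule tendsto_norm)
    show "(\<lambda>u. norm (s i u)) \<in> borel_measurable M" for i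
      using simple_function_compose1[OF s(1), of norm] by (rule borel_measurable_simple_function)
  qed
qed

text \<open>Setting the function to 0 on a null set that contains the points of divergence makes the
  approximating simple functions converge everywhere.\<close>

lemma bochner_measurable_representative:
  assumes "bochner_measurable M f"
  obtains g where "strongly_measurable M g" "AE u in M. f u = g u"
proof -
  obtain s where s: "\<And>i::nat. simple_function M (s i)" "AE u in M. (\<lambda>i. s i u) \<longlonglongrightarrow> f u"
    using assms unfolding bochner_measurable_def by metis
  obtain N where N: "{u \<in> space M. \<not> (\<lambda>i. s i u) \<longlonglongrightarrow> f u} \<subseteq> N" "N \<in> null_sets M"
    using s(2) by (auto simp: eventually_ae_filter)
  define g where "g u = (if u \<in> N then 0 else f u)" for u
  have "simple_function M (\<lambda>u. if u \<in> N then 0 else s i u)" for i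
    using N(2) s(1) by (intro simple_function_If_set) auto
  moreover have "(\<lambda>i. if u \<in> N then 0 else s i u) \<longlonglongrightarrow> g u" if "u \<in> space M" for u
    using N(1) that by (auto simp: g_def)
  ultimately have "strongly_measurable M g"
    unfolding strongly_measurable_def by (intro exI[of _ "\<lambda>i u. if u \<in> N then 0 else s i u"]) auto
  moreover have "AE u in M. f u = g u"
    using AE_not_in[OF N(2)] by eventually_elim (simp add: g_def)
  ultimately show ?thesis by (rule that)
qed

lemma norm_add_square: "(norm (a + b))\<^sup>2 \<le> 2 * (norm a)\<^sup>2 + 2 * (norm b)\<^sup>2"
proof -
  have "(norm (a + b))\<^sup>2 \<le> (norm a + norm b)\<^sup>2" by (simp add: norm_triangle_ineq power_mono)
  also have "\<dots> \<le> 2 * (norm a)\<^sup>2 + 2 * (norm b)\<^sup>2" using sum_squares_bound[of "norm a" "norm b"]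
    by (simp add: power2_sum)
  finally show ?thesis .
qed

lemma nn_integral_double_add:
  fixes f g :: "'a \<Rightarrow> ennreal"
  assumes [measurable]: "f \<in> borel_measurable M" "g \<in> borel_measurable M"
  shows "(\<integral>\<^sup>+u. 2 * f u + 2 * g u \<partial>M) = 2 * (\<integral>\<^sup>+u. f u \<partial>M) + 2 * (\<integral>\<^sup>+u. g u \<partial>M)"
  by (subst nn_integral_add) (auto simp: nn_integral_cmult)

context ahlfors_space
begin

lemma fine_nets:
  obtains n :: "nat \<Rightarrow> nat" and p :: "nat \<Rightarrow> nat \<Rightarrow> 'y"
  where "\<And>k. 0 < n k" "\<And>k (u::'y). dist u (p k (nearest (n k) (p k) u)) < 1 / real (Suc k)"
proof -
  have ex: "\<forall>k. \<exists>np :: nat \<times> (nat \<Rightarrow> 'y). \<forall>u. \<exists>i<fst np. dist u (snd np i) < 1 / real (Suc k)"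
  proof
    fix k
    have "0 < min (1 / real (Suc k)) D" using D_pos by simp
    from net_exists[OF this] obtain n :: nat and p :: "nat \<Rightarrow> 'y"
      where "\<forall>u. \<exists>i<n. dist u (p i) < min (1 / real (Suc k)) D" by auto
    then show "\<exists>np :: nat \<times> (nat \<Rightarrow> 'y). \<forall>u. \<exists>i<fst np. dist u (snd np i) < 1 / real (Suc k)"
      by (intro exI[of _ "(n, p)"]) auto
  qed
  obtain N :: "nat \<Rightarrow> nat \<times> (nat \<Rightarrow> 'y)"
    where N: "\<forall>k. \<forall>u. \<exists>i<fst (N k). dist u (snd (N k) i) < 1 / real (Suc k)"
    using choice[OF ex] by blast
  define n p where "n k = fst (N k)" and "p k = snd (N k)" for k
  have np: "\<exists>i<n k. dist u (p k i) < 1 / real (Suc k)" for k u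
    using N by (simp add: n_def p_def)
  have n: "0 < n k" for k using np[of k undefined] by (metis gr_zeroI not_less_zero)
  have "dist u (p k (nearest (n k) (p k) u)) < 1 / real (Suc k)" for k u
    using np[of k u] nearest_le[OF n] by (metis le_less_trans)
  with n show ?thesis by (rule that)
qed

text \<open>Freezing a continuous function at the nearest points of ever finer finite nets yields simple
  functions that converge to it.\<close>

lemma strongly_measurable_continuous:
  assumes "continuous_on UNIV (h :: 'y \<Rightarrow> 'x::real_normed_vector)"
  shows "strongly_measurable \<mu> h"
proof -
  obtain n p where np: "\<And>k. 0 < n k"
    "\<And>k (u::'y). dist u (p k (nearest (n k) (p k) u)) < 1 / real (Suc k)"
    by (rule fine_nets) (rule that)
  have "(\<lambda>k. h (p k (nearest (n k) (p k) u))) \<longlonglongrightarrow> h u" for u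
  proof -
    have "(\<lambda>k. p k (nearest (n k) (p k) u)) \<longlonglongrightarrow> u"
    proof (rule iffD2[OF tendsto_dist_iff],
        rule real_tendsto_sandwich[OF _ _ tendsto_const LIMSEQ_inverse_real_of_nat])
      show "\<forall>\<^sub>F k in sequentially.
          dist (p k (nearest (n k) (p k) u)) u \<le> inverse (real (Suc k))"
        using np(2)[of u] by (simp add: dist_commute inverse_eq_divide less_imp_le del: of_nat_Suc)
    qed simp
    then show ?thesis by (rule continuous_on_tendsto_compose[OF assms]) auto
  qed
  then show ?thesis
    unfolding strongly_measurable_def
    by (intro exI[of _ "\<lambda>k u. h (p k (nearest (n k) (p k) u))"])
      (auto intro: simple_function_nearest np)
qed

text \<open>The squared distance in \<open>L\<^sup>2\<close>.\<close>

definition sq_dist :: "('y \<Rightarrow> 'x::real_normed_vector) \<Rightarrow> ('y \<Rightarrow> 'x) \<Rightarrow> ennreal" where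
  "sq_dist f h = (\<integral>\<^sup>+u. ennreal ((norm (f u - h u))\<^sup>2) \<partial>\<mu>)"

definition approximable :: "('y \<Rightarrow> 'x::real_normed_vector) \<Rightarrow> bool" where
  "approximable f \<longleftrightarrow> (\<forall>e>0. \<exists>h. continuous_on UNIV h \<and> sq_dist f h \<le> ennreal e)"

lemma norm_diff2_measurable:
  assumes "strongly_measurable \<mu> f" "strongly_measurable \<mu> g"
  shows "(\<lambda>u. ennreal ((norm (f u - g u))\<^sup>2)) \<in> borel_measurable \<mu>"
  using strongly_measurable_norm[OF strongly_measurable_diff[OF assms]] by measurable

lemma approximable_limit:
  assumes f: "strongly_measurable \<mu> f"
    and approx: "\<And>e. e > 0 \<Longrightarrow> \<exists>g. strongly_measurable \<mu> g \<and> approximable g \<and> sq_dist f g \<le> ennreal e"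
  shows "approximable f"
  unfolding approximable_def
proof (intro allI impI)
  fix e :: real assume e: "e > 0"
  obtain g where g: "strongly_measurable \<mu> g" "approximable g" "sq_dist f g \<le> ennreal (e/4)"
    using approx[of "e/4"] e by auto
  then obtain h where h: "continuous_on UNIV h" "sq_dist g h \<le> ennreal (e/4)"
    using e unfolding approximable_def by (metis zero_less_divide_iff zero_less_numeral)
  note hm = strongly_measurable_continuous[OF h(1)]
  note m = norm_diff2_measurable[OF f g(1)] norm_diff2_measurable[OF g(1) hm]
  have "sq_dist f h \<le> (\<integral>\<^sup>+u. 2 * ennreal ((norm (f u - g u))\<^sup>2) + 2 * ennreal ((norm (g u - h u))\<^sup>2) \<partial>\<mu>)"
    unfolding sq_dist_def
  proof (rule nn_integral_mono)
    fix u
    have "(norm (f u - h u))\<^sup>2 \<le> 2 * (norm (f u - g u))\<^sup>2 + 2 * (norm (g u - h u))\<^sup>2"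
      using norm_add_square[of "f u - g u" "g u - h u"] by simp
    from ennreal_leI[OF this]
    show "ennreal ((norm (f u - h u))\<^sup>2) \<le> 2 * ennreal ((norm (f u - g u))\<^sup>2) + 2 * ennreal ((norm (g u - h u))\<^sup>2)"
      by (simp add: ennreal_plus ennreal_mult)
  qed
  also have "\<dots> = 2 * sq_dist f g + 2 * sq_dist g h"
    unfolding sq_dist_def by (rule nn_integral_double_add) (rule m)+
  also have "\<dots> \<le> 2 * ennreal (e/4) + 2 * ennreal (e/4)"
    using g(3) h(2) by (intro add_mono mult_left_mono) auto
  also have "\<dots> = ennreal (2 * (e/4) + 2 * (e/4))"
    using e by (simp only: ennreal_plus ennreal_mult) simp
  also have "\<dots> = ennreal e" by simp
  finally show "\<exists>h. continuous_on UNIV h \<and> sq_dist f h \<le> ennreal e" using h(1) by blast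
qed

lemma cutoff_function:
  assumes F: "closed F" and U: "open U" "F \<subseteq> U"
  obtains k :: "'y \<Rightarrow> real" where "continuous_on UNIV k" "\<And>u. 0 \<le> k u" "\<And>u. k u \<le> 1"
    "\<And>u. u \<in> F \<Longrightarrow> k u = 1" "\<And>u. u \<notin> U \<Longrightarrow> k u = 0"
proof (cases "F = {} \<or> U = UNIV")
  case True
  then show ?thesis
    by (intro that[of "\<lambda>_. if F = {} then 0 else 1"]) (use U in auto)
next
  case False
  define k where "k u = infdist u (-U) / (infdist u (-U) + infdist u F)" for u
  have pos: "0 < infdist u (-U) + infdist u F" for u
  proof (cases "u \<in> F")
    case True
    then have "0 < infdist u (-U)"
      using infdist_pos_not_in_closed[of "-U" u] U False by auto
    then show ?thesis using infdist_nonneg[of u F] by linarith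
  next
    case notin: False
    then have "0 < infdist u F"
      using infdist_pos_not_in_closed[of F u] F False by auto
    then show ?thesis using infdist_nonneg[of u "-U"] by linarith
  qed
  show ?thesis
  proof (rule that[of k])
    show "continuous_on UNIV k"
      unfolding k_def using pos by (intro continuous_intros) (metis less_irrefl)
    show "0 \<le> k u" "k u \<le> 1" for u
      unfolding k_def using pos[of u] infdist_nonneg[of u F] infdist_nonneg[of u "-U"]
      by (auto simp: divide_le_eq_1)
    show "k u = 1" if "u \<in> F" for u
      using pos[of u] that by (simp add: k_def)
    show "k u = 0" if "u \<notin> U" for u
      using that by (simp add: k_def)
  qed
qed

text \<open>A cutoff function between the closed and the open set of regularity differs from the indicator
  only on their difference.\<close>

lemma approximable_indicator:
  fixes x :: "'x::real_normed_vector"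
  assumes A: "A \<in> sets \<mu>"
  shows "approximable (\<lambda>u. indicator A u *\<^sub>R x)"
  unfolding approximable_def
proof (intro allI impI)
  fix e :: real assume e: "e > 0"
  define d where "d = e / (1 + (norm x)\<^sup>2)"
  have d: "d > 0" using e by (simp add: d_def add_pos_nonneg)
  have dx: "(norm x)\<^sup>2 * d \<le> e"
    using e by (simp add: d_def field_simps add_pos_nonneg)
  obtain F U where FU: "closed F" "open U" "F \<subseteq> A" "A \<subseteq> U" "measure \<mu> (U - F) < d"
    using regular_closed_open[OF A d] by blast
  obtain k :: "'y \<Rightarrow> real" where k: "continuous_on UNIV k" "\<And>u. 0 \<le> k u" "\<And>u. k u \<le> 1"
    "\<And>u. u \<in> F \<Longrightarrow> k u = 1" "\<And>u. u \<notin> U \<Longrightarrow> k u = 0"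
    using cutoff_function[OF FU(1,2)] FU(3,4) by (metis order_trans)
  define h where "h u = k u *\<^sub>R x" for u
  have "sq_dist (\<lambda>u. indicator A u *\<^sub>R x) h \<le> (\<integral>\<^sup>+u. ennreal ((norm x)\<^sup>2) * indicator (U - F) u \<partial>\<mu>)"
    unfolding sq_dist_def
  proof (rule nn_integral_mono)
    fix u
    show "ennreal ((norm (indicator A u *\<^sub>R x - h u))\<^sup>2) \<le> ennreal ((norm x)\<^sup>2) * indicator (U - F) u"
    proof (cases "u \<in> U - F")
      case True
      have "\<bar>indicator A u - k u\<bar> \<le> 1" using k(2,3)[of u] by (auto simp: indicator_def)
      then have "norm (indicator A u *\<^sub>R x - h u) \<le> norm x"
        using mult_right_mono[of "\<bar>indicator A u - k u\<bar>" 1 "norm x"]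
        by (simp add: h_def scaleR_diff_left[symmetric])
      then show ?thesis using True by (auto intro!: ennreal_leI power_mono)
    next
      case False
      then have "indicator A u = k u" using FU k(4,5) by (auto simp: indicator_def)
      then show ?thesis by (simp add: h_def)
    qed
  qed
  also have "\<dots> = ennreal ((norm x)\<^sup>2) * ennreal (measure \<mu> (U - F))"
    using FU by (subst nn_integral_cmult_indicator)
      (auto simp: emeasure_eq_measure intro: open_sets closed_sets)
  also have "\<dots> \<le> ennreal ((norm x)\<^sup>2 * d)"
    using FU(5) by (simp add: ennreal_mult[symmetric] d less_imp_le ennreal_leI mult_left_mono)
  also have "\<dots> \<le> ennreal e" using dx by (rule ennreal_leI)
  finally show "\<exists>h. continuous_on UNIV h \<and> sq_dist (\<lambda>u. indicator A u *\<^sub>R x) h \<le> ennreal e"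
    using k(1) unfolding h_def by (intro exI[of _ "\<lambda>u. k u *\<^sub>R x"]) (auto intro: continuous_intros)
qed

lemma approximable_add:
  assumes f: "strongly_measurable \<mu> f" "approximable f"
    and g: "strongly_measurable \<mu> g" "approximable g"
  shows "approximable (\<lambda>u. f u + g u)"
  unfolding approximable_def
proof (intro allI impI)
  fix e :: real assume e: "e > 0"
  obtain h where h: "continuous_on UNIV h" "sq_dist f h \<le> ennreal (e/4)"
    using e f(2) unfolding approximable_def by (metis zero_less_divide_iff zero_less_numeral)
  obtain k where k: "continuous_on UNIV k" "sq_dist g k \<le> ennreal (e/4)"
    using e g(2) unfolding approximable_def by (metis zero_less_divide_iff zero_less_numeral)
  note m = norm_diff2_measurable[OF f(1) strongly_measurable_continuous[OF h(1)]]
    norm_diff2_measurable[OF g(1) strongly_measurable_continuous[OF k(1)]]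
  have "sq_dist (\<lambda>u. f u + g u) (\<lambda>u. h u + k u)
      \<le> (\<integral>\<^sup>+u. 2 * ennreal ((norm (f u - h u))\<^sup>2) + 2 * ennreal ((norm (g u - k u))\<^sup>2) \<partial>\<mu>)"
    unfolding sq_dist_def
  proof (rule nn_integral_mono)
    fix u
    have "(norm (f u + g u - (h u + k u)))\<^sup>2 \<le> 2 * (norm (f u - h u))\<^sup>2 + 2 * (norm (g u - k u))\<^sup>2"
      using norm_add_square[of "f u - h u" "g u - k u"] by (simp add: algebra_simps)
    from ennreal_leI[OF this]
    show "ennreal ((norm (f u + g u - (h u + k u)))\<^sup>2)
        \<le> 2 * ennreal ((norm (f u - h u))\<^sup>2) + 2 * ennreal ((norm (g u - k u))\<^sup>2)"
      by (simp add: ennreal_plus ennreal_mult)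
  qed
  also have "\<dots> = 2 * sq_dist f h + 2 * sq_dist g k"
    unfolding sq_dist_def by (rule nn_integral_double_add) (rule m)+
  also have "\<dots> \<le> 2 * ennreal (e/4) + 2 * ennreal (e/4)"
    using h(2) k(2) by (intro add_mono mult_left_mono) auto
  also have "\<dots> = ennreal (2 * (e/4) + 2 * (e/4))"
    using e by (simp only: ennreal_plus ennreal_mult) simp
  also have "\<dots> = ennreal e" by simp
  finally show "\<exists>h. continuous_on UNIV h \<and> sq_dist (\<lambda>u. f u + g u) h \<le> ennreal e"
    using continuous_on_add[OF h(1) k(1)] by blast
qed

lemma simple_function_scaleR_indicator:
  "A \<in> sets \<mu> \<Longrightarrow> simple_function \<mu> (\<lambda>u. indicator A u *\<^sub>R (x::'x::real_normed_vector))"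
  by (rule simple_function_compose1[where g = "\<lambda>a::real. a *\<^sub>R x"]) auto

lemma approximable_simple:
  fixes f :: "'y \<Rightarrow> 'x::real_normed_vector"
  assumes f: "simple_function \<mu> f"
  shows "approximable f"
proof -
  have sets: "f -` {x} \<in> sets \<mu>" if "x \<in> range f" for x
    using simple_functionD(2)[OF f, of "{x}"] by simp
  have fin: "finite (range f)" using simple_functionD(1)[OF f] by simp
  have "simple_function \<mu> (\<lambda>u. \<Sum>x\<in>X. indicator (f -` {x}) u *\<^sub>R x) \<and>
      approximable (\<lambda>u. \<Sum>x\<in>X. indicator (f -` {x}) u *\<^sub>R x)" if "finite X" "X \<subseteq> range f" for X
    using that
  proof (induction X rule: finite_induct)
    case empty
    have "approximable (\<lambda>u. 0 :: 'x)"
      unfolding approximable_def sq_dist_def by (intro allI impI exI[of _ "\<lambda>_. 0"]) auto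
    then show ?case by simp
  next
    case (insert x X)
    then have x: "f -` {x} \<in> sets \<mu>" using sets by blast
    have IH: "simple_function \<mu> (\<lambda>u. \<Sum>x\<in>X. indicator (f -` {x}) u *\<^sub>R x)"
      "approximable (\<lambda>u. \<Sum>x\<in>X. indicator (f -` {x}) u *\<^sub>R x)" using insert by auto
    have "simple_function \<mu> (\<lambda>u. indicator (f -` {x}) u *\<^sub>R x + (\<Sum>x\<in>X. indicator (f -` {x}) u *\<^sub>R x))"
      by (rule simple_function_compose2[where h = "(+)", OF simple_function_scaleR_indicator[OF x] IH(1)])
    moreover have "approximable (\<lambda>u. indicator (f -` {x}) u *\<^sub>R x + (\<Sum>x\<in>X. indicator (f -` {x}) u *\<^sub>R x))"
      by (intro approximable_add approximable_indicator strongly_measurable_simple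
        simple_function_scaleR_indicator x IH)
    ultimately show ?case
      by (simp only: sum.insert[OF insert.hyps] simp_thms)
  qed
  from this[OF fin] have "approximable (\<lambda>u. \<Sum>x\<in>range f. indicator (f -` {x}) u *\<^sub>R x)" by simp
  moreover have "(\<Sum>x\<in>range f. indicator (f -` {x}) u *\<^sub>R x) = f u" for u
  proof -
    have "(\<Sum>x\<in>range f. indicator (f -` {x}) u *\<^sub>R x) = (\<Sum>x\<in>range f. if x = f u then x else 0)"
      by (intro sum.cong) (auto simp: indicator_def)
    then show ?thesis using fin by simp
  qed
  ultimately show ?thesis by simp
qed

text \<open>The approximating simple functions are cut off where their norm exceeds twice that of \<open>f\<close>. The
  cut-off functions are still simple and converge to \<open>f\<close>, now dominated by a multiple of \<open>f\<close>.\<close>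

lemma approximable_L2:
  fixes f :: "'y \<Rightarrow> 'x::real_normed_vector"
  assumes f: "strongly_measurable \<mu> f" and L2: "(\<integral>\<^sup>+u. ennreal ((norm (f u))\<^sup>2) \<partial>\<mu>) < \<infinity>"
  shows "approximable f"
proof (rule approximable_limit[OF f])
  fix e :: real assume e: "e > 0"
  obtain s where s: "\<And>i::nat. simple_function \<mu> (s i)" "\<And>u. (\<lambda>i. s i u) \<longlonglongrightarrow> f u"
    using f unfolding strongly_measurable_def by auto
  note [measurable] = strongly_measurable_norm[OF f]
    strongly_measurable_norm[OF strongly_measurable_simple[OF s(1)]]
  define B where "B i = {u. norm (s i u) \<le> 2 * norm (f u)}" for i
  have B: "B i \<in> sets \<mu>" for i
  proof -
    have "{u \<in> space \<mu>. norm (s i u) \<le> 2 * norm (f u)} \<in> sets \<mu>" by measurable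
    then show ?thesis by (simp add: B_def)
  qed
  define t where "t i u = indicator (B i) u *\<^sub>R s i u" for i u
  have t: "simple_function \<mu> (t i)" for i
    unfolding t_def using s(1) B
    by (intro simple_function_compose2[where h = "\<lambda>a x. a *\<^sub>R x"]) auto
  have lim: "(\<lambda>i. t i u) \<longlonglongrightarrow> f u" for u
  proof (cases "f u = 0")
    case True
    then have "t i u = 0" for i by (auto simp: t_def B_def indicator_def)
    then show ?thesis using True by simp
  next
    case False
    then have "norm (f u) < 2 * norm (f u)" by simp
    then have "eventually (\<lambda>i. norm (s i u) < 2 * norm (f u)) sequentially"
      using tendsto_norm[OF s(2)] by (rule order_tendstoD(2)[rotated])
    then have "eventually (\<lambda>i. t i u = s i u) sequentially"
      by eventually_elim (auto simp: t_def B_def indicator_def)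
    then show ?thesis using s(2) by (simp add: tendsto_cong)
  qed
  have bound: "(norm (f u - t i u))\<^sup>2 \<le> 9 * (norm (f u))\<^sup>2" for i u
  proof -
    have "norm (t i u) \<le> 2 * norm (f u)" by (auto simp: t_def B_def indicator_def)
    then have "norm (f u - t i u) \<le> 3 * norm (f u)"
      using norm_triangle_ineq4[of "f u" "t i u"] by linarith
    then show ?thesis using power_mono[of "norm (f u - t i u)" "3 * norm (f u)" 2]
      by (simp add: power_mult_distrib)
  qed
  have "(\<lambda>i. \<integral>\<^sup>+u. ennreal ((norm (f u - t i u))\<^sup>2) \<partial>\<mu>) \<longlonglongrightarrow> (\<integral>\<^sup>+u. 0 \<partial>\<mu>)"
  proof (rule nn_integral_dominated_convergence[where w = "\<lambda>u. 9 * ennreal ((norm (f u))\<^sup>2)"])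
    show "(\<lambda>u. ennreal ((norm (f u - t i u))\<^sup>2)) \<in> borel_measurable \<mu>" for i
      by (intro norm_diff2_measurable f strongly_measurable_simple t)
    show "(\<integral>\<^sup>+u. 9 * ennreal ((norm (f u))\<^sup>2) \<partial>\<mu>) < \<infinity>"
      using L2 by (simp add: nn_integral_cmult ennreal_mult_less_top)
    show "AE u in \<mu>. ennreal ((norm (f u - t i u))\<^sup>2) \<le> 9 * ennreal ((norm (f u))\<^sup>2)" for i
      using ennreal_leI[OF bound] by (auto simp: ennreal_mult)
    show "AE u in \<mu>. (\<lambda>i. ennreal ((norm (f u - t i u))\<^sup>2)) \<longlonglongrightarrow> 0"
    proof (rule AE_I2)
      fix u
      have "(\<lambda>i. (norm (f u - t i u))\<^sup>2) \<longlonglongrightarrow> (norm (f u - f u))\<^sup>2"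
        by (intro tendsto_intros lim)
      then have "(\<lambda>i. ennreal ((norm (f u - t i u))\<^sup>2)) \<longlonglongrightarrow> ennreal ((norm (f u - f u))\<^sup>2)"
        by (rule tendsto_ennrealI)
      then show "(\<lambda>i. ennreal ((norm (f u - t i u))\<^sup>2)) \<longlonglongrightarrow> 0" by simp
    qed
  qed auto
  then have "(\<lambda>i. sq_dist f (t i)) \<longlonglongrightarrow> 0" by (simp add: sq_dist_def)
  then have "eventually (\<lambda>i. sq_dist f (t i) < ennreal e) sequentially"
    using e by (intro order_tendstoD(2)[of _ 0]) auto
  then obtain i where "sq_dist f (t i) < ennreal e"
    using eventually_happens'[OF sequentially_bot] by blast
  then show "\<exists>g. strongly_measurable \<mu> g \<and> approximable g \<and> sq_dist f g \<le> ennreal e"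
    by (intro exI[of _ "t i"]) (auto intro: strongly_measurable_simple approximable_simple t)
qed

end

section \<open>The net graph of a level of the warped cone\<close>

locale lipschitz_action = ahlfors_space \<mu> c m C D + symmetric_maps \<phi> S J L
  for \<mu> :: "'y::metric_space measure" and c m C D :: real
    and \<phi> :: "'g \<Rightarrow> 'y \<Rightarrow> 'y" and S J L

text \<open>A net at the scale \<open>1/t\<close> at which \<open>tY\<close> has unit size. For small \<open>t\<close>, where this exceeds the diameter
  and \<open>tY\<close> is uniformly bounded, the scale stays at \<open>D\<close>, within the range of the Ahlfors lower bound.\<close>

locale warped_net = lipschitz_action \<mu> c m C D \<phi> S J L
  for \<mu> :: "'y::metric_space measure" and c m C D :: real
    and \<phi> :: "'g \<Rightarrow> 'y \<Rightarrow> 'y" and S J L +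
  fixes t r :: real and n :: nat and p :: "nat \<Rightarrow> 'y"
  assumes geodesic: "geodesic_space (UNIV :: 'y set)"
    and t_pos: "0 < t" and r_def: "r = min (1/t) D"
    and sep: "\<And>i j. i < n \<Longrightarrow> j < n \<Longrightarrow> i \<noteq> j \<Longrightarrow> r \<le> dist (p i) (p j)"
    and cover: "\<And>u. \<exists>i<n. dist u (p i) < r"
begin

lemma r_pos: "0 < r" and r_le: "r \<le> D" and tr: "t * r \<le> 1"
  using t_pos D_pos by (auto simp: r_def min_def field_simps)

lemma n_pos: "0 < n"
  using cover[of undefined] by auto

definition \<iota> :: "'y \<Rightarrow> nat" where "\<iota> = nearest n p"

lemma \<iota>_less: "\<iota> u < n"
  unfolding \<iota>_def by (rule nearest_less[OF n_pos])

lemma \<iota>_near: "dist u (p (\<iota> u)) < r"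
  using cover[of u] nearest_le[OF n_pos, of _ u p] unfolding \<iota>_def by (metis le_less_trans)

lemma \<iota>_eqI: "i < n \<Longrightarrow> dist u (p i) < r/2 \<Longrightarrow> \<iota> u = i"
  unfolding \<iota>_def using sep by (intro nearest_eqI)

lemma \<iota>_p: "i < n \<Longrightarrow> \<iota> (p i) = i"
  using r_pos by (intro \<iota>_eqI) auto

text \<open>Both kinds of steps have length at most 1 in the warped metric.\<close>

definition adjacent :: "'y \<Rightarrow> 'y \<Rightarrow> bool" where
  "adjacent u v \<longleftrightarrow> dist u v \<le> r \<or> (\<exists>s\<in>S. v = \<phi> s u)"

lemma adjacent_sym: "adjacent u v \<Longrightarrow> adjacent v u"
  unfolding adjacent_def using J_left J_closed by (metis dist_commute)

text \<open>Two net points are joined as soon as some step leads from the ball of one to the ball of the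
  other. With this choice every step in \<open>Y\<close>, and every generator applied to a cell, projects to an arc
  or to a single vertex.\<close>

definition net_graph :: "nat pair_pre_digraph" where
  "net_graph = \<lparr>pverts = {..<n}, parcs = {(i, j). i < n \<and> j < n \<and> i \<noteq> j \<and>
     (\<exists>u v. dist u (p i) < r \<and> dist v (p j) < r \<and> adjacent u v)}\<rparr>"

lemma pverts_net_graph: "pverts net_graph = {..<n}"
  by (simp add: net_graph_def)

lemma in_parcs: "(i, j) \<in> parcs net_graph \<longleftrightarrow> i < n \<and> j < n \<and> i \<noteq> j \<and>
     (\<exists>u v. dist u (p i) < r \<and> dist v (p j) < r \<and> adjacent u v)"
  by (simp add: net_graph_def)

lemma pair_graph_net_graph: "pair_graph net_graph"
proof
  show "finite (pverts net_graph)" by (simp add: pverts_net_graph)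
  show "finite (parcs net_graph)"
    by (rule finite_subset[of _ "{..<n} \<times> {..<n}"]) (auto simp: in_parcs)
  show "symmetric (with_proj net_graph)"
    unfolding symmetric_def with_proj_simps
  proof (rule symI)
    fix i j assume "(i, j) \<in> parcs net_graph"
    then show "(j, i) \<in> parcs net_graph" unfolding in_parcs using adjacent_sym by metis
  qed
qed (auto simp: pverts_net_graph in_parcs)

lemma adjacent_imp_arc:
  assumes "adjacent u v"
  shows "\<iota> u = \<iota> v \<or> (\<iota> u, \<iota> v) \<in> parcs net_graph"
  using assms \<iota>_near \<iota>_less by (auto simp: in_parcs)

text \<open>This is where geodesicity is used: a geodesic of length \<open>d\<close> is cut into about \<open>d / r\<close> steps.\<close>

lemma move_walk: "\<exists>N. (\<iota> u, \<iota> v) \<in> parcs net_graph ^^ N \<and> real N \<le> t * dist u v + 2"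
proof -
  define d where "d = dist u v"
  obtain \<gamma> where \<gamma>: "\<gamma> 0 = u" "\<gamma> d = v"
    "\<And>a b. a \<in> {0..d} \<Longrightarrow> b \<in> {0..d} \<Longrightarrow> dist (\<gamma> a) (\<gamma> b) = \<bar>a - b\<bar>"
    using geodesic unfolding geodesic_space_def d_def by (metis UNIV_I)
  define M where "M = nat \<lceil>d / r\<rceil>"
  have d: "0 \<le> d" "d \<le> D" using dist_le_D by (auto simp: d_def)
  have M: "d / r \<le> real M" "real M \<le> d / r + 1"
    using d r_pos by (auto simp: M_def of_nat_nat)
  have "d / r \<le> t * d + 1"
  proof (cases "1/t \<le> D")
    case True
    then show ?thesis using t_pos by (simp add: r_def min_def mult.commute)
  next
    case False
    then have "d / r \<le> 1" using d D_pos by (simp add: r_def min_def)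
    moreover have "0 \<le> t * d" using t_pos d by simp
    ultimately show ?thesis by linarith
  qed
  then have M': "real M \<le> t * d + 2" using M by linarith
  \<comment> \<open>the last step is shorter, so the points on the geodesic are truncated at \<open>d\<close>\<close>
  have walk: "\<exists>N\<le>k. (\<iota> u, \<iota> (\<gamma> (min d (real k * r)))) \<in> parcs net_graph ^^ N" for k
  proof (induction k)
    case 0
    then show ?case using \<gamma> d by simp
  next
    case (Suc k)
    then obtain N where N: "N \<le> k" "(\<iota> u, \<iota> (\<gamma> (min d (real k * r)))) \<in> parcs net_graph ^^ N"
      by blast
    have "dist (\<gamma> (min d (real k * r))) (\<gamma> (min d (real (Suc k) * r)))
        = \<bar>min d (real k * r) - min d (real (Suc k) * r)\<bar>"
      using d r_pos by (intro \<gamma>(3)) auto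
    also have "\<dots> \<le> r" using r_pos by (auto simp: min_def algebra_simps)
    finally have "adjacent (\<gamma> (min d (real k * r))) (\<gamma> (min d (real (Suc k) * r)))"
      by (simp add: adjacent_def)
    from adjacent_imp_arc[OF this] show ?case
    proof
      assume "\<iota> (\<gamma> (min d (real k * r))) = \<iota> (\<gamma> (min d (real (Suc k) * r)))"
      then show ?case using N by (intro exI[of _ N]) auto
    next
      assume "(\<iota> (\<gamma> (min d (real k * r))), \<iota> (\<gamma> (min d (real (Suc k) * r)))) \<in> parcs net_graph"
      from relpow_Suc_I[OF N(2) this] show ?case using N(1) by blast
    qed
  qed
  have "min d (real M * r) = d" using M(1) r_pos by (simp add: field_simps)
  with walk[of M] \<gamma>(2) obtain N where "N \<le> M" "(\<iota> u, \<iota> v) \<in> parcs net_graph ^^ N" by auto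
  then show ?thesis using M' by (intro exI[of _ N]) (auto simp: d_def)
qed

lemma chain_walk:
  assumes "chain \<phi> S a l u v"
  shows "\<exists>N. (\<iota> u, \<iota> v) \<in> parcs net_graph ^^ N \<and> real N \<le> t * l + 3 * real a + 2"
  using assms
proof (induction rule: chain.induct)
  case (move u v)
  then show ?case using move_walk[of u v] by simp
next
  case (jump a l u v s w)
  then obtain N where N: "(\<iota> u, \<iota> v) \<in> parcs net_graph ^^ N" "real N \<le> t * l + 3 * real a + 2"
    by blast
  have "adjacent v (\<phi> s v)" using jump by (auto simp: adjacent_def)
  from adjacent_imp_arc[OF this]
  have "\<exists>N'\<le>1. (\<iota> v, \<iota> (\<phi> s v)) \<in> parcs net_graph ^^ N'"
  proof
    assume "\<iota> v = \<iota> (\<phi> s v)"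
    then show ?thesis by (intro exI[of _ 0]) auto
  next
    assume "(\<iota> v, \<iota> (\<phi> s v)) \<in> parcs net_graph"
    then show ?thesis by (intro exI[of _ 1]) auto
  qed
  then obtain N' where N': "N' \<le> 1" "(\<iota> v, \<iota> (\<phi> s v)) \<in> parcs net_graph ^^ N'" by blast
  obtain N'' where N'': "(\<iota> (\<phi> s v), \<iota> w) \<in> parcs net_graph ^^ N''"
    "real N'' \<le> t * dist (\<phi> s v) w + 2"
    using move_walk by blast
  have "(\<iota> u, \<iota> w) \<in> parcs net_graph ^^ (N + N' + N'')"
    using relpow_trans[OF relpow_trans[OF N(1) N'(2)] N''(1)] .
  moreover have "real (N + N' + N'') \<le> t * (l + dist (\<phi> s v) w) + 3 * real (Suc a) + 2"
    using N(2) N'(1) N''(2) by (simp add: distrib_left)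
  ultimately show ?case by blast
qed

lemma warped_walk:
  "\<exists>N. (\<iota> u, \<iota> v) \<in> parcs net_graph ^^ N \<and> real N \<le> 3 * warped_metric \<phi> S t u v + 5"
proof -
  obtain a l where al: "chain \<phi> S a l u v" "real a + t * l < warped_metric \<phi> S t u v + 1"
    using warped_metric_chain[OF t_pos zero_less_one, of u v] by blast
  obtain N where "(\<iota> u, \<iota> v) \<in> parcs net_graph ^^ N" "real N \<le> t * l + 3 * real a + 2"
    using chain_walk[OF al(1)] by blast
  moreover have "0 \<le> t * l" using chain_nonneg[OF al(1)] t_pos by simp
  ultimately show ?thesis using al(2) by (intro exI[of _ N]) auto
qed

lemma connected_net_graph: "Digraph_Component.connected (with_proj net_graph)"
  unfolding connected_iff_relpow[OF pair_graph_net_graph]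
proof (intro conjI ballI)
  show "pverts net_graph \<noteq> {}" using n_pos by (auto simp: pverts_net_graph)
  fix i j assume "i \<in> pverts net_graph" "j \<in> pverts net_graph"
  then show "\<exists>N. (i, j) \<in> parcs net_graph ^^ N"
    using warped_walk[of "p i" "p j"] by (auto simp: pverts_net_graph \<iota>_p)
qed

lemma warped_triangle:
  "warped_metric \<phi> S t x z \<le> warped_metric \<phi> S t x y + warped_metric \<phi> S t y z"
  and warped_le: "warped_metric \<phi> S t x y \<le> t * dist x y"
  and warped_jump: "s \<in> S \<Longrightarrow> warped_metric \<phi> S t y (\<phi> s y) \<le> 1"
  and warped_refl: "warped_metric \<phi> S t x x = 0"
proof -
  have adm: "warped_admissible \<phi> S t (warped_metric \<phi> S t)"
    by (rule warped_metric_greatest(1)[OF t_pos])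
  then interpret M: Metric_space UNIV "warped_metric \<phi> S t"
    by (simp add: warped_admissible_def)
  show "warped_metric \<phi> S t x z \<le> warped_metric \<phi> S t x y + warped_metric \<phi> S t y z"
    by (rule M.triangle) auto
  show "warped_metric \<phi> S t x x = 0" by simp
  show "warped_metric \<phi> S t x y \<le> t * dist x y"
    using adm by (simp add: warped_admissible_def)
  show "s \<in> S \<Longrightarrow> warped_metric \<phi> S t y (\<phi> s y) \<le> 1"
    using adm by (simp add: warped_admissible_def)
qed

lemma warped_near: "dist u v \<le> r \<Longrightarrow> warped_metric \<phi> S t u v \<le> 1"
  using warped_le[of u v] mult_left_mono[of "dist u v" r t] t_pos tr by linarith

lemma warped_le_walk:
  assumes "(i, j) \<in> parcs net_graph ^^ N"
  shows "warped_metric \<phi> S t (p i) (p j) \<le> 3 * real N"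
  using assms
proof (induction N arbitrary: j)
  case 0
  then show ?case by (simp add: warped_refl)
next
  case (Suc N)
  then obtain k where k: "(i, k) \<in> parcs net_graph ^^ N" "(k, j) \<in> parcs net_graph" by auto
  then obtain u v where uv: "dist u (p k) < r" "dist v (p j) < r" "adjacent u v"
    by (auto simp: in_parcs)
  have "warped_metric \<phi> S t (p k) u \<le> 1" "warped_metric \<phi> S t v (p j) \<le> 1"
    using uv by (auto intro!: warped_near simp: dist_commute)
  moreover have "warped_metric \<phi> S t u v \<le> 1"
    using uv(3) warped_near warped_jump by (auto simp: adjacent_def)
  ultimately have "warped_metric \<phi> S t (p k) (p j) \<le> 3"
    using warped_triangle[of "p k" "p j" u] warped_triangle[of u "p j" v] by linarith
  then show ?case
    using Suc.IH[OF k(1)] warped_triangle[of "p i" "p j" "p k"] by simp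
qed

text \<open>Chains give the upper bound, since each jump costs one arc and each move is subdivided. For the
  lower bound, an arc is at most three unit steps: from the net point to the step, the step, and back
  to a net point.\<close>

lemma quasi_isometry_net_graph:
  "quasi_isometry 5 1 3 UNIV (warped_metric \<phi> S t) (pverts net_graph) (graph_metric net_graph) \<iota>"
  unfolding quasi_isometry_def
proof (intro conjI ballI)
  show "\<iota> \<in> UNIV \<rightarrow> pverts net_graph" by (auto simp: pverts_net_graph \<iota>_less)
  fix u v
  have verts: "\<iota> w \<in> pverts net_graph" for w by (simp add: pverts_net_graph \<iota>_less)
  show "graph_metric net_graph (\<iota> u) (\<iota> v) \<le> 3 * warped_metric \<phi> S t u v + 5"
    using warped_walk[of u v] graph_metric_le[OF pair_graph_net_graph verts] by force
  obtain N where N: "(\<iota> u, \<iota> v) \<in> parcs net_graph ^^ N"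
    "graph_metric net_graph (\<iota> u) (\<iota> v) = real N"
    using graph_metric_attained[OF pair_graph_net_graph connected_net_graph verts verts] by blast
  have "warped_metric \<phi> S t u (p (\<iota> u)) \<le> 1" "warped_metric \<phi> S t (p (\<iota> v)) v \<le> 1"
    using \<iota>_near[of u] \<iota>_near[of v] by (auto intro!: warped_near simp: dist_commute)
  then have "warped_metric \<phi> S t u v \<le> 3 * real N + 2"
    using warped_le_walk[OF N(1)] warped_triangle[of u v "p (\<iota> u)"]
      warped_triangle[of "p (\<iota> u)" v "p (\<iota> v)"] by linarith
  then show "inverse 3 * warped_metric \<phi> S t u v - 5 \<le> graph_metric net_graph (\<iota> u) (\<iota> v)"
    using N(2) by simp
next
  fix i assume "i \<in> pverts net_graph"
  then have "\<iota> (p i) = i" "i \<in> pverts net_graph" by (auto simp: pverts_net_graph \<iota>_p)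
  then show "\<exists>u\<in>UNIV. graph_metric net_graph (\<iota> u) i < 1"
    using graph_metric_le[OF pair_graph_net_graph, of i i 0] by (intro bexI[of _ "p i"]) auto
qed

text \<open>The neighbours of \<open>i\<close> lie near \<open>p i\<close> or near one of its images under the generators, and packing
  bounds the number of net points in each of these balls.\<close>

lemma degree_net_graph:
  "real (out_degree (with_proj net_graph) i) \<le> (1 + real (card S)) * (C * (2 * (L + 3) + 2) powr m)"
proof -
  let ?K = "L + 3"
  define near where "near y = {j. j < n \<and> dist y (p j) \<le> ?K * r}" for y
  have near: "real (card (near y)) \<le> C * (2 * ?K + 2) powr m" for y
    using L_ge_1 r_pos r_le by (intro packing_ball[where p = p and r = r and y = y]) (auto simp: near_def intro: sep)
  have fin: "finite (near y)" for y by (simp add: near_def)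
  have sub: "{j. (i, j) \<in> parcs net_graph} \<subseteq> near (p i) \<union> (\<Union>s\<in>S. near (\<phi> s (p i)))"
  proof
    fix j assume "j \<in> {j. (i, j) \<in> parcs net_graph}"
    then obtain u v where uv: "j < n" "dist u (p i) < r" "dist v (p j) < r" "adjacent u v"
      by (auto simp: in_parcs)
    from uv(4) show "j \<in> near (p i) \<union> (\<Union>s\<in>S. near (\<phi> s (p i)))"
      unfolding adjacent_def
    proof
      assume "dist u v \<le> r"
      then have "dist (p i) (p j) \<le> 3 * r"
        using uv dist_triangle[of "p i" "p j" u] dist_triangle[of u "p j" v]
        by (simp add: dist_commute)
      also have "\<dots> \<le> ?K * r" using L_ge_1 r_pos by (intro mult_right_mono) auto
      finally show ?thesis using uv by (auto simp: near_def)
    next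
      assume "\<exists>s\<in>S. v = \<phi> s u"
      then obtain s where s: "s \<in> S" "v = \<phi> s u" by blast
      have "dist (\<phi> s (p i)) v \<le> L * r"
      proof -
        have "L * dist (p i) u \<le> L * r"
          using uv(2) L_ge_1 by (intro mult_left_mono) (auto simp: dist_commute)
        then show ?thesis using lip[OF s(1), of "p i" u] s(2) by simp
      qed
      then have "dist (\<phi> s (p i)) (p j) \<le> ?K * r"
        using uv(3) dist_triangle[of "\<phi> s (p i)" "p j" v] r_pos by (simp add: algebra_simps)
      then show ?thesis using uv s by (auto simp: near_def)
    qed
  qed
  have "out_degree (with_proj net_graph) i = card {j. (i, j) \<in> parcs net_graph}"
  proof -
    have "out_arcs (with_proj net_graph) i = Pair i ` {j. (i, j) \<in> parcs net_graph}"
      by (auto simp: out_arcs_def)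
    then show ?thesis by (simp add: out_degree_def card_image inj_on_def)
  qed
  also have "\<dots> \<le> card (near (p i) \<union> (\<Union>s\<in>S. near (\<phi> s (p i))))"
    using fin finite_S by (intro card_mono sub) auto
  also have "\<dots> \<le> card (near (p i)) + (\<Sum>s\<in>S. card (near (\<phi> s (p i))))"
    using card_Un_le[of "near (p i)"] card_UN_le[OF finite_S, of "\<lambda>s. near (\<phi> s (p i))"]
    by (meson add_left_mono order_trans)
  finally have "real (out_degree (with_proj net_graph) i)
      \<le> real (card (near (p i))) + (\<Sum>s\<in>S. real (card (near (\<phi> s (p i)))))"
    by (metis of_nat_add of_nat_le_iff of_nat_sum)
  also have "\<dots> \<le> C * (2 * ?K + 2) powr m + (\<Sum>s\<in>S. C * (2 * ?K + 2) powr m)"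
    by (intro add_mono sum_mono near)
  finally show ?thesis by (simp add: algebra_simps)
qed

lemma card_net_graph: "1 \<le> real n * (C * c * r powr m)"
proof -
  have "(\<Union>i<n. ball (p i) r) = UNIV"
    using cover by (force simp: dist_commute)
  then have "1 = measure \<mu> (\<Union>i<n. ball (p i) r)"
    using prob_space by simp
  also have "\<dots> \<le> (\<Sum>i<n. measure \<mu> (ball (p i) r))"
    by (intro measure_UNION_le) auto
  also have "\<dots> \<le> (\<Sum>i<n. C * c * r powr m)"
    using r_pos by (intro sum_mono ball_upper)
  finally show ?thesis by simp
qed

text \<open>Each cell contains a ball of radius \<open>r/2\<close>.\<close>

lemma double_integral_step:
  fixes F :: "nat \<Rightarrow> 'x::real_normed_vector"
  shows "ennreal ((\<Sum>(i, j)\<in>{..<n} \<times> {..<n}. (norm (F i - F j))\<^sup>2) * (c * (r/2) powr m)\<^sup>2)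
    \<le> (\<integral>\<^sup>+(u, v). ennreal ((norm (F (\<iota> u) - F (\<iota> v)))\<^sup>2) \<partial>(\<mu> \<Otimes>\<^sub>M \<mu>))"
proof -
  define a where "a x = (norm (F (fst x) - F (snd x)))\<^sup>2" for x
  define Q where "Q x = ball (p (fst x)) (r/2) \<times> ball (p (snd x)) (r/2)" for x
  let ?V = "{..<n} \<times> {..<n}"
  have a: "0 \<le> a x" for x by (simp add: a_def)
  have low: "c * (r/2) powr m \<le> measure \<mu> (ball y (r/2))" for y
    using r_pos r_le D_pos by (intro ball_lower) auto
  have "ennreal ((\<Sum>(i, j)\<in>?V. (norm (F i - F j))\<^sup>2) * (c * (r/2) powr m)\<^sup>2)
      = (\<Sum>x\<in>?V. ennreal (a x * (c * (r/2) powr m)\<^sup>2))"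
    by (subst sum_ennreal) (auto simp: a_def sum_distrib_right case_prod_beta)
  also have "\<dots> \<le> (\<Sum>x\<in>?V. ennreal (a x) * emeasure (\<mu> \<Otimes>\<^sub>M \<mu>) (Q x))"
  proof (rule sum_mono)
    fix x
    have "emeasure (\<mu> \<Otimes>\<^sub>M \<mu>) (Q x)
        = ennreal (measure \<mu> (ball (p (fst x)) (r/2)) * measure \<mu> (ball (p (snd x)) (r/2)))"
      unfolding Q_def by (subst emeasure_pair_measure_Times) (auto simp: emeasure_eq_measure ennreal_mult)
    moreover have "(c * (r/2) powr m)\<^sup>2 \<le> measure \<mu> (ball (p (fst x)) (r/2)) * measure \<mu> (ball (p (snd x)) (r/2))"
      unfolding power2_eq_square using low c_pos by (intro mult_mono) auto
    ultimately show "ennreal (a x * (c * (r/2) powr m)\<^sup>2) \<le> ennreal (a x) * emeasure (\<mu> \<Otimes>\<^sub>M \<mu>) (Q x)"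
      using a by (simp add: ennreal_mult[symmetric] ennreal_leI mult_left_mono)
  qed
  also have "\<dots> = (\<integral>\<^sup>+z. (\<Sum>x\<in>?V. ennreal (a x) * indicator (Q x) z) \<partial>(\<mu> \<Otimes>\<^sub>M \<mu>))"
    by (subst nn_integral_sum) (auto simp: Q_def nn_integral_cmult_indicator)
  also have "\<dots> \<le> (\<integral>\<^sup>+(u, v). ennreal ((norm (F (\<iota> u) - F (\<iota> v)))\<^sup>2) \<partial>(\<mu> \<Otimes>\<^sub>M \<mu>))"
  proof (rule nn_integral_mono, clarify)
    fix u v
    have "(\<Sum>x\<in>?V. ennreal (a x) * indicator (Q x) (u, v))
        \<le> (\<Sum>x\<in>?V. if x = (\<iota> u, \<iota> v) then ennreal (a x) else 0)"
    proof (rule sum_mono)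
      fix x assume "x \<in> ?V"
      then have lt: "fst x < n" "snd x < n" by auto
      show "ennreal (a x) * indicator (Q x) (u, v) \<le> (if x = (\<iota> u, \<iota> v) then ennreal (a x) else 0)"
      proof (cases "(u, v) \<in> Q x")
        case True
        then have "dist u (p (fst x)) < r/2" "dist v (p (snd x)) < r/2"
          by (auto simp: Q_def dist_commute)
        from \<iota>_eqI[OF lt(1) this(1)] \<iota>_eqI[OF lt(2) this(2)] have "x = (\<iota> u, \<iota> v)"
          by (simp add: prod_eq_iff)
        then show ?thesis by (simp add: indicator_def)
      qed simp
    qed
    also have "\<dots> = ennreal (a (\<iota> u, \<iota> v))" by (simp add: \<iota>_less)
    finally show "(\<Sum>x\<in>?V. ennreal (a x) * indicator (Q x) (u, v)) \<le> ennreal ((norm (F (\<iota> u) - F (\<iota> v)))\<^sup>2)"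
      by (simp add: a_def)
  qed
  finally show ?thesis .
qed

text \<open>A point \<open>u\<close> and its image lie in equal or adjacent cells, and the cell of \<open>u\<close> lies in a ball of
  radius \<open>r\<close>.\<close>

lemma energy_step:
  fixes F :: "nat \<Rightarrow> 'x::real_normed_vector"
  assumes s: "s \<in> S"
  shows "(\<integral>\<^sup>+u. ennreal ((norm (F (\<iota> u) - F (\<iota> (\<phi> s u))))\<^sup>2) \<partial>\<mu>)
    \<le> ennreal ((\<Sum>(i, j)\<in>parcs net_graph. (norm (F i - F j))\<^sup>2) * (C * c * r powr m))"
proof -
  define a where "a x = (norm (F (fst x) - F (snd x)))\<^sup>2" for x
  have a: "0 \<le> a x" for x by (simp add: a_def)
  have fin: "finite (parcs net_graph)"
    using pair_graph_net_graph by (simp add: pair_graph_def pair_digraph_def pair_fin_digraph_def pair_fin_digraph_axioms_def)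
  have "(\<integral>\<^sup>+u. ennreal ((norm (F (\<iota> u) - F (\<iota> (\<phi> s u))))\<^sup>2) \<partial>\<mu>)
      \<le> (\<integral>\<^sup>+u. (\<Sum>x\<in>parcs net_graph. ennreal (a x) * indicator (ball (p (fst x)) r) u) \<partial>\<mu>)"
  proof (rule nn_integral_mono)
    fix u
    have "adjacent u (\<phi> s u)" using s by (auto simp: adjacent_def)
    from adjacent_imp_arc[OF this]
    show "ennreal ((norm (F (\<iota> u) - F (\<iota> (\<phi> s u))))\<^sup>2)
        \<le> (\<Sum>x\<in>parcs net_graph. ennreal (a x) * indicator (ball (p (fst x)) r) u)"
    proof
      assume arc: "(\<iota> u, \<iota> (\<phi> s u)) \<in> parcs net_graph"
      have "ennreal ((norm (F (\<iota> u) - F (\<iota> (\<phi> s u))))\<^sup>2)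
          = ennreal (a (\<iota> u, \<iota> (\<phi> s u))) * indicator (ball (p (\<iota> u)) r) u"
        using \<iota>_near[of u] by (simp add: a_def dist_commute)
      also have "\<dots> \<le> (\<Sum>x\<in>parcs net_graph. ennreal (a x) * indicator (ball (p (fst x)) r) u)"
        using member_le_sum[OF arc _ fin, of "\<lambda>x. ennreal (a x) * indicator (ball (p (fst x)) r) u"] by simp
      finally show ?thesis .
    qed simp
  qed
  also have "\<dots> = (\<Sum>x\<in>parcs net_graph. ennreal (a x) * emeasure \<mu> (ball (p (fst x)) r))"
    by (subst nn_integral_sum) (auto simp: nn_integral_cmult_indicator)
  also have "\<dots> \<le> (\<Sum>x\<in>parcs net_graph. ennreal (a x * (C * c * r powr m)))"
  proof (rule sum_mono)
    fix x
    show "ennreal (a x) * emeasure \<mu> (ball (p (fst x)) r) \<le> ennreal (a x * (C * c * r powr m))"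
      using a ball_upper[OF r_pos, of "p (fst x)"]
      by (simp add: emeasure_eq_measure ennreal_mult[symmetric] ennreal_leI mult_left_mono)
  qed
  also have "\<dots> = ennreal ((\<Sum>(i, j)\<in>parcs net_graph. (norm (F i - F j))\<^sup>2) * (C * c * r powr m))"
    using C_pos c_pos by (subst sum_ennreal) (auto simp: a_def sum_distrib_right case_prod_beta)
  finally show ?thesis .
qed

lemma step_in_bochner_L2:
  fixes F :: "nat \<Rightarrow> 'x::real_normed_vector"
  shows "(\<lambda>u. F (\<iota> u)) \<in> bochner_L2 \<mu>"
proof -
  have "simple_function \<mu> (\<lambda>u. F (\<iota> u))"
    unfolding \<iota>_def by (rule simple_function_nearest[OF n_pos])
  then have "bochner_measurable \<mu> (\<lambda>u. F (\<iota> u))"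
    unfolding bochner_measurable_def by (intro exI[of _ "\<lambda>_ u. F (\<iota> u)"]) auto
  moreover have "(\<integral>\<^sup>+u. ennreal ((norm (F (\<iota> u)))\<^sup>2) \<partial>\<mu>) < \<infinity>"
  proof -
    have "(\<integral>\<^sup>+u. ennreal ((norm (F (\<iota> u)))\<^sup>2) \<partial>\<mu>) \<le> (\<integral>\<^sup>+u. ennreal (\<Sum>i<n. (norm (F i))\<^sup>2) \<partial>\<mu>)"
      by (intro nn_integral_mono ennreal_leI)
        (use \<iota>_less in \<open>auto intro!: member_le_sum[where f = "\<lambda>i. (norm (F i))\<^sup>2"]\<close>)
    also have "\<dots> < \<infinity>" by (simp add: emeasure_eq_measure ennreal_mult_less_top)
    finally show ?thesis .
  qed
  ultimately show ?thesis by (simp add: bochner_L2_def)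
qed

text \<open>The spectral gap is applied to the function that equals \<open>F i\<close> on the \<open>i\<close>-th cell. All cells have
  measure of order \<open>q = c * r powr m\<close>, and \<open>1/q\<close> is at most of the order of the number of vertices by
  \<open>card_net_graph\<close>; this turns the constant of the gap into one that is independent of \<open>t\<close>.\<close>

lemma gap_imp_poincare:
  fixes F :: "nat \<Rightarrow> 'x::real_normed_vector"
  assumes \<kappa>: "0 < \<kappa>"
    and gap: "\<And>f::'y \<Rightarrow> 'x. f \<in> bochner_L2 \<mu> \<Longrightarrow>
      ennreal \<kappa> * (\<integral>\<^sup>+(u, v). ennreal ((norm (f u - f v))\<^sup>2) \<partial>(\<mu> \<Otimes>\<^sub>M \<mu>))
        \<le> (\<Sum>s\<in>S. \<integral>\<^sup>+u. ennreal ((norm (f u - f (\<phi> s u)))\<^sup>2) \<partial>\<mu>)"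
  shows "\<kappa> * (1/4) powr m / ((real (card S) + 1) * C\<^sup>2) / card (pverts net_graph) *
      (\<Sum>(i, j)\<in>pverts net_graph \<times> pverts net_graph. (norm (F i - F j))\<^sup>2)
    \<le> (\<Sum>(i, j)\<in>parcs net_graph. (norm (F i - F j))\<^sup>2)"
proof -
  define T where "T = (\<Sum>(i, j)\<in>{..<n} \<times> {..<n}. (norm (F i - F j))\<^sup>2)"
  define A where "A = (\<Sum>(i, j)\<in>parcs net_graph. (norm (F i - F j))\<^sup>2)"
  define q where "q = c * r powr m"
  have T: "0 \<le> T" unfolding T_def by (intro sum_nonneg) auto
  have A: "0 \<le> A" unfolding A_def by (intro sum_nonneg) auto
  have q: "0 < q" using c_pos r_pos by (simp add: q_def)
  have half: "(c * (r/2) powr m)\<^sup>2 = q\<^sup>2 * (1/4) powr m"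
  proof -
    have "(r/2) powr m = r powr m * (1/2) powr m"
      using r_pos powr_mult[of r "1/2" m] by simp
    moreover have "((1/2) powr m)\<^sup>2 = (1/4 :: real) powr m"
      using powr_mult[of "1/2" "1/2" m] by (simp add: power2_eq_square)
    ultimately show ?thesis by (simp add: q_def power_mult_distrib)
  qed
  have "ennreal (\<kappa> * (T * (q\<^sup>2 * (1/4) powr m))) = ennreal \<kappa> * ennreal (T * (c * (r/2) powr m)\<^sup>2)"
    unfolding half using \<kappa> by (simp add: ennreal_mult')
  also have "\<dots> \<le> ennreal \<kappa> * (\<integral>\<^sup>+(u, v). ennreal ((norm (F (\<iota> u) - F (\<iota> v)))\<^sup>2) \<partial>(\<mu> \<Otimes>\<^sub>M \<mu>))"
    unfolding T_def by (intro mult_left_mono double_integral_step) simp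
  also have "\<dots> \<le> (\<Sum>s\<in>S. \<integral>\<^sup>+u. ennreal ((norm (F (\<iota> u) - F (\<iota> (\<phi> s u))))\<^sup>2) \<partial>\<mu>)"
    by (rule gap[OF step_in_bochner_L2])
  also have "\<dots> \<le> (\<Sum>s\<in>S. ennreal (A * (C * c * r powr m)))"
    unfolding A_def by (intro sum_mono energy_step)
  also have "\<dots> = ennreal (real (card S) * (A * (C * q)))"
    using A C_pos q by (subst sum_ennreal) (auto simp: q_def mult_ac)
  finally have "\<kappa> * (T * (q\<^sup>2 * (1/4) powr m)) \<le> real (card S) * (A * (C * q))"
    using A C_pos q by (subst (asm) ennreal_le_iff) auto
  also have "\<dots> \<le> (real (card S) + 1) * (A * (C * q))"
    using A C_pos q by (intro mult_right_mono) auto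
  finally have "(\<kappa> * T * (1/4) powr m * q) * q \<le> ((real (card S) + 1) * C * A) * q"
    by (simp add: power2_eq_square mult_ac)
  then have *: "\<kappa> * T * (1/4) powr m * q \<le> (real (card S) + 1) * C * A"
    using q by (rule mult_right_le_imp_le)
  have n: "1 / (real n * C) \<le> q"
    using card_net_graph n_pos C_pos by (simp add: q_def field_simps)
  have "\<kappa> * T * (1/4) powr m * (1 / (real n * C)) \<le> \<kappa> * T * (1/4) powr m * q"
    using n \<kappa> T by (intro mult_left_mono) auto
  with * have "\<kappa> * T * (1/4) powr m * (1 / (real n * C)) \<le> (real (card S) + 1) * C * A" by linarith
  moreover have "0 < (real (card S) + 1) * C" using C_pos by simp
  ultimately have "\<kappa> * T * (1/4) powr m * (1 / (real n * C)) / ((real (card S) + 1) * C) \<le> A"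
    by (simp only: pos_divide_le_eq mult_ac)
  then have "\<kappa> * (1/4) powr m / ((real (card S) + 1) * C\<^sup>2) / real n * T \<le> A"
    by (simp add: power2_eq_square mult_ac)
  then show ?thesis by (simp add: T_def A_def pverts_net_graph)
qed

end

section \<open>From a Poincare inequality at one scale to the action\<close>

abbreviation (in symmetric_maps) words :: "nat \<Rightarrow> 'g list set" where
  "words N \<equiv> {w. set w \<subseteq> S \<and> length w \<le> N}"

lemma (in symmetric_maps) finite_words: "finite (words N)"
  using finite_lists_length_le[OF finite_S] .

lemma norm_add4_square:
  fixes a b c d :: "'x::real_normed_vector"
  assumes "norm a \<le> x" "norm b \<le> y" "norm c \<le> z" "norm d \<le> w"
  shows "(norm (a + b + c + d))\<^sup>2 \<le> 4 * (x\<^sup>2 + y\<^sup>2 + z\<^sup>2 + w\<^sup>2)"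
proof -
  have "(norm (a + b + c + d))\<^sup>2 \<le> 2 * (norm (a + b))\<^sup>2 + 2 * (norm (c + d))\<^sup>2"
    using norm_add_square[of "a + b" "c + d"] by (simp add: add.assoc)
  also have "\<dots> \<le> 2 * (2 * (norm a)\<^sup>2 + 2 * (norm b)\<^sup>2) + 2 * (2 * (norm c)\<^sup>2 + 2 * (norm d)\<^sup>2)"
    by (intro add_mono mult_left_mono norm_add_square) auto
  also have "\<dots> = 4 * ((norm a)\<^sup>2 + (norm b)\<^sup>2 + (norm c)\<^sup>2 + (norm d)\<^sup>2)" by simp
  also have "\<dots> \<le> 4 * (x\<^sup>2 + y\<^sup>2 + z\<^sup>2 + w\<^sup>2)"
    using assms by (intro mult_left_mono add_mono power_mono) auto
  finally show ?thesis .
qed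

context lipschitz_action
begin

definition energy :: "('y \<Rightarrow> 'x::real_normed_vector) \<Rightarrow> ('y \<Rightarrow> 'y) \<Rightarrow> ennreal" where
  "energy f a = (\<integral>\<^sup>+u. ennreal ((norm (f u - f (a u)))\<^sup>2) \<partial>\<mu>)"

definition variation :: "('y \<Rightarrow> 'x::real_normed_vector) \<Rightarrow> ennreal" where
  "variation f = (\<integral>\<^sup>+(u, v). ennreal ((norm (f u - f v))\<^sup>2) \<partial>(\<mu> \<Otimes>\<^sub>M \<mu>))"

lemma word_continuous:
  assumes "set w \<subseteq> S"
  shows "continuous_on UNIV (foldr \<phi> w)"
proof (rule lipschitz_on_continuous_on)
  show "(L ^ length w)-lipschitz_on UNIV (foldr \<phi> w)"
    using word_lipschitz[OF assms] L_ge_1 by (intro lipschitz_onI) auto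
qed

lemma generator_continuous: "s \<in> S \<Longrightarrow> continuous_on UNIV (\<phi> s)"
  using word_continuous[of "[s]"] by (simp add: comp_def)

text \<open>The factor of quasi-invariance of a single generator.\<close>

abbreviation Q :: real where "Q \<equiv> C * (2 * L) powr m"

lemma nn_integral_generator_le:
  assumes s: "s \<in> S" and f: "f \<in> borel_measurable \<mu>"
  shows "(\<integral>\<^sup>+u. f (\<phi> s u) \<partial>\<mu>) \<le> ennreal Q * (\<integral>\<^sup>+u. f u \<partial>\<mu>)"
proof (rule nn_integral_compose_le[where g = "\<phi> (J s)"])
  show "\<phi> s (\<phi> (J s) y) = y" for y
    using J_left[OF J_closed[OF s], of y] J_J[OF s] by simp
  show "dist (\<phi> (J s) x) (\<phi> (J s) y) \<le> L * dist x y" for x y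
    by (rule lip[OF J_closed[OF s]])
qed (use s f L_ge_1 J_left generator_continuous in auto)

lemma energy_measurable:
  assumes h: "strongly_measurable \<mu> h" and a: "continuous_on UNIV a"
  shows "(\<lambda>u. ennreal ((norm (h u - h (a u)))\<^sup>2)) \<in> borel_measurable \<mu>"
proof -
  have "a \<in> measurable \<mu> \<mu>"
    using continuous_measurable[OF a] measurable_cong_sets[OF refl sets_\<mu>] by blast
  then show ?thesis
    by (intro norm_diff2_measurable h strongly_measurable_compose[OF h])
qed

lemma energy_finite:
  assumes h: "continuous_on UNIV (h :: 'y \<Rightarrow> 'x::real_normed_vector)"
  shows "energy h a < \<infinity>"
proof -
  have "bounded (h ` UNIV)" by (intro compact_imp_bounded compact_continuous_image h compact_UNIV)
  then obtain B where B: "\<And>u. norm (h u) \<le> B" by (auto simp: bounded_iff)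
  have "energy h a \<le> (\<integral>\<^sup>+u. ennreal ((2 * B)\<^sup>2) \<partial>\<mu>)"
    unfolding energy_def
  proof (intro nn_integral_mono ennreal_leI power_mono)
    show "norm (h u - h (a u)) \<le> 2 * B" for u
      using norm_triangle_ineq4[of "h u" "h (a u)"] B[of u] B[of "a u"] by linarith
  qed simp
  also have "\<dots> < \<infinity>" by (simp add: emeasure_eq_measure ennreal_mult_less_top)
  finally show ?thesis .
qed

text \<open>The first letter to act is split off, so that the rest of the word is evaluated at \<open>\<phi> s u\<close>.
  Quasi-invariance under a single generator then removes \<open>\<phi> s\<close> from the integral.\<close>

lemma energy_word:
  assumes h: "continuous_on UNIV (h :: 'y \<Rightarrow> 'x::real_normed_vector)" and w: "set w \<subseteq> S"
  shows "energy h (foldr \<phi> w) \<le> ennreal ((2 + 2 * Q) ^ length w) * (\<Sum>s\<in>S. energy h (\<phi> s))"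
  using w
proof (induction w rule: rev_induct)
  case Nil
  then show ?case by (simp add: energy_def)
next
  case (snoc s w)
  define E where "E = (\<Sum>s\<in>S. energy h (\<phi> s))"
  have s: "s \<in> S" and w: "set w \<subseteq> S" using snoc by auto
  have Q: "0 \<le> Q" using C_pos by simp
  note hm = strongly_measurable_continuous[OF h]
  note m1 = energy_measurable[OF hm generator_continuous[OF s]]
  note m2 = energy_measurable[OF hm word_continuous[OF w]]
  have m3: "(\<lambda>u. ennreal ((norm (h (\<phi> s u) - h (foldr \<phi> w (\<phi> s u))))\<^sup>2)) \<in> borel_measurable \<mu>"
    using measurable_compose[OF _ m2, of "\<phi> s" \<mu>] continuous_measurable[OF generator_continuous[OF s]]
      measurable_cong_sets[OF refl sets_\<mu>] by blast
  have "energy h (foldr \<phi> (w @ [s])) \<le> (\<integral>\<^sup>+u. 2 * ennreal ((norm (h u - h (\<phi> s u)))\<^sup>2)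
      + 2 * ennreal ((norm (h (\<phi> s u) - h (foldr \<phi> w (\<phi> s u))))\<^sup>2) \<partial>\<mu>)"
    unfolding energy_def
  proof (rule nn_integral_mono)
    fix u
    have "(norm (h u - h (foldr \<phi> w (\<phi> s u))))\<^sup>2
        \<le> 2 * (norm (h u - h (\<phi> s u)))\<^sup>2 + 2 * (norm (h (\<phi> s u) - h (foldr \<phi> w (\<phi> s u))))\<^sup>2"
      using norm_add_square[of "h u - h (\<phi> s u)" "h (\<phi> s u) - h (foldr \<phi> w (\<phi> s u))"] by simp
    from ennreal_leI[OF this]
    show "ennreal ((norm (h u - h (foldr \<phi> (w @ [s]) u)))\<^sup>2) \<le> 2 * ennreal ((norm (h u - h (\<phi> s u)))\<^sup>2)
      + 2 * ennreal ((norm (h (\<phi> s u) - h (foldr \<phi> w (\<phi> s u))))\<^sup>2)"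
      by (simp add: ennreal_plus ennreal_mult)
  qed
  also have "\<dots> = 2 * energy h (\<phi> s) + 2 * (\<integral>\<^sup>+u. ennreal ((norm (h (\<phi> s u) - h (foldr \<phi> w (\<phi> s u))))\<^sup>2) \<partial>\<mu>)"
    unfolding energy_def by (rule nn_integral_double_add[OF m1 m3])
  also have "\<dots> \<le> 2 * E + 2 * (ennreal Q * energy h (foldr \<phi> w))"
  proof (intro add_mono mult_left_mono)
    show "energy h (\<phi> s) \<le> E"
      unfolding E_def using finite_S s by (intro member_le_sum) auto
    show "(\<integral>\<^sup>+u. ennreal ((norm (h (\<phi> s u) - h (foldr \<phi> w (\<phi> s u))))\<^sup>2) \<partial>\<mu>) \<le> ennreal Q * energy h (foldr \<phi> w)"
      unfolding energy_def by (rule nn_integral_generator_le[OF s m2])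
  qed auto
  also have "\<dots> \<le> 2 * E + 2 * (ennreal Q * (ennreal ((2 + 2 * Q) ^ length w) * E))"
    using snoc.IH[OF w] by (intro add_left_mono mult_left_mono) (auto simp: E_def)
  also have "\<dots> = ennreal (2 + 2 * (Q * (2 + 2 * Q) ^ length w)) * E"
  proof -
    have "2 * E + 2 * (ennreal x * (ennreal y * E)) = ennreal (2 + 2 * (x * y)) * E"
      if "0 \<le> x" "0 \<le> y" for x y
      using that by (simp add: ennreal_plus ennreal_mult distrib_right mult.assoc)
    then show ?thesis using Q by simp
  qed
  also have "\<dots> \<le> ennreal ((2 + 2 * Q) ^ length (w @ [s])) * E"
  proof (intro mult_right_mono ennreal_leI)
    have "1 \<le> (2 + 2 * Q) ^ length w" using Q by (intro one_le_power) auto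
    then show "2 + 2 * (Q * (2 + 2 * Q) ^ length w) \<le> (2 + 2 * Q) ^ length (w @ [s])"
      by (simp add: algebra_simps)
  qed simp
  finally show ?case unfolding E_def .
qed

text \<open>The displacement of \<open>h\<close> under \<open>w\<close> at a marked point differs from that at any point of the ball of
  radius \<open>\<rho>\<close> by at most \<open>2 * \<omega>\<close>; averaging over the balls and summing gives the energy of \<open>w\<close>, because
  the balls overlap boundedly.\<close>

lemma local_energy_sum:
  fixes q :: "'i \<Rightarrow> 'y" and h :: "'y \<Rightarrow> 'x::real_normed_vector"
  assumes h: "continuous_on UNIV h" and w: "set w \<subseteq> S" and fin: "finite I"
    and \<rho>: "0 < \<rho>" "\<rho> \<le> 2 * D" and overlap: "\<And>u. card {i \<in> I. u \<in> ball (q i) \<rho>} \<le> M"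
    and mod: "\<And>u v. dist u v < L ^ length w * \<rho> \<Longrightarrow> norm (h u - h v) \<le> \<omega>"
  shows "c * \<rho> powr m * (\<Sum>i\<in>I. (norm (h (q i) - h (foldr \<phi> w (q i))))\<^sup>2)
    \<le> real M * (2 * enn2real (energy h (foldr \<phi> w)) + 8 * \<omega>\<^sup>2)"
proof -
  let ?a = "foldr \<phi> w"
  define b where "b u = (norm (h u - h (?a u)))\<^sup>2" for u
  define g where "g u = 2 * ennreal (b u) + 2 * ennreal (4 * \<omega>\<^sup>2)" for u
  have b: "0 \<le> b u" for u by (simp add: b_def)
  have bm: "(\<lambda>u. ennreal (b u)) \<in> borel_measurable \<mu>"
    unfolding b_def by (rule energy_measurable[OF strongly_measurable_continuous[OF h] word_continuous[OF w]])
  then have gm: "g \<in> borel_measurable \<mu>" unfolding g_def by measurable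
  have near: "b (q i) \<le> 2 * b u + 8 * \<omega>\<^sup>2" if "u \<in> ball (q i) \<rho>" for i u
  proof -
    have d: "dist (q i) u < \<rho>" using that by simp
    also have "\<rho> \<le> L ^ length w * \<rho>" using \<rho> L_ge_1 by simp
    finally have 1: "norm (h (q i) - h u) \<le> \<omega>" by (rule mod)
    have "dist (?a (q i)) (?a u) \<le> L ^ length w * dist (q i) u" by (rule word_lipschitz[OF w])
    also have "\<dots> < L ^ length w * \<rho>" using d L_ge_1 by (intro mult_strict_left_mono) auto
    finally have 2: "norm (h (?a (q i)) - h (?a u)) \<le> \<omega>" by (rule mod)
    have "norm ((h (q i) - h u) - (h (?a (q i)) - h (?a u))) \<le> 2 * \<omega>"
      using norm_triangle_ineq4[of "h (q i) - h u" "h (?a (q i)) - h (?a u)"] 1 2 by linarith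
    then have sq: "(norm ((h (q i) - h u) - (h (?a (q i)) - h (?a u))))\<^sup>2 \<le> (2 * \<omega>)\<^sup>2"
      by (intro power_mono) auto
    have "b (q i) \<le> 2 * b u + 2 * (norm ((h (q i) - h u) - (h (?a (q i)) - h (?a u))))\<^sup>2"
      unfolding b_def
      using norm_add_square[of "h u - h (?a u)" "(h (q i) - h u) - (h (?a (q i)) - h (?a u))"]
      by (simp add: algebra_simps)
    then show ?thesis using sq by (simp add: power_mult_distrib)
  qed
  have "ennreal (c * \<rho> powr m * (\<Sum>i\<in>I. b (q i))) = (\<Sum>i\<in>I. ennreal (c * \<rho> powr m) * ennreal (b (q i)))"
    using b c_pos by (simp add: sum_ennreal ennreal_mult sum_nonneg flip: sum_distrib_left)
  also have "\<dots> \<le> (\<Sum>i\<in>I. \<integral>\<^sup>+u. g u * indicator (ball (q i) \<rho>) u \<partial>\<mu>)"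
  proof (rule sum_mono)
    fix i
    have "ennreal (c * \<rho> powr m) * ennreal (b (q i)) \<le> ennreal (b (q i)) * emeasure \<mu> (ball (q i) \<rho>)"
      unfolding emeasure_eq_measure using ball_lower[OF \<rho>]
      by (subst mult.commute) (intro mult_left_mono ennreal_leI, auto)
    also have "\<dots> = (\<integral>\<^sup>+u. ennreal (b (q i)) * indicator (ball (q i) \<rho>) u \<partial>\<mu>)"
      by (simp add: nn_integral_cmult_indicator)
    also have "\<dots> \<le> (\<integral>\<^sup>+u. g u * indicator (ball (q i) \<rho>) u \<partial>\<mu>)"
    proof (intro nn_integral_mono)
      fix u
      show "ennreal (b (q i)) * indicator (ball (q i) \<rho>) u \<le> g u * indicator (ball (q i) \<rho>) u"
        using ennreal_leI[OF near[of u i]] b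
        by (auto simp: indicator_def g_def ennreal_plus ennreal_mult)
    qed
    finally show "ennreal (c * \<rho> powr m) * ennreal (b (q i)) \<le> (\<integral>\<^sup>+u. g u * indicator (ball (q i) \<rho>) u \<partial>\<mu>)" .
  qed
  also have "\<dots> \<le> of_nat M * (\<integral>\<^sup>+u. g u \<partial>\<mu>)"
    by (rule bounded_overlap[OF fin gm overlap])
  also have "(\<integral>\<^sup>+u. g u \<partial>\<mu>) = 2 * energy h ?a + 2 * ennreal (4 * \<omega>\<^sup>2)"
    unfolding g_def by (subst nn_integral_double_add[OF bm])
      (auto simp: energy_def b_def emeasure_eq_measure prob_space[simplified])
  also have "energy h ?a = ennreal (enn2real (energy h ?a))"
    using energy_finite[OF h] by simp
  also have "of_nat M * (2 * ennreal (enn2real (energy h ?a)) + 2 * ennreal (4 * \<omega>\<^sup>2))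
      = ennreal (real M * (2 * enn2real (energy h ?a) + 8 * \<omega>\<^sup>2))"
    by (simp add: ennreal_plus ennreal_mult ennreal_of_nat_eq_real_of_nat)
  finally show ?thesis
    by (subst (asm) ennreal_le_iff) (auto simp: b_def)
qed

text \<open>The cover is allowed to overlap, which avoids choosing a measurable partition.\<close>

lemma variation_cover:
  fixes f :: "'y \<Rightarrow> 'x::real_normed_vector" and z :: "'j \<Rightarrow> 'y" and b :: "'j \<Rightarrow> 'j \<Rightarrow> real"
  assumes fin: "finite X" and \<rho>: "0 < \<rho>" and cover: "\<And>u. \<exists>x\<in>X. u \<in> ball (z x) \<rho>"
    and b: "\<And>x y. 0 \<le> b x y"
    and bound: "\<And>x y u v. x \<in> X \<Longrightarrow> y \<in> X \<Longrightarrow> u \<in> ball (z x) \<rho> \<Longrightarrow> v \<in> ball (z y) \<rho> \<Longrightarrow>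
      (norm (f u - f v))\<^sup>2 \<le> b x y"
  shows "variation f \<le> ennreal ((C * c * \<rho> powr m)\<^sup>2 * (\<Sum>x\<in>X. \<Sum>y\<in>X. b x y))"
proof -
  define P where "P x = ball (z (fst x)) \<rho> \<times> ball (z (snd x)) \<rho>" for x
  define a where "a x = b (fst x) (snd x)" for x
  have a: "0 \<le> a x" for x by (simp add: a_def b)
  have "variation f \<le> (\<integral>\<^sup>+y. (\<Sum>x\<in>X \<times> X. ennreal (a x) * indicator (P x) y) \<partial>(\<mu> \<Otimes>\<^sub>M \<mu>))"
    unfolding variation_def
  proof (rule nn_integral_mono, clarify)
    fix u v
    obtain x y where xy: "x \<in> X" "u \<in> ball (z x) \<rho>" "y \<in> X" "v \<in> ball (z y) \<rho>" using cover by metis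
    have "ennreal ((norm (f u - f v))\<^sup>2) \<le> ennreal (a (x, y)) * indicator (P (x, y)) (u, v)"
      using bound[OF xy(1,3,2,4)] xy by (auto simp: a_def P_def intro: ennreal_leI)
    also have "\<dots> \<le> (\<Sum>x\<in>X \<times> X. ennreal (a x) * indicator (P x) (u, v))"
      using xy fin by (intro member_le_sum[where f = "\<lambda>x. ennreal (a x) * indicator (P x) (u, v)"]) auto
    finally show "ennreal ((norm (f u - f v))\<^sup>2) \<le> (\<Sum>x\<in>X \<times> X. ennreal (a x) * indicator (P x) (u, v))" .
  qed
  also have "\<dots> = (\<Sum>x\<in>X \<times> X. ennreal (a x) * emeasure (\<mu> \<Otimes>\<^sub>M \<mu>) (P x))"
    by (subst nn_integral_sum) (auto simp: P_def nn_integral_cmult_indicator)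
  also have "\<dots> \<le> (\<Sum>x\<in>X \<times> X. ennreal (a x * (C * c * \<rho> powr m)\<^sup>2))"
  proof (rule sum_mono)
    fix x
    have "emeasure (\<mu> \<Otimes>\<^sub>M \<mu>) (P x)
        = ennreal (measure \<mu> (ball (z (fst x)) \<rho>) * measure \<mu> (ball (z (snd x)) \<rho>))"
      unfolding P_def by (subst emeasure_pair_measure_Times) (auto simp: emeasure_eq_measure ennreal_mult)
    moreover have "measure \<mu> (ball (z (fst x)) \<rho>) * measure \<mu> (ball (z (snd x)) \<rho>) \<le> (C * c * \<rho> powr m)\<^sup>2"
      unfolding power2_eq_square using ball_upper[OF \<rho>] C_pos c_pos by (intro mult_mono) auto
    ultimately show "ennreal (a x) * emeasure (\<mu> \<Otimes>\<^sub>M \<mu>) (P x) \<le> ennreal (a x * (C * c * \<rho> powr m)\<^sup>2)"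
      using a by (simp add: ennreal_mult[symmetric] ennreal_leI mult_left_mono)
  qed
  also have "\<dots> = ennreal (\<Sum>x\<in>X \<times> X. a x * (C * c * \<rho> powr m)\<^sup>2)"
    using a by (subst sum_ennreal) auto
  also have "(\<Sum>x\<in>X \<times> X. a x * (C * c * \<rho> powr m)\<^sup>2) = (C * c * \<rho> powr m)\<^sup>2 * (\<Sum>x\<in>X. \<Sum>y\<in>X. b x y)"
    by (simp add: a_def sum.cartesian_product case_prod_beta sum_distrib_right[symmetric])
  finally show ?thesis .
qed

text \<open>The marked points \<open>q i\<close> come close to every point of \<open>Y\<close> only after words of length at most \<open>N\<close>
  have been applied to them. So \<open>u\<close> and \<open>v\<close> are compared through
  \<open>u\<close>, \<open>w (q i)\<close>, \<open>q i\<close>, \<open>q j\<close>, \<open>w' (q j)\<close>, \<open>v\<close>. The outer differences are at most \<open>\<omega>\<close> by continuity, the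
  differences between \<open>q i\<close> and \<open>w (q i)\<close> are summed by \<open>local_energy_sum\<close>, and the middle difference is
  summed by the Poincare inequality, whose arcs are again words up to \<open>\<omega>\<close>.
  The number of marked points is at most of order \<open>1 / (\<rho> powr m)\<close> and the measure of the covering balls of
  order \<open>\<rho> powr m\<close>, so that the scale cancels from the final bound.\<close>

lemma poincare_imp_variation_bound:
  fixes q :: "'i \<Rightarrow> 'y" and h :: "'y \<Rightarrow> 'x::real_normed_vector" and k M N :: nat
    and \<rho> K \<omega> \<eta> :: real and W :: "'g list set" and A :: "real \<Rightarrow> real"
  defines "W \<equiv> words N"
  defines "A \<equiv> \<lambda>\<omega>. 2 * (\<Sum>w\<in>W. enn2real (energy h (foldr \<phi> w))) + 8 * real (card W) * \<omega>\<^sup>2"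
  assumes h: "continuous_on UNIV h"
    and I: "finite I" "I \<noteq> {}" and R: "R \<subseteq> I \<times> I" and deg: "\<And>i. card (R `` {i}) \<le> k"
    and \<rho>: "0 < \<rho>" "\<rho> \<le> 2 * D" and overlap: "\<And>u. card {i \<in> I. u \<in> ball (q i) \<rho>} \<le> M"
    and K: "L ^ N \<le> K"
    and arcs: "\<And>i j. (i, j) \<in> R \<Longrightarrow> \<exists>w\<in>W. dist (foldr \<phi> w (q i)) (q j) < K * \<rho>"
    and cover: "\<And>u. \<exists>i\<in>I. \<exists>w\<in>W. dist (foldr \<phi> w (q i)) u < K * \<rho>"
    and mod: "\<And>u v. dist u v < K * \<rho> \<Longrightarrow> norm (h u - h v) \<le> \<omega>"
    and \<eta>: "0 < \<eta>"
    and poincare: "\<eta> / card I * (\<Sum>(i, j)\<in>I \<times> I. (norm (h (q i) - h (q j)))\<^sup>2)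
      \<le> (\<Sum>(i, j)\<in>R. (norm (h (q i) - h (q j)))\<^sup>2)"
  shows "variation h \<le> ennreal ((card W * C * K powr m * M)\<^sup>2 *
    (4 * (4 * \<omega>\<^sup>2 + 2 * A \<omega> + 2 * k * (A \<omega> + \<omega>\<^sup>2) / \<eta>)))"
proof -
  define n where "n = real (card I)"
  define B where "B = c * \<rho> powr m"
  define b where "b i w = (norm (h (q i) - h (foldr \<phi> w (q i))))\<^sup>2" for i w
  define a where "a i = (\<Sum>w\<in>W. b i w)" for i
  define d where "d i j = (norm (h (q i) - h (q j)))\<^sup>2" for i j
  have finW: "finite W" unfolding W_def by (rule finite_words)
  have finR: "finite R" using R I by (meson finite_SigmaI finite_subset)
  have n: "0 < n" using I by (simp add: n_def card_gt_0_iff)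
  have B: "0 < B" using c_pos \<rho> by (simp add: B_def)
  have b: "0 \<le> b i w" for i w by (simp add: b_def)
  have a: "0 \<le> a i" for i unfolding a_def by (intro sum_nonneg b)
  have d: "0 \<le> d i j" for i j by (simp add: d_def)
  have ba: "b i w \<le> a i" if "w \<in> W" for i w
    unfolding a_def using that finW b by (intro member_le_sum) auto
  have LW: "L ^ length w * \<rho> \<le> K * \<rho>" if "w \<in> W" for w
  proof -
    have "L ^ length w \<le> L ^ N" using that L_ge_1 by (intro power_increasing) (auto simp: W_def)
    then show ?thesis using K \<rho> by (intro mult_right_mono) auto
  qed
  have K_pos: "0 < K" using K L_ge_1 by (meson less_le_trans zero_less_one zero_less_power order_trans)
  have M_I: "B * n \<le> real M"
    using card_balls_le[OF I(1) overlap \<rho>, of UNIV] prob_space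
    by (simp add: B_def n_def mult_ac sets_\<mu>)
  \<comment> \<open>the displacements of \<open>h\<close> at the marked points are controlled by the energies of the words\<close>
  have M_a: "B * (\<Sum>i\<in>I. a i) \<le> real M * A \<omega>"
  proof -
    have "B * (\<Sum>i\<in>I. a i) = (\<Sum>w\<in>W. B * (\<Sum>i\<in>I. b i w))"
      unfolding a_def by (subst sum.swap) (simp add: sum_distrib_left)
    also have "\<dots> \<le> (\<Sum>w\<in>W. real M * (2 * enn2real (energy h (foldr \<phi> w)) + 8 * \<omega>\<^sup>2))"
    proof (rule sum_mono)
      fix w assume w: "w \<in> W"
      then have "set w \<subseteq> S" by (simp add: W_def)
      from local_energy_sum[OF h this I(1) \<rho> overlap] mod LW[OF w]
      show "B * (\<Sum>i\<in>I. b i w) \<le> real M * (2 * enn2real (energy h (foldr \<phi> w)) + 8 * \<omega>\<^sup>2)"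
        unfolding B_def b_def by (meson less_le_trans)
    qed
    also have "\<dots> = real M * A \<omega>"
      unfolding A_def by (simp add: sum.distrib sum_distrib_left algebra_simps)
    finally show ?thesis .
  qed
  have sum_R: "(\<Sum>(i, j)\<in>R. d i j) \<le> real k * (2 * (\<Sum>i\<in>I. a i) + 2 * n * \<omega>\<^sup>2)"
  proof -
    have "(\<Sum>(i, j)\<in>R. d i j) \<le> (\<Sum>(i, j)\<in>R. 2 * a i + 2 * \<omega>\<^sup>2)"
    proof (rule sum_mono, clarify)
      fix i j assume ij: "(i, j) \<in> R"
      obtain w where w: "w \<in> W" "dist (foldr \<phi> w (q i)) (q j) < K * \<rho>" using arcs[OF ij] by blast
      have "d i j \<le> 2 * b i w + 2 * (norm (h (foldr \<phi> w (q i)) - h (q j)))\<^sup>2"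
        unfolding d_def b_def
        using norm_add_square[of "h (q i) - h (foldr \<phi> w (q i))" "h (foldr \<phi> w (q i)) - h (q j)"] by simp
      also have "\<dots> \<le> 2 * a i + 2 * \<omega>\<^sup>2"
        using ba[OF w(1)] mod[OF w(2)] by (intro add_mono mult_left_mono power_mono) auto
      finally show "d i j \<le> 2 * a i + 2 * \<omega>\<^sup>2" .
    qed
    also have "\<dots> = (\<Sum>i\<in>I. \<Sum>j\<in>R `` {i}. 2 * a i + 2 * \<omega>\<^sup>2)"
    proof -
      have eq: "R = (SIGMA i:I. R `` {i})" using R by auto
      have fin: "\<forall>i\<in>I. finite (R `` {i})" using finR by (auto intro: finite_Image)
      have "(\<Sum>(i, j)\<in>R. 2 * a i + 2 * \<omega>\<^sup>2) = (\<Sum>(i, j)\<in>(SIGMA i:I. R `` {i}). 2 * a i + 2 * \<omega>\<^sup>2)"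
        by (rule sum.cong[OF eq refl])
      also have "\<dots> = (\<Sum>i\<in>I. \<Sum>j\<in>R `` {i}. 2 * a i + 2 * \<omega>\<^sup>2)"
        by (rule sum.Sigma[OF I(1) fin, symmetric])
      finally show ?thesis .
    qed
    also have "\<dots> = (\<Sum>i\<in>I. real (card (R `` {i})) * (2 * a i + 2 * \<omega>\<^sup>2))" by simp
    also have "\<dots> \<le> (\<Sum>i\<in>I. real k * (2 * a i + 2 * \<omega>\<^sup>2))"
      using a deg by (intro sum_mono mult_right_mono) auto
    also have "\<dots> = real k * (2 * (\<Sum>i\<in>I. a i) + 2 * n * \<omega>\<^sup>2)"
      by (simp add: sum_distrib_left[symmetric] sum.distrib n_def)
    finally show ?thesis .
  qed
  define T where "T = (\<Sum>i\<in>I. \<Sum>j\<in>I. d i j)"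
  have T: "T \<le> n / \<eta> * (real k * (2 * (\<Sum>i\<in>I. a i) + 2 * n * \<omega>\<^sup>2))"
  proof -
    have "\<eta> / n * T \<le> (\<Sum>(i, j)\<in>R. d i j)"
      using poincare by (simp add: n_def T_def d_def sum.cartesian_product)
    with sum_R have "\<eta> / n * T \<le> real k * (2 * (\<Sum>i\<in>I. a i) + 2 * n * \<omega>\<^sup>2)" by linarith
    then have "n / \<eta> * (\<eta> / n * T) \<le> n / \<eta> * (real k * (2 * (\<Sum>i\<in>I. a i) + 2 * n * \<omega>\<^sup>2))"
      using n \<eta> by (intro mult_left_mono) auto
    then show ?thesis using n \<eta> by simp
  qed
  define e where "e x y = 4 * ((2 * \<omega>)\<^sup>2 + a (fst x) + d (fst x) (fst y) + a (fst y))" for x y :: "'i \<times> 'g list"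
  have "variation h \<le> ennreal ((C * c * (K * \<rho>) powr m)\<^sup>2 * (\<Sum>x\<in>I \<times> W. \<Sum>y\<in>I \<times> W. e x y))"
  proof (rule variation_cover[where z = "\<lambda>x. foldr \<phi> (snd x) (q (fst x))"])
    show "finite (I \<times> W)" using I finW by simp
    show "0 < K * \<rho>" using K_pos \<rho> by simp
    show "\<exists>x\<in>I \<times> W. u \<in> ball (foldr \<phi> (snd x) (q (fst x))) (K * \<rho>)" for u
      using cover[of u] by auto
    show "0 \<le> e x y" for x y unfolding e_def using a d by auto
    fix x y u v
    assume x: "x \<in> I \<times> W" and y: "y \<in> I \<times> W"
      and u: "u \<in> ball (foldr \<phi> (snd x) (q (fst x))) (K * \<rho>)"
      and v: "v \<in> ball (foldr \<phi> (snd y) (q (fst y))) (K * \<rho>)"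
    obtain i w j w' where xy: "x = (i, w)" "y = (j, w')" "w \<in> W" "w' \<in> W" using x y by auto
    let ?u = "foldr \<phi> w (q i)" and ?v = "foldr \<phi> w' (q j)"
    have hu: "norm (h ?u - h u) \<le> \<omega>" "norm (h ?v - h v) \<le> \<omega>"
      using u v mod xy by auto
    have 1: "norm ((h u - h ?u) + (h ?v - h v)) \<le> 2 * \<omega>"
      using norm_triangle_ineq[of "h u - h ?u" "h ?v - h v"] hu by (simp add: norm_minus_commute)
    have "(norm (((h u - h ?u) + (h ?v - h v)) + (h ?u - h (q i)) + (h (q i) - h (q j)) + (h (q j) - h ?v)))\<^sup>2
        \<le> 4 * ((2 * \<omega>)\<^sup>2 + (norm (h ?u - h (q i)))\<^sup>2 + (norm (h (q i) - h (q j)))\<^sup>2 + (norm (h (q j) - h ?v))\<^sup>2)"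
      by (rule norm_add4_square[OF 1 order_refl order_refl order_refl])
    also have "((h u - h ?u) + (h ?v - h v)) + (h ?u - h (q i)) + (h (q i) - h (q j)) + (h (q j) - h ?v) = h u - h v"
      by simp
    also have "4 * ((2 * \<omega>)\<^sup>2 + (norm (h ?u - h (q i)))\<^sup>2 + (norm (h (q i) - h (q j)))\<^sup>2 + (norm (h (q j) - h ?v))\<^sup>2)
        = 4 * ((2 * \<omega>)\<^sup>2 + b i w + d i j + b j w')"
      by (simp add: b_def d_def norm_minus_commute)
    also have "\<dots> \<le> e x y"
      unfolding e_def using ba xy by (auto intro!: mult_left_mono add_mono)
    finally show "(norm (h u - h v))\<^sup>2 \<le> e x y" .
  qed
  also have "\<dots> \<le> ennreal ((card W * C * K powr m * M)\<^sup>2 *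
    (4 * (4 * \<omega>\<^sup>2 + 2 * A \<omega> + 2 * k * (A \<omega> + \<omega>\<^sup>2) / \<eta>)))"
  proof (rule ennreal_leI)
    define sa where "sa = (\<Sum>i\<in>I. a i)"
    have sa: "0 \<le> sa" unfolding sa_def by (intro sum_nonneg a)
    have A: "0 \<le> A \<omega>" unfolding A_def by (intro add_nonneg_nonneg mult_nonneg_nonneg sum_nonneg) auto
    have "(\<Sum>x\<in>I \<times> W. \<Sum>y\<in>I \<times> W. e x y)
        = (real (card W))\<^sup>2 * (\<Sum>i\<in>I. \<Sum>j\<in>I. 4 * ((2 * \<omega>)\<^sup>2 + a i + d i j + a j))"
    proof -
      have fst: "(\<Sum>x\<in>I \<times> W. g (fst x)) = real (card W) * (\<Sum>i\<in>I. g i)" for g :: "'i \<Rightarrow> real"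
      proof -
        have "(\<Sum>x\<in>I \<times> W. g (fst x)) = (\<Sum>i\<in>I. \<Sum>w\<in>W. g i)"
          unfolding sum.cartesian_product by (rule sum.cong) auto
        then show ?thesis by (simp add: sum_distrib_left)
      qed
      have inner: "(\<Sum>y\<in>I \<times> W. e x y)
          = real (card W) * (\<Sum>j\<in>I. 4 * ((2 * \<omega>)\<^sup>2 + a (fst x) + d (fst x) j + a j))" for x
        unfolding e_def by (rule fst)
      have "(\<Sum>x\<in>I \<times> W. \<Sum>y\<in>I \<times> W. e x y)
          = real (card W) * (\<Sum>i\<in>I. real (card W) * (\<Sum>j\<in>I. 4 * ((2 * \<omega>)\<^sup>2 + a i + d i j + a j)))"
        unfolding inner
        by (rule fst[of "\<lambda>i. real (card W) * (\<Sum>j\<in>I. 4 * ((2 * \<omega>)\<^sup>2 + a i + d i j + a j))"])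
      then show ?thesis by (simp only: power2_eq_square sum_distrib_left[symmetric] mult.assoc)
    qed
    also have "(\<Sum>i\<in>I. \<Sum>j\<in>I. 4 * ((2 * \<omega>)\<^sup>2 + a i + d i j + a j))
        = 4 * (4 * \<omega>\<^sup>2 * n\<^sup>2 + 2 * n * sa + T)"
    proof -
      have "(\<Sum>i\<in>I. \<Sum>j\<in>I. (2 * \<omega>)\<^sup>2 + a i + d i j + a j) = n * (n * (2 * \<omega>)\<^sup>2) + n * sa + T + n * sa"
        by (simp only: sum.distrib sum_constant sum_distrib_left[symmetric] n_def sa_def T_def)
      then have "(\<Sum>i\<in>I. \<Sum>j\<in>I. 4 * ((2 * \<omega>)\<^sup>2 + a i + d i j + a j))
          = 4 * (n * (n * (2 * \<omega>)\<^sup>2) + n * sa + T + n * sa)"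
        by (simp only: sum_distrib_left[symmetric])
      then show ?thesis by (simp add: power2_eq_square algebra_simps)
    qed
    finally have S: "(\<Sum>x\<in>I \<times> W. \<Sum>y\<in>I \<times> W. e x y)
        = (real (card W))\<^sup>2 * (4 * (4 * \<omega>\<^sup>2 * n\<^sup>2 + 2 * n * sa + T))" .
    have CB: "C * c * (K * \<rho>) powr m = C * K powr m * B"
      using K_pos \<rho> by (simp add: B_def powr_mult)
    have Bn: "0 \<le> B * n" "0 \<le> B * sa" using B n sa by auto
    have "B\<^sup>2 * (4 * \<omega>\<^sup>2 * n\<^sup>2 + 2 * n * sa + T)
        \<le> B\<^sup>2 * (4 * \<omega>\<^sup>2 * n\<^sup>2 + 2 * n * sa + n / \<eta> * (real k * (2 * sa + 2 * n * \<omega>\<^sup>2)))"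
      using T unfolding sa_def by (intro mult_left_mono add_left_mono) auto
    also have "\<dots> = 4 * \<omega>\<^sup>2 * ((B * n) * (B * n)) + 2 * ((B * n) * (B * sa))
        + 2 * k / \<eta> * ((B * n) * (B * sa) + \<omega>\<^sup>2 * ((B * n) * (B * n)))"
      by (simp add: power2_eq_square algebra_simps)
    also have "\<dots> \<le> 4 * \<omega>\<^sup>2 * (real M * real M) + 2 * (real M * (real M * A \<omega>))
        + 2 * k / \<eta> * (real M * (real M * A \<omega>) + \<omega>\<^sup>2 * (real M * real M))"
    proof -
      have sq: "(B * n) * (B * n) \<le> real M * real M"
        using M_I Bn by (intro mult_mono) auto
      have mixed: "(B * n) * (B * sa) \<le> real M * (real M * A \<omega>)"
        using M_I M_a Bn unfolding sa_def[symmetric] by (intro mult_mono[of "B * n" _ "B * sa"]) auto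
      show ?thesis using sq mixed \<eta> by (intro add_mono mult_left_mono) auto
    qed
    also have "\<dots> = (real M)\<^sup>2 * (4 * \<omega>\<^sup>2 + 2 * A \<omega> + 2 * k * (A \<omega> + \<omega>\<^sup>2) / \<eta>)"
      by (simp add: power2_eq_square field_simps)
    finally have main: "B\<^sup>2 * (4 * \<omega>\<^sup>2 * n\<^sup>2 + 2 * n * sa + T)
        \<le> (real M)\<^sup>2 * (4 * \<omega>\<^sup>2 + 2 * A \<omega> + 2 * k * (A \<omega> + \<omega>\<^sup>2) / \<eta>)" .
    have "(C * c * (K * \<rho>) powr m)\<^sup>2 * (\<Sum>x\<in>I \<times> W. \<Sum>y\<in>I \<times> W. e x y)
        = (4 * (card W * C * K powr m)\<^sup>2) * (B\<^sup>2 * (4 * \<omega>\<^sup>2 * n\<^sup>2 + 2 * n * sa + T))"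
      unfolding S CB by (simp add: power_mult_distrib mult_ac)
    also have "\<dots> \<le> (4 * (card W * C * K powr m)\<^sup>2) *
        ((real M)\<^sup>2 * (4 * \<omega>\<^sup>2 + 2 * A \<omega> + 2 * k * (A \<omega> + \<omega>\<^sup>2) / \<eta>))"
      using main by (intro mult_left_mono) auto
    also have "\<dots> = (card W * C * K powr m * M)\<^sup>2 *
        (4 * (4 * \<omega>\<^sup>2 + 2 * A \<omega> + 2 * k * (A \<omega> + \<omega>\<^sup>2) / \<eta>))"
      by (simp add: power_mult_distrib mult_ac)
    finally show "(C * c * (K * \<rho>) powr m)\<^sup>2 * (\<Sum>x\<in>I \<times> W. \<Sum>y\<in>I \<times> W. e x y)
        \<le> (card W * C * K powr m * M)\<^sup>2 *
          (4 * (4 * \<omega>\<^sup>2 + 2 * A \<omega> + 2 * k * (A \<omega> + \<omega>\<^sup>2) / \<eta>))" .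
  qed
  finally show ?thesis .
qed

end

lemma enn2real_finite_le:
  assumes "x \<le> ennreal a * y" "y < \<top>" "0 \<le> a"
  shows "enn2real x \<le> a * enn2real y"
  using enn2real_mono[OF assms(1)] assms(2,3) by (simp add: enn2real_mult ennreal_mult_less_top)

context lipschitz_action
begin

text \<open>Every vertex \<open>i\<close> of \<open>G\<close> is marked by a point \<open>q i\<close> whose image lies within \<open>B\<close> of \<open>i\<close>. Bounded graph
  distance gives bounded warped distance, hence a word of bounded length. Conversely, vertices
  whose marked points are \<open>1/t\<close>-close to \<open>u\<close> lie in a ball of bounded radius around \<open>f u\<close>, which has
  boundedly many elements by the degree bound. The summand 1 in \<open>K\<close> makes the inequalities strict.\<close>

lemma quasi_isometry_marking:
  fixes G :: "'v pair_pre_digraph" and f :: "'y \<Rightarrow> 'v" and A B K0 t R1 K :: real and N :: nat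
  defines "R1 \<equiv> K0 * (2 * B + 1 + A)" and "N \<equiv> nat \<lfloor>R1 + 1\<rfloor>" and "K \<equiv> L ^ N * (R1 + 1) + 1"
  assumes G: "pair_graph G" and con: "Digraph_Component.connected (with_proj G)"
    and deg: "\<And>v. v \<in> pverts G \<Longrightarrow> out_degree (with_proj G) v \<le> k"
    and qi: "quasi_isometry A B K0 UNIV (warped_metric \<phi> S t) (pverts G) (graph_metric G) f"
    and const_bounds: "0 \<le> A" "0 < B" "1 \<le> K0" and t: "0 < t"
  obtains q :: "'v \<Rightarrow> 'y"
  where "\<And>i j. (i, j) \<in> parcs G \<Longrightarrow> \<exists>w\<in>words N. dist (foldr \<phi> w (q i)) (q j) < K * (1/t)"
    and "\<And>u. \<exists>i\<in>pverts G. \<exists>w\<in>words N. dist (foldr \<phi> w (q i)) u < K * (1/t)"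
    and "\<And>u. card {i \<in> pverts G. u \<in> ball (q i) (1/t)} \<le> (\<Sum>n\<le>nat \<lfloor>K0 + A + B\<rfloor>. k ^ n)"
proof -
  let ?w = "warped_metric \<phi> S t" and ?d = "graph_metric G"
  have fV: "f u \<in> pverts G" for u using qi by (auto simp: quasi_isometry_def)
  have lower: "?w u v \<le> K0 * (?d (f u) (f v) + A)" for u v
  proof -
    have "inverse K0 * ?w u v \<le> ?d (f u) (f v) + A"
      using qi unfolding quasi_isometry_def by (metis UNIV_I diff_le_eq)
    then have "K0 * (inverse K0 * ?w u v) \<le> K0 * (?d (f u) (f v) + A)"
      using const_bounds by (intro mult_left_mono) auto
    moreover have "K0 \<noteq> 0" using const_bounds by auto
    then have "K0 * (inverse K0 * ?w u v) = ?w u v" by simp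
    ultimately show ?thesis by simp
  qed
  have upper: "?d (f u) (f v) \<le> K0 * ?w u v + A" for u v
    using qi unfolding quasi_isometry_def by blast
  have "\<forall>i\<in>pverts G. \<exists>u. ?d (f u) i < B"
    using qi unfolding quasi_isometry_def by blast
  then obtain q where q: "\<And>i. i \<in> pverts G \<Longrightarrow> ?d (f (q i)) i < B" by metis
  have R1: "0 \<le> R1" using const_bounds by (simp add: R1_def)
  have word: "\<exists>w\<in>words N. dist (foldr \<phi> w u) v < K * (1/t)" if close: "?w u v \<le> R1" for u v
  proof -
    obtain w where w: "set w \<subseteq> S" "real (length w) \<le> R1 + 1"
      "dist (foldr \<phi> w u) v \<le> L ^ nat \<lfloor>R1 + 1\<rfloor> * (R1 + 1) / t"
      using warped_close_imp_word[OF t close] by blast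
    have "length w \<le> N" unfolding N_def by (rule le_nat_floor[OF w(2)])
    moreover have "L ^ nat \<lfloor>R1 + 1\<rfloor> * (R1 + 1) / t < K * (1/t)"
      using t by (simp add: K_def N_def divide_strict_right_mono)
    ultimately show ?thesis using w by (intro bexI[of _ w]) auto
  qed
  note walk = graph_metric_attained[OF G con]
  show ?thesis
  proof (rule that[of q])
    fix i j assume ij: "(i, j) \<in> parcs G"
    have V: "i \<in> pverts G" "j \<in> pverts G"
      using G ij by (auto dest: pair_wf_digraph.in_arcsD1 pair_wf_digraph.in_arcsD2
        simp: pair_graph_def pair_digraph_def pair_fin_digraph_def)
    obtain a where a: "(f (q i), i) \<in> parcs G ^^ a" "?d (f (q i)) i = real a"
      using walk[OF fV V(1)] by metis
    obtain b where b: "(f (q j), j) \<in> parcs G ^^ b" "?d (f (q j)) j = real b"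
      using walk[OF fV V(2)] by metis
    have "(f (q i), f (q j)) \<in> parcs G ^^ (Suc a + b)"
      using relpow_trans[OF relpow_Suc_I[OF a(1) ij] relpow_sym[OF pair_graph_sym[OF G] b(1)]] .
    then have "?d (f (q i)) (f (q j)) \<le> real (Suc a + b)"
      by (rule graph_metric_le[OF G fV])
    also have "\<dots> \<le> 2 * B + 1" using q[OF V(1)] q[OF V(2)] a(2) b(2) by simp
    finally have "?w (q i) (q j) \<le> K0 * (2 * B + 1 + A)"
      using lower[of "q i" "q j"] const_bounds
      by (smt (verit) mult_left_mono)
    then show "\<exists>w\<in>words N. dist (foldr \<phi> w (q i)) (q j) < K * (1/t)"
      by (intro word) (simp add: R1_def)
  next
    fix u
    have "?w (q (f u)) u \<le> K0 * (?d (f (q (f u))) (f u) + A)" by (rule lower)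
    also have "\<dots> \<le> K0 * (2 * B + 1 + A)"
      using q[OF fV[of u]] const_bounds by (intro mult_left_mono) auto
    finally have "?w (q (f u)) u \<le> R1" by (simp add: R1_def)
    then show "\<exists>i\<in>pverts G. \<exists>w\<in>words N. dist (foldr \<phi> w (q i)) u < K * (1/t)"
      by (intro bexI[OF _ fV[of u]] word)
  next
    fix u
    let ?n = "nat \<lfloor>K0 + A + B\<rfloor>"
    have "{i \<in> pverts G. u \<in> ball (q i) (1/t)} \<subseteq> {i. \<exists>n\<le>?n. (f u, i) \<in> parcs G ^^ n}"
    proof safe
      fix i assume i: "i \<in> pverts G" "u \<in> ball (q i) (1/t)"
      have adm: "warped_admissible \<phi> S t ?w" by (rule warped_metric_greatest(1)[OF t])
      then have "?w u (q i) \<le> t * dist u (q i)" by (simp add: warped_admissible_def)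
      also have "\<dots> \<le> 1" using i(2) t by (simp add: dist_commute field_simps)
      finally have "K0 * ?w u (q i) \<le> K0" using const_bounds by simp
      then have d1: "?d (f u) (f (q i)) \<le> K0 + A" using upper[of u "q i"] by linarith
      obtain a where a: "(f u, f (q i)) \<in> parcs G ^^ a" "?d (f u) (f (q i)) = real a"
        using walk[OF fV fV] by metis
      obtain b where b: "(f (q i), i) \<in> parcs G ^^ b" "?d (f (q i)) i = real b"
        using walk[OF fV i(1)] by metis
      have "real (a + b) \<le> K0 + A + B" using d1 a(2) b(2) q[OF i(1)] by simp
      then have "a + b \<le> ?n" by (rule le_nat_floor)
      then show "\<exists>n\<le>?n. (f u, i) \<in> parcs G ^^ n" using relpow_trans[OF a(1) b(1)] by blast
    qed
    moreover note card_ball_le[of "parcs G" k ?n "f u"] card_image_le_out_degree[OF G deg]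
    ultimately show "card {i \<in> pverts G. u \<in> ball (q i) (1/t)} \<le> (\<Sum>n\<le>?n. k ^ n)"
      by (meson card_mono order_trans)
  qed
qed

text \<open>For a fixed continuous function the level \<open>t\<close> is taken so large that the modulus of continuity at
  scale \<open>K/t\<close> is below \<open>\<omega>\<close>, while the constants \<open>K1\<close> and \<open>K2\<close> do not depend on \<open>t\<close>. Letting \<open>\<omega>\<close> tend to 0
  removes the error term.\<close>

lemma expander_imp_continuous_gap:
  fixes G :: "real \<Rightarrow> 'v pair_pre_digraph"
  assumes exp: "expander_wrt TYPE('x::banach) {0<..} G"
    and con: "\<And>t. 0 < t \<Longrightarrow> Digraph_Component.connected (with_proj (G t))"
    and qi: "quasi_isometric_families {0<..} (\<lambda>t. UNIV) (\<lambda>t. warped_metric \<phi> S t)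
         (\<lambda>t. pverts (G t)) (\<lambda>t. graph_metric (G t))"
  shows "\<exists>K1>0. \<forall>h :: 'y \<Rightarrow> 'x. continuous_on UNIV h \<longrightarrow>
    variation h \<le> ennreal K1 * (\<Sum>s\<in>S. energy h (\<phi> s))"
proof -
  obtain k \<eta> where G: "\<And>t. 0 < t \<Longrightarrow> pair_graph (G t)"
    and deg: "\<And>t v. 0 < t \<Longrightarrow> v \<in> pverts (G t) \<Longrightarrow> out_degree (with_proj (G t)) v \<le> k"
    and \<eta>: "0 < \<eta>"
    and poincare: "\<And>t (F :: 'v \<Rightarrow> 'x). 0 < t \<Longrightarrow> \<eta> / card (pverts (G t)) *
        (\<Sum>(x, y)\<in>pverts (G t) \<times> pverts (G t). (norm (F x - F y))\<^sup>2)
        \<le> (\<Sum>(x, y)\<in>parcs (G t). (norm (F x - F y))\<^sup>2)"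
    using exp unfolding expander_wrt_def by (metis greaterThan_iff)
  obtain A B K0 where const_bounds: "0 \<le> A" "0 < B" "1 \<le> K0"
    and qi: "\<And>t. 0 < t \<Longrightarrow> \<exists>f. quasi_isometry A B K0 UNIV (warped_metric \<phi> S t)
        (pverts (G t)) (graph_metric (G t)) f"
    using qi unfolding quasi_isometric_families_def by (metis greaterThan_iff)
  define R1 where "R1 = K0 * (2 * B + 1 + A)"
  define N where "N = nat \<lfloor>R1 + 1\<rfloor>"
  define K where "K = L ^ N * (R1 + 1) + 1"
  define M where "M = (\<Sum>n\<le>nat \<lfloor>K0 + A + B\<rfloor>. k ^ n)"
  define W where "W = words N"
  define Z where "Z = (card W * C * K powr m * M)\<^sup>2 * 4"
  define \<alpha> where "\<alpha> = 2 * real (card W) * (2 + 2 * Q) ^ N"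
  define K1 where "K1 = Z * (2 * \<alpha> + 2 * k * \<alpha> / \<eta>)"
  define K2 where "K2 = Z * (4 + 16 * real (card W) + 2 * k * (8 * real (card W) + 1) / \<eta>)"
  have Q: "0 \<le> Q" using C_pos by simp
  have "0 \<le> R1" using const_bounds by (simp add: R1_def)
  then have "L ^ N * 1 \<le> L ^ N * (R1 + 1)" using L_ge_1 by (intro mult_left_mono) auto
  then have LK: "L ^ N \<le> K" by (simp add: K_def)
  have "1 \<le> L ^ N" by (rule one_le_power[OF L_ge_1])
  then have K_pos: "0 < K" using LK by linarith
  have Z: "0 \<le> Z" by (simp add: Z_def)
  have \<alpha>: "0 \<le> \<alpha>" using Q by (simp add: \<alpha>_def)
  have K1: "0 \<le> K1" using Z \<alpha> \<eta> by (simp add: K1_def)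
  have K2: "0 \<le> K2" using Z \<eta> by (simp add: K2_def)
  have main: "variation h \<le> ennreal (K1 * E + K2 * \<omega>\<^sup>2)"
    if h: "continuous_on UNIV (h :: 'y \<Rightarrow> 'x)" and E: "E = enn2real (\<Sum>s\<in>S. energy h (\<phi> s))"
      and \<omega>: "0 < \<omega>" for h E \<omega>
  proof -
    have "uniformly_continuous_on UNIV h" by (rule compact_uniformly_continuous[OF h compact_UNIV])
    then obtain \<delta> where \<delta>: "0 < \<delta>" "\<And>u v. dist u v < \<delta> \<Longrightarrow> dist (h u) (h v) < \<omega>"
      using \<omega> unfolding uniformly_continuous_on_def by (metis UNIV_I)
    define \<rho> where "\<rho> = min (2 * D) (\<delta> / K)"
    have \<rho>: "0 < \<rho>" "\<rho> \<le> 2 * D" "K * \<rho> \<le> \<delta>"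
      using D_pos \<delta> K_pos by (auto simp: \<rho>_def min_def field_simps)
    define t where "t = 1 / \<rho>"
    have t: "0 < t" "1 / t = \<rho>" using \<rho> by (auto simp: t_def)
    obtain f where f: "quasi_isometry A B K0 UNIV (warped_metric \<phi> S t) (pverts (G t)) (graph_metric (G t)) f"
      using qi[OF t(1)] by blast
    obtain q where q: "\<And>i j. (i, j) \<in> parcs (G t) \<Longrightarrow> \<exists>w\<in>words N. dist (foldr \<phi> w (q i)) (q j) < K * \<rho>"
      "\<And>u. \<exists>i\<in>pverts (G t). \<exists>w\<in>words N. dist (foldr \<phi> w (q i)) u < K * \<rho>"
      "\<And>u. card {i \<in> pverts (G t). u \<in> ball (q i) \<rho>} \<le> M"
      using quasi_isometry_marking[OF G[OF t(1)] con[OF t(1)] deg[OF t(1)] f const_bounds t(1)]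
      unfolding t(2) M_def K_def N_def R1_def by blast
    interpret G: pair_graph "G t" by (rule G[OF t(1)])
    define a where "a = 2 * (\<Sum>w\<in>W. enn2real (energy h (foldr \<phi> w))) + 8 * real (card W) * \<omega>\<^sup>2"
    have "variation h \<le> ennreal ((card W * C * K powr m * M)\<^sup>2 *
        (4 * (4 * \<omega>\<^sup>2 + 2 * a + 2 * k * (a + \<omega>\<^sup>2) / \<eta>)))"
      unfolding a_def W_def
    proof (rule poincare_imp_variation_bound[where I = "pverts (G t)" and R = "parcs (G t)" and q = q,
          OF h G.pair_finite_verts _ _ _ \<rho>(1,2) q(3) LK q(1) q(2) _ \<eta> poincare[OF t(1)]])
      show "pverts (G t) \<noteq> {}"
        using con[OF t(1)] by (simp add: connected_iff_relpow[OF G[OF t(1)]])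
      show "parcs (G t) \<subseteq> pverts (G t) \<times> pverts (G t)"
        using G.in_arcsD1 G.in_arcsD2 by auto
      show "card (parcs (G t) `` {i}) \<le> k" for i
        using card_image_le_out_degree[OF G[OF t(1)] deg[OF t(1)]] by blast
      show "norm (h u - h v) \<le> \<omega>" if "dist u v < K * \<rho>" for u v
        using \<delta>(2)[of u v] that \<rho>(3) by (simp add: dist_norm)
    qed
    also have "(card W * C * K powr m * M)\<^sup>2 * (4 * (4 * \<omega>\<^sup>2 + 2 * a + 2 * k * (a + \<omega>\<^sup>2) / \<eta>))
        = Z * (4 * \<omega>\<^sup>2 + 2 * a + 2 * k * (a + \<omega>\<^sup>2) / \<eta>)"
      by (simp add: Z_def)
    also have "\<dots> \<le> Z * (4 * \<omega>\<^sup>2 + 2 * (\<alpha> * E + 8 * real (card W) * \<omega>\<^sup>2)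
        + 2 * k * ((\<alpha> * E + 8 * real (card W) * \<omega>\<^sup>2) + \<omega>\<^sup>2) / \<eta>)"
    proof -
      have "(\<Sum>w\<in>W. enn2real (energy h (foldr \<phi> w))) \<le> (\<Sum>w\<in>W. (2 + 2 * Q) ^ N * E)"
      proof (rule sum_mono)
        fix w assume w: "w \<in> W"
        then have "energy h (foldr \<phi> w) \<le> ennreal ((2 + 2 * Q) ^ length w) * (\<Sum>s\<in>S. energy h (\<phi> s))"
          by (intro energy_word h) (auto simp: W_def)
        moreover have "(\<Sum>s\<in>S. energy h (\<phi> s)) < \<top>"
          using energy_finite[OF h] finite_S by simp
        ultimately have "enn2real (energy h (foldr \<phi> w)) \<le> (2 + 2 * Q) ^ length w * E"
          unfolding E using Q by (intro enn2real_finite_le) auto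
        also have "\<dots> \<le> (2 + 2 * Q) ^ N * E"
          using w Q by (intro mult_right_mono power_increasing) (auto simp: W_def E)
        finally show "enn2real (energy h (foldr \<phi> w)) \<le> (2 + 2 * Q) ^ N * E" .
      qed
      then have "a \<le> \<alpha> * E + 8 * real (card W) * \<omega>\<^sup>2"
        by (simp add: a_def \<alpha>_def mult_ac)
      then show ?thesis
        using Z \<eta> by (intro mult_left_mono add_mono divide_right_mono) auto
    qed
    also have "\<dots> = K1 * E + K2 * \<omega>\<^sup>2"
      using \<eta> by (simp add: K1_def K2_def field_simps)
    finally show ?thesis by (simp add: ennreal_leI)
  qed
  show ?thesis
  proof (intro exI[of _ "K1 + 1"] conjI allI impI)
    show "0 < K1 + 1" using K1 by simp
    fix h :: "'y \<Rightarrow> 'x" assume h: "continuous_on UNIV h"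
    define E where "E = enn2real (\<Sum>s\<in>S. energy h (\<phi> s))"
    have E: "0 \<le> E" "ennreal E = (\<Sum>s\<in>S. energy h (\<phi> s))"
      using energy_finite[OF h] finite_S by (auto simp: E_def)
    have "variation h \<le> ennreal (K1 * E)"
    proof (rule ennreal_le_epsilon)
      fix e :: real assume e: "0 < e"
      \<comment> \<open>chosen so that \<open>K2 * \<omega>\<^sup>2 \<le> e\<close>, also if \<open>K2\<close> is 0\<close>
      define \<omega> where "\<omega> = sqrt (e / (K2 + 1))"
      have "0 < \<omega>" using e K2 by (simp add: \<omega>_def)
      from main[OF h E_def this] have "variation h \<le> ennreal (K1 * E + K2 * \<omega>\<^sup>2)" .
      also have "K2 * \<omega>\<^sup>2 \<le> e"
        using e K2 by (simp add: \<omega>_def field_simps)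
      then have "ennreal (K1 * E + K2 * \<omega>\<^sup>2) \<le> ennreal (K1 * E) + ennreal e"
        using K1 E e by (simp add: ennreal_plus[symmetric] ennreal_leI del: ennreal_plus)
      finally show "variation h \<le> ennreal (K1 * E) + ennreal e" .
    qed
    also have "\<dots> \<le> ennreal ((K1 + 1) * E)"
      using E by (intro ennreal_leI mult_right_mono) auto
    also have "\<dots> = ennreal (K1 + 1) * (\<Sum>s\<in>S. energy h (\<phi> s))"
      unfolding E(2)[symmetric] using K1 E by (simp add: ennreal_mult)
    finally show "variation h \<le> ennreal (K1 + 1) * (\<Sum>s\<in>S. energy h (\<phi> s))" .
  qed
qed

end

section \<open>Passing from continuous functions to square-integrable ones\<close>

lemma norm_add3_square:
  "(norm (a + b + c))\<^sup>2 \<le> 3 * ((norm a)\<^sup>2 + (norm b)\<^sup>2 + (norm c)\<^sup>2)"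
proof -
  have "(norm (a + b + c))\<^sup>2 \<le> (norm a + norm b + norm c)\<^sup>2"
    by (intro power_mono norm_triangle_le add_mono norm_triangle_ineq) auto
  also have "\<dots> \<le> 3 * ((norm a)\<^sup>2 + (norm b)\<^sup>2 + (norm c)\<^sup>2)"
    using zero_le_power2[of "norm a - norm b"] zero_le_power2[of "norm b - norm c"]
      zero_le_power2[of "norm a - norm c"]
    by (simp add: power2_eq_square algebra_simps)
  finally show ?thesis .
qed

lemma nn_integral_triple_add:
  fixes f g k :: "'a \<Rightarrow> ennreal"
  assumes [measurable]: "f \<in> borel_measurable M" "g \<in> borel_measurable M" "k \<in> borel_measurable M"
  shows "(\<integral>\<^sup>+u. 3 * (f u + g u + k u) \<partial>M)
    = 3 * ((\<integral>\<^sup>+u. f u \<partial>M) + (\<integral>\<^sup>+u. g u \<partial>M) + (\<integral>\<^sup>+u. k u \<partial>M))"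
  by (simp add: nn_integral_cmult nn_integral_add)

lemma ennreal_norm_add3_square:
  "ennreal ((norm (a + b + c))\<^sup>2)
    \<le> 3 * (ennreal ((norm a)\<^sup>2) + ennreal ((norm b)\<^sup>2) + ennreal ((norm c)\<^sup>2))"
  using ennreal_leI[OF norm_add3_square[of a b c]] by (simp add: ennreal_plus ennreal_mult)

context lipschitz_action
begin

text \<open>By quasi-invariance the preimage of a null set is a null set, so the energies depend only on the
  class of a function modulo null sets.\<close>

lemma AE_generator:
  assumes s: "s \<in> S" and P: "AE u in \<mu>. P u"
  shows "AE u in \<mu>. P (\<phi> s u)"
proof -
  obtain N where N: "{u \<in> space \<mu>. \<not> P u} \<subseteq> N" "N \<in> null_sets \<mu>"
    using P by (auto simp: eventually_ae_filter)
  have "\<phi> s \<in> measurable \<mu> \<mu>"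
    using continuous_measurable[OF generator_continuous[OF s]] measurable_cong_sets[OF refl sets_\<mu>] by blast
  then have pre: "\<phi> s -` N \<in> sets \<mu>"
    using measurable_sets[of "\<phi> s" \<mu> \<mu> N] N(2) by auto
  have "emeasure \<mu> (\<phi> s -` N) = (\<integral>\<^sup>+u. indicator N (\<phi> s u) \<partial>\<mu>)"
    using pre by (simp add: nn_integral_indicator[symmetric] indicator_def vimage_def del: nn_integral_indicator)
  also have "\<dots> \<le> ennreal Q * (\<integral>\<^sup>+u. indicator N u \<partial>\<mu>)"
    using N(2) by (intro nn_integral_generator_le s) auto
  also have "\<dots> = 0" by (simp add: nn_integral_indicator[OF null_setsD2[OF N(2)]] null_setsD1[OF N(2)])
  finally have "\<phi> s -` N \<in> null_sets \<mu>" using pre by auto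
  from AE_not_in[OF this] show ?thesis
    by eventually_elim (use N(1) in auto)
qed

lemma energy_cong_AE:
  assumes s: "s \<in> S" and fg: "AE u in \<mu>. f u = g u"
  shows "energy f (\<phi> s) = energy g (\<phi> s)"
  unfolding energy_def
proof (rule nn_integral_cong_AE)
  show "AE u in \<mu>. ennreal ((norm (f u - f (\<phi> s u)))\<^sup>2) = ennreal ((norm (g u - g (\<phi> s u)))\<^sup>2)"
    using fg AE_generator[OF s fg] by eventually_elim simp
qed

lemma variation_cong_AE:
  assumes fg: "AE u in \<mu>. f u = g u"
  shows "variation f = variation g"
proof -
  obtain N where N: "{u \<in> space \<mu>. \<not> f u = g u} \<subseteq> N" "N \<in> null_sets \<mu>"
    using fg by (auto simp: eventually_ae_filter)
  have null: "N \<times> UNIV \<in> null_sets (\<mu> \<Otimes>\<^sub>M \<mu>)" "UNIV \<times> N \<in> null_sets (\<mu> \<Otimes>\<^sub>M \<mu>)"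
  proof -
    have [simp]: "N \<in> sets \<mu>" "UNIV \<in> sets \<mu>" "emeasure \<mu> N = 0"
      using N(2) sets.top[of \<mu>] by auto
    show "N \<times> UNIV \<in> null_sets (\<mu> \<Otimes>\<^sub>M \<mu>)" "UNIV \<times> N \<in> null_sets (\<mu> \<Otimes>\<^sub>M \<mu>)"
      by (auto simp: null_sets_def emeasure_pair_measure_Times)
  qed
  have "AE z in \<mu> \<Otimes>\<^sub>M \<mu>. z \<notin> N \<times> UNIV \<and> z \<notin> UNIV \<times> N"
    by (intro AE_conjI AE_not_in null)
  then have "AE z in \<mu> \<Otimes>\<^sub>M \<mu>. (case z of (u, v) \<Rightarrow> ennreal ((norm (f u - f v))\<^sup>2))
      = (case z of (u, v) \<Rightarrow> ennreal ((norm (g u - g v))\<^sup>2))"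
  proof eventually_elim
    case (elim z)
    then have "f (fst z) = g (fst z)" "f (snd z) = g (snd z)"
      using N(1) by (cases z; auto)+
    then show ?case by (simp add: case_prod_beta)
  qed
  then show ?thesis unfolding variation_def by (rule nn_integral_cong_AE)
qed

lemma variation_perturb:
  assumes g: "strongly_measurable \<mu> g" and h: "strongly_measurable \<mu> h"
  shows "variation g \<le> 3 * (sq_dist g h + variation h + sq_dist g h)"
proof -
  define a where "a u = ennreal ((norm (g u - h u))\<^sup>2)" for u
  have a [measurable]: "a \<in> borel_measurable \<mu>"
    unfolding a_def by (rule norm_diff2_measurable[OF g h])
  have "strongly_measurable (\<mu> \<Otimes>\<^sub>M \<mu>) (\<lambda>z. h (fst z))" "strongly_measurable (\<mu> \<Otimes>\<^sub>M \<mu>) (\<lambda>z. h (snd z))"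
    by (rule strongly_measurable_compose[OF h], measurable)+
  from strongly_measurable_norm[OF strongly_measurable_diff[OF this]]
  have hm: "(\<lambda>z. ennreal ((norm (h (fst z) - h (snd z)))\<^sup>2)) \<in> borel_measurable (\<mu> \<Otimes>\<^sub>M \<mu>)"
    by measurable
  have "variation g \<le> (\<integral>\<^sup>+z. 3 * (a (fst z) + ennreal ((norm (h (fst z) - h (snd z)))\<^sup>2) + a (snd z)) \<partial>(\<mu> \<Otimes>\<^sub>M \<mu>))"
    unfolding variation_def
  proof (rule nn_integral_mono, clarify)
    fix u v
    show "ennreal ((norm (g u - g v))\<^sup>2) \<le> 3 * (a (fst (u, v)) +
        ennreal ((norm (h (fst (u, v)) - h (snd (u, v))))\<^sup>2) + a (snd (u, v)))"
      using ennreal_norm_add3_square[of "g u - h u" "h u - h v" "h v - g v"]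
      by (simp add: a_def norm_minus_commute)
  qed
  also have "\<dots> = 3 * ((\<integral>\<^sup>+z. a (fst z) \<partial>(\<mu> \<Otimes>\<^sub>M \<mu>))
      + (\<integral>\<^sup>+z. ennreal ((norm (h (fst z) - h (snd z)))\<^sup>2) \<partial>(\<mu> \<Otimes>\<^sub>M \<mu>)) + (\<integral>\<^sup>+z. a (snd z) \<partial>(\<mu> \<Otimes>\<^sub>M \<mu>)))"
    by (rule nn_integral_triple_add) (use hm in measurable)
  also have "(\<integral>\<^sup>+z. a (fst z) \<partial>(\<mu> \<Otimes>\<^sub>M \<mu>)) = sq_dist g h"
    by (subst nn_integral_fst[symmetric]) (auto simp: sq_dist_def a_def[symmetric] emeasure_eq_measure prob_space[simplified])
  also have "(\<integral>\<^sup>+z. a (snd z) \<partial>(\<mu> \<Otimes>\<^sub>M \<mu>)) = sq_dist g h"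
    by (subst nn_integral_fst[symmetric]) (auto simp: sq_dist_def a_def[symmetric] emeasure_eq_measure prob_space[simplified])
  also have "(\<integral>\<^sup>+z. ennreal ((norm (h (fst z) - h (snd z)))\<^sup>2) \<partial>(\<mu> \<Otimes>\<^sub>M \<mu>)) = variation h"
    unfolding variation_def by (rule nn_integral_cong) (simp split: prod.split)
  finally show ?thesis .
qed

lemma energy_perturb:
  assumes g: "strongly_measurable \<mu> g" and h: "strongly_measurable \<mu> h" and s: "s \<in> S"
  shows "energy h (\<phi> s) \<le> 3 * (sq_dist g h + energy g (\<phi> s) + ennreal Q * sq_dist g h)"
proof -
  define a where "a u = ennreal ((norm (g u - h u))\<^sup>2)" for u
  have a: "a \<in> borel_measurable \<mu>"
    unfolding a_def by (rule norm_diff2_measurable[OF g h])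
  have "\<phi> s \<in> measurable \<mu> \<mu>"
    using continuous_measurable[OF generator_continuous[OF s]] measurable_cong_sets[OF refl sets_\<mu>] by blast
  then have as: "(\<lambda>u. a (\<phi> s u)) \<in> borel_measurable \<mu>" using a by (rule measurable_compose)
  note em = energy_measurable[OF g generator_continuous[OF s]]
  have "energy h (\<phi> s) \<le> (\<integral>\<^sup>+u. 3 * (a u + ennreal ((norm (g u - g (\<phi> s u)))\<^sup>2) + a (\<phi> s u)) \<partial>\<mu>)"
    unfolding energy_def
  proof (rule nn_integral_mono)
    fix u
    show "ennreal ((norm (h u - h (\<phi> s u)))\<^sup>2)
        \<le> 3 * (a u + ennreal ((norm (g u - g (\<phi> s u)))\<^sup>2) + a (\<phi> s u))"
      using ennreal_norm_add3_square[of "h u - g u" "g u - g (\<phi> s u)" "g (\<phi> s u) - h (\<phi> s u)"]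
      by (simp add: a_def norm_minus_commute)
  qed
  also have "\<dots> = 3 * (sq_dist g h + energy g (\<phi> s) + (\<integral>\<^sup>+u. a (\<phi> s u) \<partial>\<mu>))"
  proof -
    have "integral\<^sup>N \<mu> a = sq_dist g h"
      unfolding sq_dist_def by (rule nn_integral_cong) (simp add: a_def)
    then show ?thesis
      unfolding nn_integral_triple_add[OF a em as] by (simp only: energy_def)
  qed
  also have "\<dots> \<le> 3 * (sq_dist g h + energy g (\<phi> s) + ennreal Q * sq_dist g h)"
    using nn_integral_generator_le[OF s a] by (intro mult_left_mono add_left_mono) (auto simp: sq_dist_def a_def)
  finally show ?thesis .
qed

text \<open>Both sides of the gap inequality change by a bounded multiple of the squared \<open>L\<^sup>2\<close> distance, up to
  the factor 3 of the triangle inequality for squares, which is lost once on each side.\<close>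

lemma continuous_gap_imp_L2_gap:
  fixes f :: "'y \<Rightarrow> 'x::banach"
  assumes K1: "0 < K1"
    and gap: "\<And>h :: 'y \<Rightarrow> 'x. continuous_on UNIV h \<Longrightarrow>
      variation h \<le> ennreal K1 * (\<Sum>s\<in>S. energy h (\<phi> s))"
    and f: "f \<in> bochner_L2 \<mu>"
  shows "variation f \<le> ennreal (9 * K1) * (\<Sum>s\<in>S. energy f (\<phi> s))"
proof -
  obtain g where g: "strongly_measurable \<mu> g" and fg: "AE u in \<mu>. f u = g u"
    using bochner_measurable_representative f unfolding bochner_L2_def by blast
  have "(\<integral>\<^sup>+u. ennreal ((norm (g u))\<^sup>2) \<partial>\<mu>) = (\<integral>\<^sup>+u. ennreal ((norm (f u))\<^sup>2) \<partial>\<mu>)"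
    by (rule nn_integral_cong_AE) (use fg in eventually_elim, simp)
  then have "approximable g"
    using f g by (intro approximable_L2) (auto simp: bochner_L2_def)
  define E where "E = (\<Sum>s\<in>S. energy g (\<phi> s))"
  define K2 where "K2 = 6 + 9 * K1 * real (card S) * (1 + Q)"
  have Q: "0 \<le> Q" using C_pos by simp
  have K2: "0 < K2" using K1 Q by (simp add: K2_def add_pos_nonneg)
  have "variation g \<le> ennreal (9 * K1) * E"
  proof (rule ennreal_le_epsilon)
    fix \<epsilon> :: real assume \<epsilon>: "0 < \<epsilon>"
    define e where "e = \<epsilon> / K2"
    have e: "0 < e" using \<epsilon> K2 by (simp add: e_def)
    obtain h where h: "continuous_on UNIV h" "sq_dist g h \<le> ennreal e"
      using \<open>approximable g\<close> e unfolding approximable_def by blast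
    note hm = strongly_measurable_continuous[OF h(1)]
    have "(\<Sum>s\<in>S. energy h (\<phi> s)) \<le> (\<Sum>s\<in>S. 3 * (sq_dist g h + energy g (\<phi> s) + ennreal Q * sq_dist g h))"
      by (intro sum_mono energy_perturb g hm)
    also have "\<dots> \<le> (\<Sum>s\<in>S. 3 * (ennreal e + energy g (\<phi> s) + ennreal Q * ennreal e))"
      using h(2) by (intro sum_mono mult_left_mono add_mono) auto
    also have "\<dots> = (\<Sum>s\<in>S. ennreal (3 * (1 + Q) * e) + 3 * energy g (\<phi> s))"
    proof (rule sum.cong[OF refl])
      fix s
      have "3 * (ennreal e + x + ennreal y * ennreal e) = ennreal (3 * (1 + y) * e) + 3 * x"
        if "0 \<le> y" for x y
        using that e by (simp add: ennreal_plus ennreal_mult distrib_left distrib_right add_ac mult_ac)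
      then show "3 * (ennreal e + energy g (\<phi> s) + ennreal Q * ennreal e)
          = ennreal (3 * (1 + Q) * e) + 3 * energy g (\<phi> s)" using Q by blast
    qed
    also have "\<dots> = ennreal (real (card S) * (3 * (1 + Q) * e)) + 3 * E"
      unfolding E_def sum.distrib sum_distrib_left[symmetric]
      using Q e by (simp add: ennreal_mult ennreal_of_nat_eq_real_of_nat)
    finally have sumE: "(\<Sum>s\<in>S. energy h (\<phi> s)) \<le> ennreal (real (card S) * (3 * (1 + Q) * e)) + 3 * E" .
    have "variation g \<le> 3 * (sq_dist g h + variation h + sq_dist g h)"
      by (rule variation_perturb[OF g hm])
    also have "\<dots> \<le> 3 * (ennreal e + ennreal K1 * (ennreal (real (card S) * (3 * (1 + Q) * e)) + 3 * E) + ennreal e)"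
      using h(2) order_trans[OF gap[OF h(1)] mult_left_mono[OF sumE, of "ennreal K1"]]
      by (intro mult_left_mono add_mono) auto
    also have "\<dots> = ennreal (9 * K1) * E + ennreal (6 * e + 9 * K1 * (real (card S) * (1 + Q) * e))"
    proof -
      have "3 * (ennreal e + ennreal K1 * (ennreal (3 * x) + 3 * E) + ennreal e)
          = ennreal (9 * K1) * E + ennreal (6 * e + 9 * K1 * x)" if "0 \<le> x" for x
      proof -
        have "ennreal (6 * e + 9 * K1 * x) = 3 * (ennreal e + ennreal K1 * ennreal (3 * x) + ennreal e)"
          using that e K1 by (simp add: ennreal_plus[symmetric] ennreal_mult[symmetric]
              ennreal_numeral[symmetric] algebra_simps del: ennreal_plus ennreal_numeral)
        moreover have "ennreal (9 * K1) * E = 3 * (ennreal K1 * (3 * E))"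
          using K1 by (simp add: ennreal_mult mult_ac)
        ultimately show ?thesis by (simp add: distrib_left add_ac)
      qed
      from this[of "real (card S) * (1 + Q) * e"] show ?thesis
        using Q e by (simp add: mult_ac)
    qed
    also have "6 * e + 9 * K1 * (real (card S) * (1 + Q) * e) = K2 * e"
      by (simp add: K2_def algebra_simps)
    also have "K2 * e = \<epsilon>" using K2 by (simp add: e_def)
    finally show "variation g \<le> ennreal (9 * K1) * E + ennreal \<epsilon>" .
  qed
  then show ?thesis
    unfolding E_def variation_cong_AE[OF fg] using energy_cong_AE[OF _ fg] by simp
qed

section \<open>Spectral gap and expanders\<close>

lemma exists_net_graph:
  assumes geodesic: "geodesic_space (UNIV :: 'y set)" and t: "0 < t" and \<kappa>: "0 < \<kappa>"
    and gap: "\<And>f::'y \<Rightarrow> 'x::banach. f \<in> bochner_L2 \<mu> \<Longrightarrow>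
      ennreal \<kappa> * variation f \<le> (\<Sum>s\<in>S. energy f (\<phi> s))"
  shows "\<exists>H :: nat pair_pre_digraph.
    pair_graph H \<and> Digraph_Component.connected (with_proj H) \<and>
    (\<forall>v. real (out_degree (with_proj H) v) \<le> (1 + real (card S)) * (C * (2 * (L + 3) + 2) powr m)) \<and>
    1 \<le> real (card (pverts H)) * (C * c * (min (1/t) D) powr m) \<and>
    (\<forall>F :: nat \<Rightarrow> 'x. \<kappa> * (1/4) powr m / ((real (card S) + 1) * C\<^sup>2) / card (pverts H) *
        (\<Sum>(i, j)\<in>pverts H \<times> pverts H. (norm (F i - F j))\<^sup>2)
      \<le> (\<Sum>(i, j)\<in>parcs H. (norm (F i - F j))\<^sup>2)) \<and>
    (\<exists>f. quasi_isometry 5 1 3 UNIV (warped_metric \<phi> S t) (pverts H) (graph_metric H) f)"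
proof -
  define r where "r = min (1/t) D"
  have r: "0 < r" "r \<le> D" using t D_pos by (auto simp: r_def)
  obtain n :: nat and p :: "nat \<Rightarrow> 'y" where "\<forall>i<n. \<forall>j<n. i \<noteq> j \<longrightarrow> r \<le> dist (p i) (p j :: 'y)" "\<forall>u. \<exists>i<n. dist u (p i) < r"
    using net_exists[OF r] by blast
  then interpret net: warped_net \<mu> c m C D \<phi> S J L t r n p
    by unfold_locales (use geodesic t in \<open>auto simp: r_def\<close>)
  show ?thesis
  proof (intro exI[of _ net.net_graph] conjI allI)
    show "1 \<le> real (card (pverts net.net_graph)) * (C * c * (min (1/t) D) powr m)"
      using net.card_net_graph by (simp add: net.pverts_net_graph r_def[symmetric])
    show "\<exists>f. quasi_isometry 5 1 3 UNIV (warped_metric \<phi> S t) (pverts net.net_graph) (graph_metric net.net_graph) f"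
      using net.quasi_isometry_net_graph by blast
    show "\<kappa> * (1/4) powr m / ((real (card S) + 1) * C\<^sup>2) / card (pverts net.net_graph) *
        (\<Sum>(i, j)\<in>pverts net.net_graph \<times> pverts net.net_graph. (norm (F i - F j))\<^sup>2)
      \<le> (\<Sum>(i, j)\<in>parcs net.net_graph. (norm (F i - F j))\<^sup>2)" for F :: "nat \<Rightarrow> 'x"
      using net.gap_imp_poincare[OF \<kappa>] gap unfolding variation_def energy_def by blast
  qed (rule net.pair_graph_net_graph net.connected_net_graph net.degree_net_graph)+
qed

lemma gap_iff_expander:
  assumes geodesic: "geodesic_space (UNIV :: 'y set)"
  shows "(\<exists>\<kappa>>0. \<forall>f::'y \<Rightarrow> 'x::banach. f \<in> bochner_L2 \<mu> \<longrightarrow>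
      ennreal \<kappa> * variation f \<le> (\<Sum>s\<in>S. energy f (\<phi> s))) \<longleftrightarrow>
    (\<exists>G :: real \<Rightarrow> nat pair_pre_digraph.
       expander_wrt TYPE('x) {0<..} G \<and>
       (\<forall>t>0. Digraph_Component.connected (with_proj (G t))) \<and>
       quasi_isometric_families {0<..}
         (\<lambda>t. UNIV) (\<lambda>t. warped_metric \<phi> S t)
         (\<lambda>t. pverts (G t)) (\<lambda>t. graph_metric (G t)))"
    (is "?gap \<longleftrightarrow> ?expander")
proof
  assume ?expander
  then obtain K1 where K1: "0 < K1" "\<And>h :: 'y \<Rightarrow> 'x. continuous_on UNIV h \<Longrightarrow>
      variation h \<le> ennreal K1 * (\<Sum>s\<in>S. energy h (\<phi> s))"
    using expander_imp_continuous_gap by blast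
  show ?gap
  proof (intro exI[of _ "1 / (9 * K1)"] conjI allI impI)
    fix f :: "'y \<Rightarrow> 'x" assume "f \<in> bochner_L2 \<mu>"
    from continuous_gap_imp_L2_gap[OF K1 this]
    have "ennreal (1 / (9 * K1)) * variation f
        \<le> ennreal (1 / (9 * K1)) * (ennreal (9 * K1) * (\<Sum>s\<in>S. energy f (\<phi> s)))"
      by (intro mult_left_mono) auto
    also have "\<dots> = (\<Sum>s\<in>S. energy f (\<phi> s))"
      using K1(1) by (simp add: mult.assoc[symmetric] ennreal_mult[symmetric])
    finally show "ennreal (1 / (9 * K1)) * variation f \<le> (\<Sum>s\<in>S. energy f (\<phi> s))" .
  qed (use K1 in simp)
next
  assume ?gap
  then obtain \<kappa> where \<kappa>: "0 < \<kappa>" and gap: "\<And>f::'y \<Rightarrow> 'x. f \<in> bochner_L2 \<mu> \<Longrightarrow>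
      ennreal \<kappa> * variation f \<le> (\<Sum>s\<in>S. energy f (\<phi> s))" by blast
  define k where "k = nat \<lfloor>(1 + real (card S)) * (C * (2 * (L + 3) + 2) powr m)\<rfloor>"
  define \<eta> where "\<eta> = \<kappa> * (1/4) powr m / ((real (card S) + 1) * C\<^sup>2)"
  have \<eta>: "0 < \<eta>" using \<kappa> C_pos by (simp add: \<eta>_def)
  have "\<forall>t. \<exists>H :: nat pair_pre_digraph. 0 < t \<longrightarrow>
    (pair_graph H \<and> Digraph_Component.connected (with_proj H) \<and>
    (\<forall>v. real (out_degree (with_proj H) v) \<le> (1 + real (card S)) * (C * (2 * (L + 3) + 2) powr m)) \<and>
    1 \<le> real (card (pverts H)) * (C * c * (min (1/t) D) powr m) \<and>
    (\<forall>F :: nat \<Rightarrow> 'x. \<eta> / card (pverts H) *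
        (\<Sum>(i, j)\<in>pverts H \<times> pverts H. (norm (F i - F j))\<^sup>2)
      \<le> (\<Sum>(i, j)\<in>parcs H. (norm (F i - F j))\<^sup>2)) \<and>
    (\<exists>f. quasi_isometry 5 1 3 UNIV (warped_metric \<phi> S t) (pverts H) (graph_metric H) f))"
    using exists_net_graph[OF geodesic _ \<kappa> gap] unfolding \<eta>_def by blast
  from choice[OF this] obtain G :: "real \<Rightarrow> nat pair_pre_digraph" where
    G: "\<And>t. 0 < t \<Longrightarrow> pair_graph (G t)"
      "\<And>t. 0 < t \<Longrightarrow> Digraph_Component.connected (with_proj (G t))"
      "\<And>t v. 0 < t \<Longrightarrow> real (out_degree (with_proj (G t)) v) \<le> (1 + real (card S)) * (C * (2 * (L + 3) + 2) powr m)"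
      "\<And>t. 0 < t \<Longrightarrow> 1 \<le> real (card (pverts (G t))) * (C * c * (min (1/t) D) powr m)"
      "\<And>t (F :: nat \<Rightarrow> 'x). 0 < t \<Longrightarrow> \<eta> / card (pverts (G t)) *
        (\<Sum>(i, j)\<in>pverts (G t) \<times> pverts (G t). (norm (F i - F j))\<^sup>2)
      \<le> (\<Sum>(i, j)\<in>parcs (G t). (norm (F i - F j))\<^sup>2)"
      "\<And>t. 0 < t \<Longrightarrow> \<exists>f. quasi_isometry 5 1 3 UNIV (warped_metric \<phi> S t) (pverts (G t)) (graph_metric (G t)) f"
    by blast
  \<comment> \<open>the number of vertices is at least of order \<open>1 / (r powr m)\<close>, where \<open>r\<close> tends to 0 as \<open>t\<close> grows\<close>
  have large: "\<exists>t>0. n < card (pverts (G t))" for n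
  proof -
    define b where "b = 1 / ((real n + 1) * 2 * (C * c))"
    have b: "0 < b" using C_pos c_pos by (simp add: b_def)
    define r where "r = min (b powr (1/m)) D"
    have r: "0 < r" "r \<le> D" using b D_pos by (auto simp: r_def)
    define t where "t = 1 / r"
    have t: "0 < t" "min (1/t) D = r" using r by (auto simp: t_def)
    have "r powr m \<le> (b powr (1/m)) powr m"
      using r m_pos by (intro powr_mono2) (auto simp: r_def)
    also have "\<dots> = b" using b m_pos by (simp add: powr_powr)
    finally have "C * c * r powr m \<le> C * c * b" using C_pos c_pos by (intro mult_left_mono) auto
    also have "\<dots> = 1 / ((real n + 1) * 2)" using C_pos c_pos by (simp add: b_def)
    finally have "real (card (pverts (G t))) * (C * c * r powr m)
        \<le> real (card (pverts (G t))) * (1 / ((real n + 1) * 2))"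
      by (rule mult_left_mono) simp
    with G(4)[OF t(1)] have "1 \<le> real (card (pverts (G t))) * (1 / ((real n + 1) * 2))"
      unfolding t(2) by linarith
    then have "1 * ((real n + 1) * 2) \<le> real (card (pverts (G t))) * (1 / ((real n + 1) * 2)) * ((real n + 1) * 2)"
      by (rule mult_right_mono) simp
    then have "(real n + 1) * 2 \<le> real (card (pverts (G t)))" by simp
    moreover have "real n < (real n + 1) * 2" by (simp add: algebra_simps)
    ultimately have "real n < real (card (pverts (G t)))" by (rule less_le_trans[rotated])
    then have "n < card (pverts (G t))" by simp
    with t(1) show ?thesis by blast
  qed
  show ?expander
  proof (intro exI[of _ G] conjI allI impI)
    show "expander_wrt TYPE('x) {0<..} G"
      unfolding expander_wrt_def
    proof (intro conjI)
      show "\<forall>t\<in>{0<..}. pair_graph (G t)" using G(1) by simp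
      show "\<exists>k. \<forall>t\<in>{0<..}. \<forall>v\<in>pverts (G t). out_degree (with_proj (G t)) v \<le> k"
        using G(3) by (intro exI[of _ k]) (auto simp: k_def intro!: le_nat_floor)
      show "\<forall>n. \<exists>t\<in>{0<..}. card (pverts (G t)) > n" using large by (metis greaterThan_iff)
      show "\<exists>\<eta>>0. \<forall>t\<in>{0<..}. \<forall>f::nat \<Rightarrow> 'x.
           (\<Sum>(x, y)\<in>parcs (G t). (norm (f x - f y))\<^sup>2) \<ge>
           \<eta> / card (pverts (G t)) *
             (\<Sum>(x, y)\<in>pverts (G t) \<times> pverts (G t). (norm (f x - f y))\<^sup>2)"
        using \<eta> G(5) by (intro exI[of _ \<eta>]) auto
    qed
    show "quasi_isometric_families {0<..} (\<lambda>t. UNIV) (\<lambda>t. warped_metric \<phi> S t)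
         (\<lambda>t. pverts (G t)) (\<lambda>t. graph_metric (G t))"
      unfolding quasi_isometric_families_def
      using G(6) by (intro exI[of _ 5] exI[of _ 1] exI[of _ 3]) auto
  qed (rule G(2))
qed

end

theorem theorem1p1:
  fixes \<mu> :: "'y::metric_space measure"
    and \<Gamma> :: "('g, 'b) monoid_scheme"
    and \<phi> :: "'g \<Rightarrow> 'y \<Rightarrow> 'y"
    and S :: "'g set"
  assumes compact: "compact (UNIV :: 'y set)"
    and geodesic: "geodesic_space (UNIV :: 'y set)"
    and nontrivial: "\<exists>x y :: 'y. x \<noteq> y"
    and borel: "sets \<mu> = sets borel"
    and prob: "prob_space \<mu>"
    and ahlfors: "ahlfors_regular \<mu>"
    and action: "group_action \<Gamma> (UNIV :: 'y set) \<phi>"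
    and lipschitz: "\<And>g. g \<in> carrier \<Gamma> \<Longrightarrow> lipschitz_homeomorphism (\<phi> g)"
    and S_fin: "finite S"
    and S_carrier: "S \<subseteq> carrier \<Gamma>"
    and S_inv: "\<And>s. s \<in> S \<Longrightarrow> inv\<^bsub>\<Gamma>\<^esub> s \<in> S"
    and S_gen: "generate \<Gamma> S = carrier \<Gamma>"
  shows "spectral_gap TYPE('x::banach) \<Gamma> \<phi> S \<mu> \<longleftrightarrow>
    (\<exists>G :: real \<Rightarrow> nat pair_pre_digraph.
       expander_wrt TYPE('x) {0<..} G \<and>
       (\<forall>t>0. Digraph_Component.connected (with_proj (G t))) \<and>
       quasi_isometric_families {0<..}
         (\<lambda>t. UNIV) (\<lambda>t. warped_metric \<phi> S t)
         (\<lambda>t. pverts (G t)) (\<lambda>t. graph_metric (G t)))"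
proof -
  interpret action: group_action \<Gamma> UNIV \<phi> by fact
  interpret group \<Gamma> using action.group_hom group_hom.axioms(1) by auto
  let ?D = "diameter (UNIV :: 'y set)"
  have bdd: "bounded (UNIV :: 'y set)" by (rule compact_imp_bounded[OF compact])
  have dist_le: "dist x y \<le> ?D" for x y :: 'y
    using diameter_bounded_bound[OF bdd] by simp
  obtain x y :: 'y where "x \<noteq> y" using nontrivial by blast
  then have D_pos: "0 < ?D" using dist_le[of x y] by (metis dist_pos_lt less_le_trans)
  obtain c m C where cmC: "0 < c" "0 < m" "1 \<le> C"
    and balls: "\<And>(y::'y) r. 0 < r \<Longrightarrow> r \<le> 2 * ?D \<Longrightarrow>
      c * r powr m \<le> measure \<mu> (ball y r) \<and> measure \<mu> (ball y r) \<le> C * c * r powr m"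
    using ahlfors unfolding ahlfors_regular_def by metis
  have "\<forall>s\<in>S. \<exists>L. L-lipschitz_on UNIV (\<phi> s)"
    using lipschitz S_carrier unfolding lipschitz_homeomorphism_def by blast
  then obtain l where l: "\<And>s. s \<in> S \<Longrightarrow> (l s)-lipschitz_on UNIV (\<phi> s)" by metis
  define L where "L = 1 + (\<Sum>s\<in>S. l s)"
  have l0: "0 \<le> l s" if "s \<in> S" for s using l[OF that] by (rule lipschitz_on_nonneg)
  have lL: "l s \<le> L" if "s \<in> S" for s
    using member_le_sum[OF that, of l] l0 S_fin by (simp add: L_def)
  interpret prob_space \<mu> by fact
  interpret lipschitz_action \<mu> c m C ?D \<phi> S "\<lambda>s. inv\<^bsub>\<Gamma>\<^esub> s" L
  proof unfold_locales
    show "1 \<le> L" using l0 by (simp add: L_def sum_nonneg)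
    fix s x y assume s: "s \<in> S"
    then show "inv\<^bsub>\<Gamma>\<^esub> (inv\<^bsub>\<Gamma>\<^esub> s) = s" using S_carrier by auto
    show "\<phi> (inv\<^bsub>\<Gamma>\<^esub> s) (\<phi> s y) = y"
      using action.orbit_sym_aux[of s y] s S_carrier by auto
    have "dist (\<phi> s x) (\<phi> s y) \<le> l s * dist x y" by (rule lipschitz_onD[OF l[OF s]]) auto
    also have "\<dots> \<le> L * dist x y" using lL[OF s] by (intro mult_right_mono) auto
    finally show "dist (\<phi> s x) (\<phi> s y) \<le> L * dist x y" .
  qed (use compact borel D_pos dist_le cmC balls S_fin S_inv in auto)
  \<comment> \<open>inversion permutes the generators\<close>
  have reindex: "(\<Sum>s\<in>S. \<integral>\<^sup>+u. ennreal ((norm (f u - f (\<phi> (inv\<^bsub>\<Gamma>\<^esub> s) u)))\<^sup>2) \<partial>\<mu>)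
      = (\<Sum>s\<in>S. energy f (\<phi> s))" for f :: "'y \<Rightarrow> 'x"
    unfolding energy_def
    by (rule sum.reindex_bij_witness[where i = "\<lambda>s. inv\<^bsub>\<Gamma>\<^esub> s" and j = "\<lambda>s. inv\<^bsub>\<Gamma>\<^esub> s"])
      (use S_inv S_carrier in auto)
  have "spectral_gap TYPE('x) \<Gamma> \<phi> S \<mu> \<longleftrightarrow> (\<exists>\<kappa>>0. \<forall>f::'y \<Rightarrow> 'x. f \<in> bochner_L2 \<mu> \<longrightarrow>
      ennreal \<kappa> * variation f \<le> (\<Sum>s\<in>S. energy f (\<phi> s)))"
    unfolding spectral_gap_def reindex variation_def by blast
  then show ?thesis
    using gap_iff_expander[OF geodesic, where 'x = 'x] by simp
qed

end
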